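(* Let $A$ be a commutative QLC algebra over a field $k$ of characteristic zero, and let $\mathfrak G=((qA)^{¡},\tilde\phi,\tilde\theta)$ be its Koszul dual curved Lie coalgebra. Suppose $qA$ is Koszul. Then the morphism of commutative DG algebras $g_\kappa:\boldsymbol\Omega_{\mathtt{Lie}}(\mathfrak G)\to A$ is a quasi-isomorphism.
   Context: Conventions. $k$ has characteristic zero; homological gradings, differentials of degree $-1$, Koszul sign rule; $sV$ is the suspension, $(sV)_i=V_{i-1}$, and $W[-1]=s^{-1}W$. $\mathbf{Sym}$ is the graded symmetric algebra. A graded Lie coalgebra is a graded vector space $\mathfrak G$ with a degree $0$ cobracket $]-[\,:\mathfrak G\to\mathfrak G\otimes\mathfrak G$ satisfying $\tau_{(12)}\circ]-[\,=-\,]-[$ and the co-Jacobi identity $(\mathrm{id}+\tau_{(123)}+\tau_{(123)}^2)\circ(]-[\otimes\mathrm{id})\circ]-[\,=0$. A curved DG Lie coalgebra $(\mathfrak G,d,h)$ is a graded Lie coalgebra with a degree $-1$ Lie coderivation $d$ and a degree $-2$ linear map $h:\mathfrak G\to k$ with $d^2=(h\otimes\mathrm{id})\circ]-[$ and $hd=0$. Its Lie cobar construction $\boldsymbol\Omega_{\mathtt{Lie}}(\mathfrak G)$ is the commutative DG algebra $\mathbf{Sym}(\mathfrak G[-1])$ with differential $d_0+d_1+d_2$, derivations determined by $d_0(s^{-1}\xi)=h(\xi)$, $d_1(s^{-1}\xi)=-s^{-1}d\xi$, $d_2(s^{-1}\xi)=-\frac12\sum_i(-1)^{|\xi_i'|}s^{-1}\xi_i'\cdot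 s^{-1}\xi_i''$ where $]\xi[\,=\sum_i\xi_i'\otimes\xi_i''$. Commutative QLC algebras. $V$ is a vector space in degree $0$, $R\subset k\oplus V\oplus\mathrm{Sym}^2(V)$ a subspace, $A=\mathrm{Sym}(V)/(R)$ (zero differential). It is assumed throughout that $R\cap(k\oplus V)=\{0\}$ and $(R)\cap(k\oplus V\oplus\mathrm{Sym}^2(V))=R$. Let $q:\mathrm{Sym}(V)\to\mathrm{Sym}^2(V)$ be the projection, $qR=q(R)$, and $\phi:qR\to V$, $\theta:qR\to k$ the unique linear maps with $R=\{x-\phi(x)+\theta(x)\mid x\in qR\}$. $qA:=\overline{\mathrm{Sym}(V)}/(qR)$ is the associated nonunital commutative quadratic algebra, $\overline{\mathrm{Sym}(V)}=\mathrm{Sym}(V)/k$. Koszul dual curved Lie coalgebra. Let $L^c(sV)$ be the cofree (conilpotent) graded Lie coalgebra on $sV$; its weight $2$ part $\wedge^2(sV)$ is identified with $s^2\mathrm{Sym}^2(V)$ so that $s^2(vw)$ has cobracket $sv\otimes sw+sw\otimes sv$. $(qA)^{¡}$ is the universal Lie subcoalgebra of $L^c(sV)$ among those whose composite to $\wedge^2(sV)/s^2qR$ vanishes; it is weight graded with weight $1$ part $sV$ and weight $2$ part $s^2qR$. $\tilde\phi$ is the degree $-1$ Lie coderivation of $(qA)^{¡}$ determined by $(qA)^{¡}\twoheadrightarrow s^2qR\to sV$, $s^2x\mapsto s\phi(x)$, and $\tilde\theta:(qA)^{¡}\twoheadrightarrow s^2qR\to k$, $s^2x\mapsto\theta(x)$.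 This is a curved DG Lie coalgebra. $\kappa$ is the degree $-1$ map $(qA)^{¡}\twoheadrightarrow sV\xrightarrow{s^{-1}}V\hookrightarrow A$, and $g_\kappa$ is the algebra map with $g_\kappa(s^{-1}\xi)=\kappa(\xi)$; it is a morphism of commutative DG algebras. Koszulness. $qA$ is Koszul if the canonical projection from the cobar construction of the (uncurved, zero coderivation) Lie coalgebra $(qA)^{¡}$ to $qA$ is a quasi-isomorphism; equivalently, the DG algebra map $(\mathbf{Sym}((qA)^{¡}[-1]),d_2)\to k\oplus qA$ induced by $(qA)^{¡}\twoheadrightarrow sV\xrightarrow{s^{-1}}V\hookrightarrow qA$ is a quasi-isomorphism. *)

theory Defs
  imports Complex_Main "HOL-Library.Function_Algebras"
begin

text \<open>
  Vector spaces given by generators and relations.  A vector space presented by generators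
  \<open>w\<close> and linear relations is determined by the set \<open>\<Phi>\<close> of those \<open>k\<close>-valued functions on
  generators that respect the relations: it is the quotient of the free vector space by the
  common kernel of \<open>\<Phi>\<close>, i.e. (over a field) the span of the evaluation functionals
  \<open>ev \<Phi> w\<close> on \<open>\<Phi>\<close>.  Thus \<open>ev \<Phi> w\<close> is the class of the generator \<open>w\<close>.  In this theory the
  generators are words.
\<close>

type_synonym ('a, 'k) words = "('a list \<Rightarrow> 'k) \<Rightarrow> 'k"

definition fscale :: "'k::field \<Rightarrow> ('m \<Rightarrow> 'k) \<Rightarrow> ('m \<Rightarrow> 'k)"
  where "fscale c F = (\<lambda>m. c * F m)"

abbreviation fspan :: "('m \<Rightarrow> 'k::field) set \<Rightarrow> ('m \<Rightarrow> 'k) set"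
  where "fspan \<equiv> module.span fscale"

abbreviation fsubspace :: "('m \<Rightarrow> 'k::field) set \<Rightarrow> bool"
  where "fsubspace \<equiv> module.subspace fscale"

lemma vector_space_fscale: "vector_space (fscale :: 'k::field \<Rightarrow> ('m \<Rightarrow> 'k) \<Rightarrow> ('m \<Rightarrow> 'k))"
  by unfold_locales (auto simp: fscale_def algebra_simps)

definition ev :: "('a list \<Rightarrow> 'k::field) set \<Rightarrow> 'a list \<Rightarrow> ('a, 'k) words"
  where "ev \<Phi> w = (\<lambda>M. if M \<in> \<Phi> then M w else 0)"

text \<open>\<open>lift \<Phi> f\<close> is the linear map, into a space presented by \<open>\<Phi>\<close>, which sends (the class of)
  each generator \<open>w\<close> to \<open>f w\<close>; this is meaningful when \<open>f\<close> respects the relations, see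
  \<open>lift_ev\<close>.\<close>

definition lift :: "('b list \<Rightarrow> 'k::field) set \<Rightarrow> ('a list \<Rightarrow> ('b, 'k) words)
    \<Rightarrow> ('a, 'k) words \<Rightarrow> ('b, 'k) words"
  where "lift \<Phi> f F = (\<lambda>M. if M \<in> \<Phi> then F (\<lambda>w. f w M) else 0)"

lemma lift_ev:
  assumes "\<And>M. M \<in> \<Phi> \<Longrightarrow> (\<lambda>u. f u M) \<in> \<Psi>" and "\<And>M. M \<notin> \<Phi> \<Longrightarrow> f w M = 0"
  shows "lift \<Phi> f (ev \<Psi> w) = f w"
  using assms by (auto simp: lift_def ev_def)

lemma lift_add: "lift \<Phi> f (F + G) = lift \<Phi> f F + lift \<Phi> f G"
  by (auto simp: lift_def)

lemma lift_fscale: "lift \<Phi> f (fscale c F) = fscale c (lift \<Phi> f F)"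
  by (auto simp: lift_def fscale_def)

definition conc :: "('a list \<Rightarrow> 'k::field) set \<Rightarrow> ('a, 'k) words \<Rightarrow> ('a, 'k) words \<Rightarrow> ('a, 'k) words"
  where "conc \<Phi> F G = lift \<Phi> (\<lambda>u. lift \<Phi> (\<lambda>v. ev \<Phi> (u @ v)) G) F"


section \<open>Graded vector spaces, tensor powers, symmetric algebras\<close>

text \<open>A graded vector space is the family of its homogeneous parts, inside an ambient space.
  Suspension does not change the underlying elements, only their degree, so \<open>s x\<close> and
  \<open>s\<^sup>-\<^sup>1 x\<close> are both written \<open>x\<close>.\<close>

definition homs :: "(int \<Rightarrow> 'a set) \<Rightarrow> 'a set"
  where "homs G = (\<Union>n. G n)"

definition total :: "(int \<Rightarrow> ('m \<Rightarrow> 'k::field) set) \<Rightarrow> ('m \<Rightarrow> 'k) set"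
  where "total G = fspan (homs G)"

definition shift :: "int \<Rightarrow> (int \<Rightarrow> 'a set) \<Rightarrow> int \<Rightarrow> 'a set"
  where "shift m G = (\<lambda>n. G (n - m))"

definition degree_zero :: "int \<Rightarrow> 'v::zero set"
  where "degree_zero n = (if n = 0 then UNIV else {0})"

text \<open>Only used for homogeneous elements.  The degree of \<open>0\<close> is unspecified, which is
  harmless since a word with a letter \<open>0\<close> represents \<open>0\<close>.\<close>

definition deg :: "(int \<Rightarrow> 'a set) \<Rightarrow> 'a \<Rightarrow> int"
  where "deg G x = (SOME n. x \<in> G n)"

definition ksign :: "int \<Rightarrow> 'k::field"
  where "ksign n = (if even n then 1 else - 1)"

text \<open>The relations of the tensor algebra.  Since the tensor product of direct sums is the
  direct sum of tensor products, it suffices to consider words in homogeneous letters.\<close>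

definition multilin :: "('k::field \<Rightarrow> 'a::ab_group_add \<Rightarrow> 'a) \<Rightarrow> (int \<Rightarrow> 'a set) \<Rightarrow> ('a list \<Rightarrow> 'k) set"
  where "multilin sc G = {M. \<forall>us vs n x y c.
     set us \<subseteq> homs G \<longrightarrow> set vs \<subseteq> homs G \<longrightarrow> x \<in> G n \<longrightarrow> y \<in> G n \<longrightarrow>
       M (us @ (x + y) # vs) = M (us @ x # vs) + M (us @ y # vs) \<and>
       M (us @ sc c x # vs) = c * M (us @ x # vs)}"

definition sym_forms :: "('k::field \<Rightarrow> 'a::ab_group_add \<Rightarrow> 'a) \<Rightarrow> (int \<Rightarrow> 'a set) \<Rightarrow> ('a list \<Rightarrow> 'k) set"
  where "sym_forms sc G = {M \<in> multilin sc G. \<forall>us vs m n x y.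
     set us \<subseteq> homs G \<longrightarrow> set vs \<subseteq> homs G \<longrightarrow> x \<in> G m \<longrightarrow> y \<in> G n \<longrightarrow>
       M (us @ x # y # vs) = ksign (m * n) * M (us @ y # x # vs)}"

text \<open>Degree \<open>n\<close> part of an algebra generated by \<open>G\<close>.  With \<open>\<Phi> = sym_forms sc G\<close> this is the
  degree \<open>n\<close> part of the graded symmetric algebra \<open>Sym(G)\<close>, with product \<open>conc \<Phi>\<close>, unit
  \<open>ev \<Phi> []\<close> and generators \<open>ev \<Phi> [x]\<close>.\<close>

definition alg_part :: "('a list \<Rightarrow> 'k::field) set \<Rightarrow> (int \<Rightarrow> 'a set) \<Rightarrow> int \<Rightarrow> ('a, 'k) words set"
  where "alg_part \<Phi> G n = fspan {ev \<Phi> w | w. set w \<subseteq> homs G \<and> sum_list (map (deg G) w) = n}"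

text \<open>The algebra map extending \<open>f\<close>, and the derivation of odd degree extending \<open>f\<close>.\<close>

definition alg_extend :: "('b list \<Rightarrow> 'k::field) set \<Rightarrow> ('a \<Rightarrow> ('b, 'k) words)
    \<Rightarrow> ('a, 'k) words \<Rightarrow> ('b, 'k) words"
  where "alg_extend \<Phi> f = lift \<Phi> (\<lambda>w. foldr (conc \<Phi>) (map f w) (ev \<Phi> []))"

definition der_extend :: "('a list \<Rightarrow> 'k::field) set \<Rightarrow> (int \<Rightarrow> 'a set) \<Rightarrow> ('a \<Rightarrow> ('a, 'k) words)
    \<Rightarrow> ('a, 'k) words \<Rightarrow> ('a, 'k) words"
  where "der_extend \<Phi> G f = lift \<Phi> (\<lambda>w. \<Sum>i<length w.
     fscale (ksign (sum_list (map (deg G) (take i w))))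
       (conc \<Phi> (ev \<Phi> (take i w)) (conc \<Phi> (f (w ! i)) (ev \<Phi> (drop (Suc i) w)))))"

definition tensor_square :: "(int \<Rightarrow> ('m \<Rightarrow> 'k::field) set) \<Rightarrow> (int \<Rightarrow> ('m \<Rightarrow> 'k) set)
    \<Rightarrow> ('m \<Rightarrow> 'k, 'k) words set"
    \<comment> \<open>the image of \<open>C \<otimes> C\<close> in \<open>G \<otimes> G\<close>, where \<open>C \<subseteq> G\<close>\<close>
  where "tensor_square G C = fspan {ev (multilin fscale G) [x, y] | x y. x \<in> homs C \<and> y \<in> homs C}"


section \<open>Chain complexes and quasi-isomorphisms\<close>

definition lin_on :: "('m \<Rightarrow> 'k::field) set \<Rightarrow> (('m \<Rightarrow> 'k) \<Rightarrow> ('n \<Rightarrow> 'k)) \<Rightarrow> bool"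
  where "lin_on S f \<longleftrightarrow>
     (\<forall>x\<in>S. \<forall>y\<in>S. f (x + y) = f x + f y) \<and> (\<forall>c. \<forall>x\<in>S. f (fscale c x) = fscale c (f x))"

definition chain_complex :: "(int \<Rightarrow> ('m \<Rightarrow> 'k::field) set) \<Rightarrow> (('m \<Rightarrow> 'k) \<Rightarrow> ('m \<Rightarrow> 'k)) \<Rightarrow> bool"
  where "chain_complex C d \<longleftrightarrow> (\<forall>n. fsubspace (C n) \<and> lin_on (C n) d \<and>
     (\<forall>x \<in> C n. d x \<in> C (n - 1) \<and> d (d x) = 0))"

definition chain_map :: "(int \<Rightarrow> ('m \<Rightarrow> 'k::field) set) \<Rightarrow> (('m \<Rightarrow> 'k) \<Rightarrow> ('m \<Rightarrow> 'k)) \<Rightarrow>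
    (int \<Rightarrow> ('n \<Rightarrow> 'k) set) \<Rightarrow> (('n \<Rightarrow> 'k) \<Rightarrow> ('n \<Rightarrow> 'k)) \<Rightarrow> (('m \<Rightarrow> 'k) \<Rightarrow> ('n \<Rightarrow> 'k)) \<Rightarrow> bool"
  where "chain_map C d C' d' f \<longleftrightarrow> (\<forall>n. lin_on (C n) f \<and>
     (\<forall>x \<in> C n. f x \<in> C' n \<and> f (d x) = d' (f x)))"

definition cycles :: "(int \<Rightarrow> ('m \<Rightarrow> 'k::field) set) \<Rightarrow> (('m \<Rightarrow> 'k) \<Rightarrow> ('m \<Rightarrow> 'k)) \<Rightarrow> int \<Rightarrow> ('m \<Rightarrow> 'k) set"
  where "cycles C d n = {x \<in> C n. d x = 0}"

definition boundaries :: "(int \<Rightarrow> ('m \<Rightarrow> 'k::field) set) \<Rightarrow> (('m \<Rightarrow> 'k) \<Rightarrow> ('m \<Rightarrow> 'k)) \<Rightarrow> int \<Rightarrow> ('m \<Rightarrow> 'k) set"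
  where "boundaries C d n = d ` C (n + 1)"

definition homology :: "(int \<Rightarrow> ('m \<Rightarrow> 'k::field) set) \<Rightarrow> (('m \<Rightarrow> 'k) \<Rightarrow> ('m \<Rightarrow> 'k)) \<Rightarrow> int \<Rightarrow> ('m \<Rightarrow> 'k) set set"
  where "homology C d n = (\<lambda>x. {x + b | b. b \<in> boundaries C d n}) ` cycles C d n"

definition homology_map :: "(int \<Rightarrow> ('n \<Rightarrow> 'k::field) set) \<Rightarrow> (('n \<Rightarrow> 'k) \<Rightarrow> ('n \<Rightarrow> 'k)) \<Rightarrow>
    (('m \<Rightarrow> 'k) \<Rightarrow> ('n \<Rightarrow> 'k)) \<Rightarrow> int \<Rightarrow> ('m \<Rightarrow> 'k) set \<Rightarrow> ('n \<Rightarrow> 'k) set"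
  where "homology_map C' d' f n X = {f x + b | x b. x \<in> X \<and> b \<in> boundaries C' d' n}"

definition quasi_isomorphism :: "(int \<Rightarrow> ('m \<Rightarrow> 'k::field) set) \<Rightarrow> (('m \<Rightarrow> 'k) \<Rightarrow> ('m \<Rightarrow> 'k)) \<Rightarrow>
    (int \<Rightarrow> ('n \<Rightarrow> 'k) set) \<Rightarrow> (('n \<Rightarrow> 'k) \<Rightarrow> ('n \<Rightarrow> 'k)) \<Rightarrow> (('m \<Rightarrow> 'k) \<Rightarrow> ('n \<Rightarrow> 'k)) \<Rightarrow> bool"
  where "quasi_isomorphism C d C' d' f \<longleftrightarrow>
     chain_complex C d \<and> chain_complex C' d' \<and> chain_map C d C' d' f \<and>
     (\<forall>n. bij_betw (homology_map C' d' f n) (homology C d n) (homology C' d' n))"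


section \<open>Lie coderivations and the Lie cobar construction\<close>

text \<open>In this section \<open>G\<close> is a graded space and \<open>\<delta>\<close> its cobracket, with values in
  \<open>tensor_square G G\<close>.\<close>

definition lie_coderivation :: "(int \<Rightarrow> ('m \<Rightarrow> 'k::field) set) \<Rightarrow> (('m \<Rightarrow> 'k) \<Rightarrow> ('m \<Rightarrow> 'k, 'k) words)
    \<Rightarrow> (('m \<Rightarrow> 'k) \<Rightarrow> ('m \<Rightarrow> 'k)) \<Rightarrow> bool"
    \<comment> \<open>of degree \<open>-1\<close>; the sign is the Koszul sign of \<open>id \<otimes> d\<close>\<close>
  where "lie_coderivation G \<delta> d \<longleftrightarrow> lin_on (total G) d \<and> (\<forall>n. d ` G n \<subseteq> G (n - 1)) \<and>
     (\<forall>\<xi> \<in> total G. \<delta> (d \<xi>) = lift (multilin fscale G) (\<lambda>w. case w of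
          [x, y] \<Rightarrow> ev (multilin fscale G) [d x, y] +
                    fscale (ksign (deg G x)) (ev (multilin fscale G) [x, d y])
        | _ \<Rightarrow> 0) (\<delta> \<xi>))"

definition cobar_forms :: "(int \<Rightarrow> ('m \<Rightarrow> 'k::field) set) \<Rightarrow> (('m \<Rightarrow> 'k) list \<Rightarrow> 'k) set"
  where "cobar_forms G = sym_forms fscale (shift (- 1) G)"

definition cobar :: "(int \<Rightarrow> ('m \<Rightarrow> 'k::field) set) \<Rightarrow> int \<Rightarrow> ('m \<Rightarrow> 'k, 'k) words set"
  where "cobar G = alg_part (cobar_forms G) (shift (- 1) G)"

definition cobar_d0 :: "(int \<Rightarrow> ('m \<Rightarrow> 'k::field) set) \<Rightarrow> (('m \<Rightarrow> 'k) \<Rightarrow> 'k)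
    \<Rightarrow> ('m \<Rightarrow> 'k) \<Rightarrow> ('m \<Rightarrow> 'k, 'k) words"
  where "cobar_d0 G h \<xi> = fscale (h \<xi>) (ev (cobar_forms G) [])"

definition cobar_d1 :: "(int \<Rightarrow> ('m \<Rightarrow> 'k::field) set) \<Rightarrow> (('m \<Rightarrow> 'k) \<Rightarrow> ('m \<Rightarrow> 'k))
    \<Rightarrow> ('m \<Rightarrow> 'k) \<Rightarrow> ('m \<Rightarrow> 'k, 'k) words"
  where "cobar_d1 G d \<xi> = - ev (cobar_forms G) [d \<xi>]"

definition cobar_d2 :: "(int \<Rightarrow> ('m \<Rightarrow> 'k::field) set) \<Rightarrow> (('m \<Rightarrow> 'k) \<Rightarrow> ('m \<Rightarrow> 'k, 'k) words)
    \<Rightarrow> ('m \<Rightarrow> 'k) \<Rightarrow> ('m \<Rightarrow> 'k, 'k) words"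
    \<comment> \<open>the sign involves the degree of \<open>x\<close> in \<open>G\<close>, not in the desuspension\<close>
  where "cobar_d2 G \<delta> \<xi> = fscale (- (1 / 2)) (lift (cobar_forms G) (\<lambda>w. case w of
       [x, y] \<Rightarrow> fscale (ksign (deg G x))
                   (conc (cobar_forms G) (ev (cobar_forms G) [x]) (ev (cobar_forms G) [y]))
     | _ \<Rightarrow> 0) (\<delta> \<xi>))"

definition cobar_diff :: "(int \<Rightarrow> ('m \<Rightarrow> 'k::field) set) \<Rightarrow> (('m \<Rightarrow> 'k) \<Rightarrow> ('m \<Rightarrow> 'k, 'k) words)
    \<Rightarrow> (('m \<Rightarrow> 'k) \<Rightarrow> ('m \<Rightarrow> 'k)) \<Rightarrow> (('m \<Rightarrow> 'k) \<Rightarrow> 'k)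
    \<Rightarrow> ('m \<Rightarrow> 'k, 'k) words \<Rightarrow> ('m \<Rightarrow> 'k, 'k) words"
  where "cobar_diff G \<delta> d h F =
     der_extend (cobar_forms G) (shift (- 1) G) (cobar_d0 G h) F +
     der_extend (cobar_forms G) (shift (- 1) G) (cobar_d1 G d) F +
     der_extend (cobar_forms G) (shift (- 1) G) (cobar_d2 G \<delta>) F"


section \<open>Commutative QLC algebras\<close>

text \<open>\<open>V\<close> is the whole type \<open>'v\<close> with scalar multiplication \<open>sc\<close>, placed in degree \<open>0\<close>.\<close>

definition symV_forms :: "('k::field \<Rightarrow> 'v::ab_group_add \<Rightarrow> 'v) \<Rightarrow> ('v list \<Rightarrow> 'k) set"
  where "symV_forms sc = sym_forms sc degree_zero"

definition symV_upto :: "('k::field \<Rightarrow> 'v::ab_group_add \<Rightarrow> 'v) \<Rightarrow> nat \<Rightarrow> ('v, 'k) words set"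
    \<comment> \<open>\<open>k \<oplus> V \<oplus> \<dots> \<oplus> Sym\<^sup>n(V)\<close>\<close>
  where "symV_upto sc n = fspan {ev (symV_forms sc) w | w. length w \<le> n}"

definition weight_proj :: "('a list \<Rightarrow> 'k::field) set \<Rightarrow> nat \<Rightarrow> ('a, 'k) words \<Rightarrow> ('a, 'k) words"
  where "weight_proj \<Phi> n = lift \<Phi> (\<lambda>w. if length w = n then ev \<Phi> w else 0)"

definition ideal :: "('k::field \<Rightarrow> 'v::ab_group_add \<Rightarrow> 'v) \<Rightarrow> ('v, 'k) words set \<Rightarrow> ('v, 'k) words set"
  where "ideal sc R = fspan {conc (symV_forms sc) F r | F r. F \<in> alg_part (symV_forms sc) degree_zero 0 \<and> r \<in> R}"

definition commutative_QLC :: "('k::field \<Rightarrow> 'v::ab_group_add \<Rightarrow> 'v) \<Rightarrow> ('v, 'k) words set \<Rightarrow> bool"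
  where "commutative_QLC sc R \<longleftrightarrow> vector_space sc \<and> fsubspace R \<and> R \<subseteq> symV_upto sc 2 \<and>
     R \<inter> symV_upto sc 1 = {0} \<and> ideal sc R \<inter> symV_upto sc 2 = R"

text \<open>The quotient \<open>Sym(V)/(R)\<close>, as the algebra presented by the forms that also kill \<open>(R)\<close>.\<close>

definition quot_forms :: "('k::field \<Rightarrow> 'v::ab_group_add \<Rightarrow> 'v) \<Rightarrow> ('v, 'k) words set \<Rightarrow> ('v list \<Rightarrow> 'k) set"
  where "quot_forms sc R = {M \<in> symV_forms sc. \<forall>r \<in> ideal sc R. r M = 0}"

definition quot_alg :: "('k::field \<Rightarrow> 'v::ab_group_add \<Rightarrow> 'v) \<Rightarrow> ('v, 'k) words set \<Rightarrow> int \<Rightarrow> ('v, 'k) words set"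
  where "quot_alg sc R = alg_part (quot_forms sc R) degree_zero"

definition qR :: "('k::field \<Rightarrow> 'v::ab_group_add \<Rightarrow> 'v) \<Rightarrow> ('v, 'k) words set \<Rightarrow> ('v, 'k) words set"
  where "qR sc R = weight_proj (symV_forms sc) 2 ` R"

definition QLC_phi :: "('k::field \<Rightarrow> 'v::ab_group_add \<Rightarrow> 'v) \<Rightarrow> ('v, 'k) words set \<Rightarrow> ('v, 'k) words \<Rightarrow> 'v"
  where "QLC_phi sc R x =
     (THE v. \<exists>c. x - ev (symV_forms sc) [v] + fscale c (ev (symV_forms sc) []) \<in> R)"

definition QLC_theta :: "('k::field \<Rightarrow> 'v::ab_group_add \<Rightarrow> 'v) \<Rightarrow> ('v, 'k) words set \<Rightarrow> ('v, 'k) words \<Rightarrow> 'k"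
  where "QLC_theta sc R x =
     (THE c. \<exists>v. x - ev (symV_forms sc) [v] + fscale c (ev (symV_forms sc) []) \<in> R)"


section \<open>The cofree conilpotent Lie coalgebra on \<open>sV\<close>\<close>

text \<open>It is realised as the reduced tensor coalgebra of \<open>sV\<close> modulo shuffle products, with the
  cobracket obtained by antisymmetrising deconcatenation.  The word \<open>[v\<^sub>1, \<dots>, v\<^sub>n]\<close> stands for
  \<open>[sv\<^sub>1|\<dots>|sv\<^sub>n]\<close>; all letters are of degree \<open>1\<close>, so that the degree of a word is its length and
  the shuffle product carries the sign of the shuffle permutation.  \<open>shuffle_sum M us vs\<close> is the
  value of \<open>M\<close> on the shuffle product of \<open>us\<close> and \<open>vs\<close>.\<close>

fun shuffle_sum :: "('v list \<Rightarrow> 'k::field) \<Rightarrow> 'v list \<Rightarrow> 'v list \<Rightarrow> 'k" where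
  "shuffle_sum M [] vs = M vs"
| "shuffle_sum M (u # us) [] = M (u # us)"
| "shuffle_sum M (u # us) (v # vs) = shuffle_sum (\<lambda>w. M (u # w)) us (v # vs)
     + ksign (int (length (u # us))) * shuffle_sum (\<lambda>w. M (v # w)) (u # us) vs"

definition lie_forms :: "('k::field \<Rightarrow> 'v::ab_group_add \<Rightarrow> 'v) \<Rightarrow> ('v list \<Rightarrow> 'k) set"
  where "lie_forms sc = {M \<in> multilin sc (shift 1 degree_zero). M [] = 0 \<and>
     (\<forall>us vs. us \<noteq> [] \<longrightarrow> vs \<noteq> [] \<longrightarrow> shuffle_sum M us vs = 0)}"

definition cofree_lie :: "('k::field \<Rightarrow> 'v::ab_group_add \<Rightarrow> 'v) \<Rightarrow> int \<Rightarrow> ('v, 'k) words set"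
    \<comment> \<open>degree and weight coincide\<close>
  where "cofree_lie sc n = fspan {ev (lie_forms sc) w | w. int (length w) = n}"

definition cofree_cobracket :: "('k::field \<Rightarrow> 'v::ab_group_add \<Rightarrow> 'v) \<Rightarrow> ('v, 'k) words
    \<Rightarrow> (('v, 'k) words, 'k) words"
  where "cofree_cobracket sc = lift (multilin fscale (cofree_lie sc)) (\<lambda>w.
     \<Sum>i \<in> {1..<length w}.
       let x = ev (lie_forms sc) (take i w); y = ev (lie_forms sc) (drop i w) in
       ev (multilin fscale (cofree_lie sc)) [x, y] -
       fscale (ksign (int i * int (length w - i))) (ev (multilin fscale (cofree_lie sc)) [y, x]))"

text \<open>The identification of \<open>s\<^sup>2Sym\<^sup>2(V)\<close> with the weight \<open>2\<close> part sends \<open>s\<^sup>2(vw)\<close> to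
  \<open>[sv|sw]\<close>, whose cobracket is \<open>sv \<otimes> sw + sw \<otimes> sv\<close>.\<close>

definition susp2 :: "('k::field \<Rightarrow> 'v::ab_group_add \<Rightarrow> 'v) \<Rightarrow> ('v, 'k) words \<Rightarrow> ('v, 'k) words"
  where "susp2 sc = lift (lie_forms sc) (\<lambda>w. if length w = 2 then ev (lie_forms sc) w else 0)"


section \<open>The Koszul dual curved Lie coalgebra\<close>

definition graded_lie_subcoalgebra :: "('k::field \<Rightarrow> 'v::ab_group_add \<Rightarrow> 'v)
    \<Rightarrow> (int \<Rightarrow> ('v, 'k) words set) \<Rightarrow> bool"
  where "graded_lie_subcoalgebra sc C \<longleftrightarrow> (\<forall>n. fsubspace (C n) \<and> C n \<subseteq> cofree_lie sc n \<and>
     cofree_cobracket sc ` C n \<subseteq> tensor_square (cofree_lie sc) C)"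

text \<open>The universal subcoalgebra is the sum of all those whose composite to
  \<open>\<And>\<^sup>2(sV)/s\<^sup>2Q\<close> vanishes.\<close>

definition koszul_dual :: "('k::field \<Rightarrow> 'v::ab_group_add \<Rightarrow> 'v) \<Rightarrow> ('v, 'k) words set
    \<Rightarrow> int \<Rightarrow> ('v, 'k) words set"
  where "koszul_dual sc Q n =
     fspan (\<Union>{C n | C. graded_lie_subcoalgebra sc C \<and> C 2 \<subseteq> susp2 sc ` Q})"

text \<open>The corestriction of the cobracket to \<open>G \<otimes> G\<close>, where \<open>G\<close> is a subcoalgebra.\<close>

definition sub_cobracket :: "('k::field \<Rightarrow> 'v::ab_group_add \<Rightarrow> 'v) \<Rightarrow> (int \<Rightarrow> ('v, 'k) words set)
    \<Rightarrow> ('v, 'k) words \<Rightarrow> (('v, 'k) words, 'k) words"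
  where "sub_cobracket sc G \<xi> = (THE t. t \<in> tensor_square G G \<and>
     (\<forall>M \<in> multilin fscale (cofree_lie sc). t M = cofree_cobracket sc \<xi> M))"

text \<open>The coderivation is a map on \<open>total G\<close>; it is made unique as a HOL function by the
  value \<open>0\<close> elsewhere.\<close>

definition phi_tilde :: "('k::field \<Rightarrow> 'v::ab_group_add \<Rightarrow> 'v) \<Rightarrow> ('v, 'k) words set
    \<Rightarrow> ('v, 'k) words \<Rightarrow> ('v, 'k) words"
  where "phi_tilde sc R = (let G = koszul_dual sc (qR sc R) in
     THE d. lie_coderivation G (sub_cobracket sc G) d \<and>
       (\<forall>\<xi> \<in> total G. \<forall>x \<in> qR sc R. weight_proj (lie_forms sc) 2 \<xi> = susp2 sc x \<longrightarrow>
          weight_proj (lie_forms sc) 1 (d \<xi>) = ev (lie_forms sc) [QLC_phi sc R x]) \<and>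
       (\<forall>\<xi>. \<xi> \<notin> total G \<longrightarrow> d \<xi> = 0))"

definition theta_tilde :: "('k::field \<Rightarrow> 'v::ab_group_add \<Rightarrow> 'v) \<Rightarrow> ('v, 'k) words set
    \<Rightarrow> ('v, 'k) words \<Rightarrow> 'k"
  where "theta_tilde sc R \<xi> =
     QLC_theta sc R (THE x. x \<in> qR sc R \<and> susp2 sc x = weight_proj (lie_forms sc) 2 \<xi>)"

text \<open>\<open>kappa sc P\<close> and \<open>g_kappa sc P\<close> have values in \<open>Sym(V)/(P)\<close>: they are used with \<open>P = R\<close>,
  and with \<open>P = qR\<close> for the associated quadratic algebra.\<close>

definition kappa :: "('k::field \<Rightarrow> 'v::ab_group_add \<Rightarrow> 'v) \<Rightarrow> ('v, 'k) words set
    \<Rightarrow> ('v, 'k) words \<Rightarrow> ('v, 'k) words"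
  where "kappa sc P \<xi> =
     ev (quot_forms sc P) [THE v. ev (lie_forms sc) [v] = weight_proj (lie_forms sc) 1 \<xi>]"

definition g_kappa :: "('k::field \<Rightarrow> 'v::ab_group_add \<Rightarrow> 'v) \<Rightarrow> ('v, 'k) words set
    \<Rightarrow> (('v, 'k) words, 'k) words \<Rightarrow> ('v, 'k) words"
  where "g_kappa sc P = alg_extend (quot_forms sc P) (kappa sc P)"

text \<open>Koszulness of \<open>qA\<close>.  Since \<open>(qR)\<close> lies in weights \<open>\<ge> 2\<close>, the unital algebra \<open>k \<oplus> qA\<close> is
  \<open>Sym(V)/(qR)\<close>; its differential is \<open>0\<close>.\<close>

definition qA_koszul :: "('k::field \<Rightarrow> 'v::ab_group_add \<Rightarrow> 'v) \<Rightarrow> ('v, 'k) words set \<Rightarrow> bool"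
  where "qA_koszul sc R \<longleftrightarrow> (let G = koszul_dual sc (qR sc R) in
     quasi_isomorphism (cobar G) (cobar_diff G (sub_cobracket sc G) (\<lambda>_. 0) (\<lambda>_. 0))
       (quot_alg sc (qR sc R)) (\<lambda>_. 0) (g_kappa sc (qR sc R)))"

end

theory Submission
  imports Defs
begin

text \<open>
  Why the theorem holds.  The differential of the cobar construction is a sum
  \<open>D = d\<^sub>2 + d\<^sub>1 + d\<^sub>0\<close> of derivations of the symmetric algebra on the desuspended Koszul dual
  \<open>G\<close>, which change the length of words by \<open>1\<close>, \<open>0\<close> and \<open>- 1\<close>.  Koszulness of \<open>qA\<close> says that
  \<open>d\<^sub>2\<close> alone has homology only in degree \<open>0\<close>, so the leading term of \<open>D\<close> is exact in every other
  degree, and \<open>D\<close> is studied by looking at the longest words.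

  \<^item> In degree \<open>n \<noteq> 0\<close> the longest part of a \<open>D\<close>-cycle is a \<open>d\<^sub>2\<close>-cycle, hence of the form
    \<open>d\<^sub>2 K\<close>.  Subtracting \<open>D K\<close> leaves a cycle with shorter words, and finitely many such steps
    exhaust it (\<open>D_acyclic\<close>).  The target is zero in these degrees.

  \<^item> All generators have nonnegative degree; those of degree \<open>0\<close> form \<open>V\<close> and those of degree \<open>1\<close>
    form the desuspension of \<open>s\<^sup>2 qR\<close>.  So the degree \<open>0\<close> part of the cobar construction is \<open>Sym(V)\<close>
    (the map \<open>J\<close>), and a generator given by \<open>x \<in> qR\<close> has differential
    \<open>x - \<phi>(x) + \<theta>(x)\<close>, an element of \<open>R\<close>.  Hence the boundaries of degree \<open>0\<close> are exactly the ideal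
    \<open>(R)\<close> (\<open>boundary_in_ideal\<close>, \<open>ideal_in_boundary\<close>), and the homology is \<open>A\<close>.

  What remains is \<open>D\<^sup>2 = 0\<close> for the coderivation \<open>phi_tilde\<close>, which is given by a
  description and not by a formula.  Both its existence and its uniqueness are deduced from Koszulness
  rather than from the universal property of a cofree coalgebra.  Since \<open>d\<^sub>2\<close> is injective on
  generators of degree at least \<open>1\<close> (\<open>d2_inj\<close>), a coderivation is determined by its values in weight
  \<open>2\<close> (\<open>coderivation_unique\<close>).  For existence a degree \<open>- 1\<close> map \<open>d\<close> on \<open>G\<close> is built weight by
  weight such that \<open>D\<^sup>2 = 0\<close>: if \<open>D\<^sup>2 = 0\<close> holds on words in letters of weight at most \<open>N\<close> and \<open>x\<close> has
  weight \<open>N + 1\<close>, then \<open>D(d\<^sub>2 x)\<close> is a cycle whose longest part is, by exactness, \<open>d\<^sub>2\<close> of a generator \<open>y\<close>;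
  then \<open>D(d\<^sub>2 x)\<close> is the differential of the generator \<open>y\<close>, which is the only possible value of \<open>d\<close> at \<open>x\<close>
  (\<open>corestriction_exists\<close>, \<open>corestriction_unique\<close>).  The step to weight \<open>3\<close> takes place in homological
  degree \<open>0\<close>, where exactness is not available; there the condition
  \<open>(R) \<inter> (k \<oplus> V \<oplus> Sym\<^sup>2(V)) = R\<close> replaces it (\<open>weight_three\<close>).  The part of \<open>D\<^sup>2 = 0\<close> in word length
  \<open>2\<close> then says that \<open>d\<close> is a coderivation (\<open>coderivation_if_square_zero\<close>), because the passage from
  antisymmetric tensors to quadratic elements of the desuspended symmetric algebra is injective
  (\<open>mu_inj\<close>).

  Of the cofree Lie coalgebra only little is used: its cobracket is well defined modulo shuffles
  (\<open>shuffle_splits\<close>, \<open>cobr_form\<close>), additive in weight (\<open>cob_degree\<close>) and antisymmetric (\<open>cob_anti\<close>), and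
  the Koszul dual is \<open>V\<close> in weight \<open>1\<close> and \<open>s\<^sup>2 qR\<close> in weight \<open>2\<close> (\<open>G_1\<close>, \<open>G_2\<close>).
\<close>

section \<open>Spans, linear maps and functionals\<close>

interpretation fs: vector_space "fscale :: 'k::field \<Rightarrow> ('m \<Rightarrow> 'k) \<Rightarrow> ('m \<Rightarrow> 'k)"
  by (rule vector_space_fscale)

lemma fscale_apply: "fscale c F m = c * F m"
  by (simp add: fscale_def)

text \<open>Elements of the algebras and coalgebras below are functions on forms.  As simplification rules the pointwise
  laws would break up sums wherever a sum is applied to a form, so they are collected here and used
  on demand.\<close>

lemmas pointwise = plus_fun_apply zero_fun_apply minus_apply uminus_apply fscale_apply

declare plus_fun_apply [simp del] zero_fun_apply [simp del]
  minus_apply [simp del] uminus_apply [simp del]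

lemma fspan_induct [consumes 1, case_names zero base add scale]:
  assumes "F \<in> fspan B" and "P 0" and "\<And>b. b \<in> B \<Longrightarrow> P b"
    and "\<And>F G. F \<in> fspan B \<Longrightarrow> G \<in> fspan B \<Longrightarrow> P F \<Longrightarrow> P G \<Longrightarrow> P (F + G)"
    and "\<And>c F. F \<in> fspan B \<Longrightarrow> P F \<Longrightarrow> P (fscale c F)"
  shows "P F"
proof -
  have "fsubspace {F \<in> fspan B. P F}"
    using assms by (auto intro!: fs.subspaceI fs.span_add fs.span_scale fs.span_zero)
  moreover have "B \<subseteq> {F \<in> fspan B. P F}"
    using assms(3) by (auto intro: fs.span_base)
  ultimately have "fspan B \<subseteq> {F \<in> fspan B. P F}"
    by (metis fs.span_minimal)
  then show ?thesis using assms(1) by auto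
qed

lemma lin_onD: "lin_on S f \<Longrightarrow> x \<in> S \<Longrightarrow> y \<in> S \<Longrightarrow> f (x + y) = f x + f y"
  "lin_on S f \<Longrightarrow> x \<in> S \<Longrightarrow> f (fscale c x) = fscale c (f x)"
  by (simp_all add: lin_on_def)

lemma lin_on_zero: "lin_on S f \<Longrightarrow> x \<in> S \<Longrightarrow> f 0 = 0"
  using lin_onD(2)[of S f x 0] by simp

text \<open>Replaces induction over a span: the closure conditions are packed into the linearity of
  \<open>f\<close> and into \<open>W\<close> being a subspace.  With \<open>W\<close> the image of another linear map it
  proves existence statements.\<close>

lemma fspan_mem:
  assumes "F \<in> fspan B" "lin_on (fspan B) f" "fsubspace W" "\<And>b. b \<in> B \<Longrightarrow> f b \<in> W"
  shows "f F \<in> W"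
  using assms(1)
proof (induction rule: fspan_induct)
  case zero
  show ?case using lin_on_zero[OF assms(2) fs.span_zero] fs.subspace_0[OF assms(3)] by simp
next
  case (add F K)
  then show ?case using lin_onD(1)[OF assms(2)] fs.subspace_add[OF assms(3)] by simp
next
  case (scale c F)
  then show ?case using lin_onD(2)[OF assms(2)] fs.subspace_scale[OF assms(3)] by simp
qed (rule assms(4))

lemma lin_on_ops:
  "lin_on S f \<Longrightarrow> lin_on S g \<Longrightarrow> lin_on S (\<lambda>x. f x + g x)"
  "lin_on S f \<Longrightarrow> lin_on S g \<Longrightarrow> lin_on S (\<lambda>x. f x - g x)"
  "lin_on S f \<Longrightarrow> lin_on S (\<lambda>x. fscale c (f x))"
  "lin_on S (\<lambda>x. x)" "lin_on S (\<lambda>_. 0)"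
  by (auto simp: lin_on_def fs.scale_right_distrib fs.scale_right_diff_distrib algebra_simps)

lemma fspan_eq:
  assumes "F \<in> fspan B" "lin_on (fspan B) f" "lin_on (fspan B) g" "\<And>b. b \<in> B \<Longrightarrow> f b = g b"
  shows "f F = g F"
  using fspan_mem[OF assms(1) lin_on_ops(2)[OF assms(2,3)] fs.subspace_single_0] assms(4) by simp

lemma lin_on_comp: "lin_on UNIV g \<Longrightarrow> lin_on S f \<Longrightarrow> lin_on S (\<lambda>x. g (f x))"
  by (auto simp: lin_on_def)

lemma lin_on_image:
  assumes "lin_on T f" "fsubspace T"
  shows "fsubspace (f ` T)"
proof (rule fs.subspaceI)
  show "0 \<in> f ` T"
    using lin_on_zero[OF assms(1)] fs.subspace_0[OF assms(2)] by (metis image_eqI)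
  show "x + y \<in> f ` T" if "x \<in> f ` T" "y \<in> f ` T" for x y
    using that fs.subspace_add[OF assms(2)] by (auto simp: lin_onD(1)[OF assms(1), symmetric])
  show "fscale c x \<in> f ` T" if "x \<in> f ` T" for x c
    using that fs.subspace_scale[OF assms(2)] by (auto simp: lin_onD(2)[OF assms(1), symmetric])
qed

text \<open>Since spaces are presented by forms, that an element is nonzero must be witnessed by a form;
  such forms come from functionals obtained by extending a basis.\<close>

lemma separating_functional:
  fixes sc :: "'k::field \<Rightarrow> 'a::ab_group_add \<Rightarrow> 'a"
  assumes "vector_space sc" and "module.subspace sc S" and "x \<notin> S"
  shows "\<exists>l. (\<forall>a b. l (a + b) = l a + l b) \<and> (\<forall>c a. l (sc c a) = c * l a) \<and>
    (\<forall>a\<in>S. l a = 0) \<and> l x = 1"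
proof -
  interpret vector_space sc by fact
  interpret vector_space_pair sc "(*) :: 'k \<Rightarrow> 'k \<Rightarrow> 'k"
    by unfold_locales (auto simp: algebra_simps)
  obtain B where B: "B \<subseteq> S" "independent B" "S \<subseteq> span B"
    using basis_exists[of S] by metis
  have sB: "span B = S"
    using B assms(2) span_minimal by blast
  have "independent (insert x B)"
    using B sB assms(3) by (simp add: independent_insert)
  then obtain g where g: "Vector_Spaces.linear sc (*) g" "\<forall>y\<in>insert x B. g y = (if y = x then 1 else 0)"
    using linear_independent_extend[of "insert x B" "\<lambda>y. if y = x then 1 else 0"] by auto
  interpret g: Vector_Spaces.linear sc "(*)" g by (rule g)
  have xB: "x \<notin> B" using B assms(3) by auto
  have "g a = 0" if "a \<in> S" for a
  proof -
    have "a \<in> span B" using that sB by simp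
    then show ?thesis
      by (induction rule: span_induct_alt) (use g xB in \<open>auto simp: g.add g.scale g.zero\<close>)
  qed
  then show ?thesis
    using g.add g.scale g by (intro exI[of _ g]) auto
qed

text \<open>Composition with a retraction extends forms from a graded subspace to the ambient space.\<close>

lemma linear_retraction:
  fixes sc :: "'k::field \<Rightarrow> 'a::ab_group_add \<Rightarrow> 'a"
  assumes "vector_space sc" and "module.subspace sc S"
  shows "\<exists>p. (\<forall>a b. p (a + b) = p a + p b) \<and> (\<forall>c a. p (sc c a) = sc c (p a)) \<and>
    (\<forall>a\<in>S. p a = a) \<and> (\<forall>a. p a \<in> S)"
proof -
  interpret vector_space sc by fact
  interpret vector_space_pair sc sc by unfold_locales
  obtain B where B: "B \<subseteq> S" "independent B" "S \<subseteq> span B"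
    using basis_exists[of S] by metis
  have sB: "span B = S"
    using B assms(2) span_minimal by blast
  obtain g where g: "Vector_Spaces.linear sc sc g" "\<forall>y\<in>B. g y = y" "range g = span ((\<lambda>y. y) ` B)"
    using linear_independent_extend_subspace[OF B(2), of "\<lambda>y. y"] by blast
  interpret g: Vector_Spaces.linear sc sc g by (rule g)
  have "g a = a" if "a \<in> S" for a
  proof -
    have "a \<in> span B" using that sB by simp
    then show ?thesis
      by (induction rule: span_induct_alt) (use g in \<open>auto simp: g.add g.scale g.zero\<close>)
  qed
  then show ?thesis
    using g.add g.scale g sB by (intro exI[of _ g]) auto
qed

section \<open>Words modulo a space of forms\<close>

lemma ksign_add: "ksign (m + n) = (ksign m * ksign n :: 'k::field)"
  by (auto simp: ksign_def)

lemma ksign_minus1: "ksign (n - 1) = (- ksign n :: 'k::field)"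
  by (auto simp: ksign_def)

lemma ksign_square [simp]: "ksign n * ksign n = (1 :: 'k::field)"
  "ksign n * (ksign n * x) = (x :: 'k)"
  by (auto simp: ksign_def)

lemma ksign_0 [simp]: "ksign 0 = 1"
  by (simp add: ksign_def)

lemma lift_zero [simp]: "lift \<Phi> f 0 = 0"
  by (auto simp: lift_def fun_eq_iff pointwise)

lemma lift_diff: "lift \<Phi> f (F - G) = lift \<Phi> f F - lift \<Phi> f G"
  by (auto simp: lift_def fun_eq_iff pointwise)

lemma conc_apply: "conc \<Phi> F G M = (if M \<in> \<Phi> then F (\<lambda>u. G (\<lambda>v. M (u @ v))) else 0)"
  by (simp add: conc_def lift_def ev_def)

lemma conc_zero_left [simp]: "conc \<Phi> 0 G = 0"
  by (auto simp: conc_apply fun_eq_iff pointwise)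

lemma conc_add_left: "conc \<Phi> (F + F') G = conc \<Phi> F G + conc \<Phi> F' G"
  by (auto simp: conc_apply fun_eq_iff pointwise)

lemma conc_scale_left: "conc \<Phi> (fscale c F) G = fscale c (conc \<Phi> F G)"
  by (auto simp: conc_apply fun_eq_iff pointwise)

lemma conc_minus_left: "conc \<Phi> (- F) G = - conc \<Phi> F G"
  by (auto simp: conc_apply fun_eq_iff pointwise)

lemma lin_on_lift: "lin_on S (lift \<Phi> f)"
  by (simp add: lin_on_def lift_add lift_fscale)

lemma lin_on_conc: "lin_on S (\<lambda>F. conc \<Phi> F G)"
  by (simp add: lin_on_def conc_add_left conc_scale_left)

text \<open>What makes concatenation of words descend to a space presented by \<open>\<Phi>\<close>: the forms are closed
  under prescribing a prefix or a suffix.  The letters are taken from \<open>H\<close>; membership in \<open>\<Phi>\<close> puts no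
  condition on the values at other words, which is the axiom \<open>local\<close>.  Tensor algebras, symmetric
  algebras and their quotients are instances.\<close>

locale conc_forms =
  fixes \<Phi> :: "('a list \<Rightarrow> 'k::field) set" and H :: "'a set"
  assumes zero: "(\<lambda>_. 0) \<in> \<Phi>"
    and add: "\<And>M N. M \<in> \<Phi> \<Longrightarrow> N \<in> \<Phi> \<Longrightarrow> (\<lambda>w. M w + N w) \<in> \<Phi>"
    and scale: "\<And>M c. M \<in> \<Phi> \<Longrightarrow> (\<lambda>w. c * M w) \<in> \<Phi>"
    and local: "\<And>M N. M \<in> \<Phi> \<Longrightarrow> (\<And>w. set w \<subseteq> H \<Longrightarrow> N w = M w) \<Longrightarrow> N \<in> \<Phi>"
    and left: "\<And>M u. M \<in> \<Phi> \<Longrightarrow> set u \<subseteq> H \<Longrightarrow> (\<lambda>v. M (u @ v)) \<in> \<Phi>"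
    and right: "\<And>M v. M \<in> \<Phi> \<Longrightarrow> set v \<subseteq> H \<Longrightarrow> (\<lambda>u. M (u @ v)) \<in> \<Phi>"
begin

abbreviation e :: "'a list \<Rightarrow> ('a, 'k) words" where "e \<equiv> ev \<Phi>"
abbreviation pr (infixl "\<cdot>" 70) where "F \<cdot> G \<equiv> conc \<Phi> F G"
abbreviation S :: "('a, 'k) words set" where "S \<equiv> fspan {ev \<Phi> w | w. set w \<subseteq> H}"

lemma e_in_S: "set w \<subseteq> H \<Longrightarrow> e w \<in> S"
  by (intro fs.span_base) auto

lemma e_apply: "M \<in> \<Phi> \<Longrightarrow> e w M = M w"
  by (simp add: ev_def)

lemma S_off: "F \<in> S \<Longrightarrow> M \<notin> \<Phi> \<Longrightarrow> F M = 0"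
  by (induction rule: fspan_induct) (auto simp: ev_def pointwise)

lemma S_plus: "F \<in> S \<Longrightarrow> M \<in> \<Phi> \<Longrightarrow> N \<in> \<Phi> \<Longrightarrow> F (\<lambda>w. M w + N w) = F M + F N"
  by (induction rule: fspan_induct) (auto simp: ev_def add algebra_simps pointwise)

lemma S_times: "F \<in> S \<Longrightarrow> M \<in> \<Phi> \<Longrightarrow> F (\<lambda>w. c * M w) = c * F M"
  by (induction rule: fspan_induct) (auto simp: ev_def scale algebra_simps pointwise)

lemma S_null: "F \<in> S \<Longrightarrow> F (\<lambda>_. 0) = 0"
  by (induction rule: fspan_induct) (auto simp: ev_def pointwise)

text \<open>This is how an element of the span is evaluated at a complicated form: replace the form by one
  that agrees with it on words over \<open>H\<close>.\<close>

lemma S_local: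
  assumes "F \<in> S" "M \<in> \<Phi>" "\<And>w. set w \<subseteq> H \<Longrightarrow> N w = M w"
  shows "F N = F M"
proof -
  have "N \<in> \<Phi>" using assms(2,3) by (rule local)
  with assms show ?thesis
    by (induction rule: fspan_induct) (auto simp: ev_def pointwise)
qed

text \<open>The product \<open>F \<cdot> G\<close> evaluates \<open>G\<close> at the suffix and then \<open>F\<close> at the prefix; for this to
  make sense the result of the inner evaluation must again be a form.\<close>

lemma inner_form: "G \<in> S \<Longrightarrow> M \<in> \<Phi> \<Longrightarrow> (\<lambda>u. G (\<lambda>v. M (u @ v))) \<in> \<Phi>"
proof (induction rule: fspan_induct)
  case (base b)
  then obtain v where v: "b = e v" "set v \<subseteq> H" by auto
  show ?case
    by (rule local[OF right[OF base(2) v(2)]]) (simp add: v e_apply left base)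
qed (auto simp: zero add scale pointwise)

lemma conc_ev: "set u \<subseteq> H \<Longrightarrow> set v \<subseteq> H \<Longrightarrow> e u \<cdot> e v = e (u @ v)"
  by (rule ext) (use inner_form[OF e_in_S] in \<open>auto simp: conc_apply e_apply left ev_def\<close>)

lemma conc_add_right:
  assumes "F \<in> S" "G \<in> S" "G' \<in> S"
  shows "F \<cdot> (G + G') = F \<cdot> G + F \<cdot> G'"
proof
  fix M
  show "(F \<cdot> (G + G')) M = (F \<cdot> G + F \<cdot> G') M"
    using S_plus[OF assms(1) inner_form[OF assms(2)] inner_form[OF assms(3)], of M M]
    by (simp add: conc_apply pointwise)
qed

lemma conc_scale_right:
  assumes "F \<in> S" "G \<in> S"
  shows "F \<cdot> fscale c G = fscale c (F \<cdot> G)"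
proof
  fix M
  show "(F \<cdot> fscale c G) M = fscale c (F \<cdot> G) M"
    using S_times[OF assms(1) inner_form[OF assms(2)], of M c]
    by (simp add: conc_apply pointwise)
qed

lemma conc_zero_right [simp]: "F \<in> S \<Longrightarrow> F \<cdot> 0 = 0"
  by (rule ext) (auto simp: conc_apply S_null pointwise)

lemma conc_minus_right: "F \<in> S \<Longrightarrow> G \<in> S \<Longrightarrow> F \<cdot> (- G) = - (F \<cdot> G)"
  using conc_scale_right[of F G "- 1"] by (simp add: fscale_def fun_Compl_def)

lemma conc_assoc:
  assumes "F \<in> S" "G \<in> S" "K \<in> S"
  shows "(F \<cdot> G) \<cdot> K = F \<cdot> (G \<cdot> K)"
proof
  fix M
  show "((F \<cdot> G) \<cdot> K) M = (F \<cdot> (G \<cdot> K)) M"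
  proof (cases "M \<in> \<Phi>")
    case True
    have "F (\<lambda>u. (G \<cdot> K) (\<lambda>v. M (u @ v))) = F (\<lambda>u. G (\<lambda>v. K (\<lambda>w. M ((u @ v) @ w))))"
      by (rule S_local[OF assms(1) inner_form[OF assms(2) inner_form[OF assms(3) True]]])
        (auto simp: conc_apply left True)
    then show ?thesis
      by (simp add: conc_apply[of \<Phi> "F \<cdot> G"] conc_apply[of \<Phi> F] True inner_form assms)
  qed (simp add: conc_apply)
qed

lemma one_conc: "G \<in> S \<Longrightarrow> e [] \<cdot> G = G"
  by (rule ext) (auto simp: conc_apply e_apply inner_form S_off)

lemma conc_one:
  assumes "F \<in> S"
  shows "F \<cdot> e [] = F"
proof
  fix M
  show "(F \<cdot> e []) M = F M"
  proof (cases "M \<in> \<Phi>")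
    case True
    have "F (\<lambda>u. e [] (\<lambda>v. M (u @ v))) = F M"
      by (rule S_local[OF assms True]) (simp add: e_apply left True)
    then show ?thesis by (simp add: conc_apply True)
  qed (simp add: conc_apply S_off assms)
qed

lemma lin_on_conc_right: "F \<in> S \<Longrightarrow> T \<subseteq> S \<Longrightarrow> lin_on T (\<lambda>G. F \<cdot> G)"
  by (auto simp: lin_on_def conc_add_right conc_scale_right subset_iff)

lemma conc_in_S:
  assumes "F \<in> S" and "G \<in> S"
  shows "F \<cdot> G \<in> S"
proof -
  have "e u \<cdot> G \<in> S" if "set u \<subseteq> H" for u
    by (rule fspan_mem[OF assms(2) lin_on_conc_right[OF e_in_S[OF that] order.refl] fs.subspace_span])
      (use that in \<open>clarsimp simp: conc_ev, intro e_in_S, simp\<close>)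
  then show ?thesis
    by (intro fspan_mem[OF assms(1) lin_on_conc fs.subspace_span]) auto
qed

lemma conc_sum_right:
  "F \<in> S \<Longrightarrow> (\<And>i. i \<in> I \<Longrightarrow> G i \<in> S) \<Longrightarrow> F \<cdot> (\<Sum>i\<in>I. G i) = (\<Sum>i\<in>I. F \<cdot> G i)"
  by (induction I rule: infinite_finite_induct) (auto simp: conc_add_right fs.span_sum)

lemma lift_in:
  assumes "\<And>M. M \<in> \<Phi> \<Longrightarrow> (\<lambda>u. f u M) \<in> \<Phi>" and "\<And>w. set w \<subseteq> H \<Longrightarrow> f w \<in> S" and "set w \<subseteq> H"
  shows "lift \<Phi> f (e w) = f w"
  using assms by (intro lift_ev) (auto simp: S_off)

text \<open>A linear functional \<open>l\<close> restricts to a form on words, and evaluation at this form recovers \<open>l\<close>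
  on the span.  Kernels of maps between presented spaces are computed in this way.\<close>

lemma functional_form:
  assumes "\<And>a b. l (a + b) = l a + l b" and "\<And>c a. l (fscale c a) = c * l a" and "F \<in> S"
    and "(\<lambda>w. l (e w)) \<in> \<Phi>"
  shows "F (\<lambda>w. l (e w)) = l F"
proof -
  have l0: "l 0 = 0" using assms(2)[of 0 0] by simp
  show ?thesis
    using assms(3)
  proof (induction rule: fspan_induct)
    case (base b)
    then show ?case using assms(4) by (auto simp: e_apply)
  next
    case (add F G)
    have "(F + G) (\<lambda>w. l (e w)) = F (\<lambda>w. l (e w)) + G (\<lambda>w. l (e w))"
      by (rule plus_fun_apply)
    then show ?case by (simp only: assms(1) add(3,4))
  next
    case (scale c F)
    have "fscale c F (\<lambda>w. l (e w)) = c * F (\<lambda>w. l (e w))"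
      by (rule fscale_apply)
    then show ?case by (simp only: assms(2) scale(2))
  qed (simp only: l0 zero_fun_apply[of "\<lambda>w. l (e w)"])
qed

end

section \<open>Graded symmetric algebras\<close>

lemma ksign_mult_add: "ksign (a * (b + c)) = (ksign (a * b) * ksign (a * c) :: 'k::field)"
  "ksign ((b + c) * a) = (ksign (b * a) * ksign (c * a) :: 'k::field)"
  by (auto simp: ksign_def)

text \<open>The degree \<open>dg x\<close> is a choice when \<open>x = 0\<close>.  Hence statements with signs take a degree
  \<open>n\<close> with \<open>x \<in> G n\<close> as a parameter wherever letters are added or scaled.\<close>

locale graded_space =
  fixes sc :: "'k::field \<Rightarrow> 'a::ab_group_add \<Rightarrow> 'a" and G :: "int \<Rightarrow> 'a set"
  assumes vs: "vector_space sc" and sub: "\<And>n. module.subspace sc (G n)"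
    and disj: "\<And>m n x. x \<in> G m \<Longrightarrow> x \<in> G n \<Longrightarrow> m \<noteq> n \<Longrightarrow> x = 0"
begin

interpretation V: vector_space sc by (rule vs)

abbreviation H where "H \<equiv> homs G"
abbreviation \<Phi> where "\<Phi> \<equiv> sym_forms sc G"
abbreviation dg where "dg x \<equiv> deg G x"
abbreviation wdeg where "wdeg w \<equiv> sum_list (map (deg G) w)"

lemma G_add: "x \<in> G n \<Longrightarrow> y \<in> G n \<Longrightarrow> x + y \<in> G n"
  using sub V.subspace_add by blast

lemma G_scale: "x \<in> G n \<Longrightarrow> sc c x \<in> G n"
  using sub V.subspace_scale by blast

lemma G_zero: "0 \<in> G n"
  using sub V.subspace_0 by blast

lemma G_homs: "x \<in> G n \<Longrightarrow> x \<in> H"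
  by (auto simp: homs_def)

lemma deg_in: "x \<in> H \<Longrightarrow> x \<in> G (dg x)"
  unfolding deg_def homs_def by (auto intro: someI)

lemma deg_eq: "x \<in> G n \<Longrightarrow> x \<noteq> 0 \<Longrightarrow> dg x = n"
  using deg_in[OF G_homs] disj by blast

lemma sc_simps [simp]: "sc 0 x = 0" "sc 1 x = x" "sc c 0 = 0" "sc a (sc b x) = sc (a * b) x"
  by auto

lemma multilinD:
  assumes "M \<in> multilin sc G" "set us \<subseteq> H" "set vs \<subseteq> H" "x \<in> G n"
  shows "y \<in> G n \<Longrightarrow> M (us @ (x + y) # vs) = M (us @ x # vs) + M (us @ y # vs)"
    and "M (us @ sc c x # vs) = c * M (us @ x # vs)"
  using assms unfolding multilin_def by blast+

lemma multilinI:
  assumes "\<And>us vs n x y. set us \<subseteq> H \<Longrightarrow> set vs \<subseteq> H \<Longrightarrow> x \<in> G n \<Longrightarrow> y \<in> G n \<Longrightarrow>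
       M (us @ (x + y) # vs) = M (us @ x # vs) + M (us @ y # vs)"
    and "\<And>us vs n x c. set us \<subseteq> H \<Longrightarrow> set vs \<subseteq> H \<Longrightarrow> x \<in> G n \<Longrightarrow>
       M (us @ sc c x # vs) = c * M (us @ x # vs)"
  shows "M \<in> multilin sc G"
  using assms unfolding multilin_def by blast

lemma sym_multilin: "M \<in> \<Phi> \<Longrightarrow> M \<in> multilin sc G"
  by (simp add: sym_forms_def)

lemma symD:
  assumes "M \<in> \<Phi>" "set us \<subseteq> H" "set vs \<subseteq> H" "x \<in> G m" "y \<in> G n"
  shows "M (us @ x # y # vs) = ksign (m * n) * M (us @ y # x # vs)"
  using assms unfolding sym_forms_def by blast

lemma symI:
  assumes "M \<in> multilin sc G"
    and "\<And>us vs m n x y. set us \<subseteq> H \<Longrightarrow> set vs \<subseteq> H \<Longrightarrow> x \<in> G m \<Longrightarrow> y \<in> G n \<Longrightarrow>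
       M (us @ x # y # vs) = ksign (m * n) * M (us @ y # x # vs)"
  shows "M \<in> \<Phi>"
  using assms unfolding sym_forms_def by blast

lemma multilin_local:
  assumes "M \<in> multilin sc G" and "\<And>w. set w \<subseteq> H \<Longrightarrow> N w = M w"
  shows "N \<in> multilin sc G"
proof (rule multilinI)
  fix us vs n x y assume *: "set us \<subseteq> H" "set vs \<subseteq> H" "x \<in> G n" "y \<in> G n"
  show "N (us @ (x + y) # vs) = N (us @ x # vs) + N (us @ y # vs)"
    using multilinD(1)[OF assms(1) *] * G_homs G_add[of x n y] by (simp add: assms(2))
next
  fix us vs n x c assume *: "set us \<subseteq> H" "set vs \<subseteq> H" "x \<in> G n"
  show "N (us @ sc c x # vs) = c * N (us @ x # vs)"
    using multilinD(2)[OF assms(1) *] * G_homs G_scale[of x n c] by (simp add: assms(2))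
qed

lemma sym_local:
  assumes "M \<in> \<Phi>" and "\<And>w. set w \<subseteq> H \<Longrightarrow> N w = M w"
  shows "N \<in> \<Phi>"
proof (rule symI)
  show "N \<in> multilin sc G"
    using multilin_local[OF sym_multilin[OF assms(1)] assms(2)] .
  fix us vs m n x y assume *: "set us \<subseteq> H" "set vs \<subseteq> H" "x \<in> G m" "y \<in> G n"
  show "N (us @ x # y # vs) = ksign (m * n) * N (us @ y # x # vs)"
    using symD[OF assms(1) *] * G_homs by (simp add: assms(2))
qed

lemma multilin_left:
  assumes "M \<in> multilin sc G" and "set u \<subseteq> H"
  shows "(\<lambda>v. M (u @ v)) \<in> multilin sc G"
  using multilinD[OF assms(1), of "u @ us" for us] assms(2) by (intro multilinI) auto

lemma multilin_right:
  assumes "M \<in> multilin sc G" and "set v \<subseteq> H"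
  shows "(\<lambda>u. M (u @ v)) \<in> multilin sc G"
  using multilinD[OF assms(1), of _ "vs @ v" for vs] assms(2) by (intro multilinI) auto

lemma multilin_zero: "(\<lambda>_. 0) \<in> multilin sc G"
  and multilin_add: "M \<in> multilin sc G \<Longrightarrow> N \<in> multilin sc G \<Longrightarrow> (\<lambda>w. M w + N w) \<in> multilin sc G"
  and multilin_scale: "M \<in> multilin sc G \<Longrightarrow> (\<lambda>w. c * M w) \<in> multilin sc G"
  unfolding multilin_def by (auto simp: algebra_simps)

sublocale T: conc_forms "multilin sc G" "homs G"
  by (unfold_locales; (rule multilin_zero multilin_add multilin_scale multilin_local
      multilin_left multilin_right)?)

sublocale conc_forms "sym_forms sc G" "homs G"
proof
  show "(\<lambda>_. 0) \<in> \<Phi>"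
    by (auto simp: sym_forms_def multilin_zero)
  show "(\<lambda>w. M w + N w) \<in> \<Phi>" if "M \<in> \<Phi>" "N \<in> \<Phi>" for M N
  proof (rule symI[OF multilin_add[OF sym_multilin sym_multilin, OF that]])
    fix us vs m n x y assume *: "set us \<subseteq> H" "set vs \<subseteq> H" "x \<in> G m" "y \<in> G n"
    show "M (us @ x # y # vs) + N (us @ x # y # vs) =
        ksign (m * n) * (M (us @ y # x # vs) + N (us @ y # x # vs))"
      unfolding symD[OF that(1) *] symD[OF that(2) *] by (rule distrib_left[symmetric])
  qed
  show "(\<lambda>w. c * M w) \<in> \<Phi>" if "M \<in> \<Phi>" for M c
  proof (rule symI[OF multilin_scale[OF sym_multilin[OF that]]])
    fix us vs m n x y assume *: "set us \<subseteq> H" "set vs \<subseteq> H" "x \<in> G m" "y \<in> G n"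
    show "c * M (us @ x # y # vs) = ksign (m * n) * (c * M (us @ y # x # vs))"
      by (subst symD[OF that *]) (simp add: mult.left_commute)
  qed
  show "N \<in> \<Phi>" if "M \<in> \<Phi>" "\<And>w. set w \<subseteq> H \<Longrightarrow> N w = M w" for M N
    using that by (rule sym_local)
  show "(\<lambda>v. M (u @ v)) \<in> \<Phi>" if "M \<in> \<Phi>" "set u \<subseteq> H" for M u
  proof (rule symI[OF multilin_left[OF sym_multilin[OF that(1)] that(2)]])
    fix us vs m n x y assume *: "set us \<subseteq> H" "set vs \<subseteq> H" "x \<in> G m" "y \<in> G n"
    show "M (u @ us @ x # y # vs) = ksign (m * n) * M (u @ us @ y # x # vs)"
      using symD[OF that(1) _ *(2-4), of "u @ us"] * that by simp
  qed
  show "(\<lambda>u. M (u @ v)) \<in> \<Phi>" if "M \<in> \<Phi>" "set v \<subseteq> H" for M v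
  proof (rule symI[OF multilin_right[OF sym_multilin[OF that(1)] that(2)]])
    fix us vs m n x y assume *: "set us \<subseteq> H" "set vs \<subseteq> H" "x \<in> G m" "y \<in> G n"
    show "M ((us @ x # y # vs) @ v) = ksign (m * n) * M ((us @ y # x # vs) @ v)"
      using symD[OF that(1) *(1) _ *(3,4), of "vs @ v"] * that by simp
  qed
qed

abbreviation sym_prod (infixl "\<cdot>" 70) where "F \<cdot> K \<equiv> conc \<Phi> F K"

lemma e_add:
  assumes "set us \<subseteq> H" "set vs \<subseteq> H" "x \<in> G n" "y \<in> G n"
  shows "e (us @ (x + y) # vs) = e (us @ x # vs) + e (us @ y # vs)"
  using multilinD(1)[OF sym_multilin assms] by (intro ext) (simp add: ev_def pointwise)

lemma e_scale:
  assumes "set us \<subseteq> H" "set vs \<subseteq> H" "x \<in> H"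
  shows "e (us @ sc c x # vs) = fscale c (e (us @ x # vs))"
  using multilinD(2)[OF sym_multilin assms(1,2) deg_in[OF assms(3)]]
  by (intro ext) (simp add: ev_def pointwise)

lemma e_null:
  assumes "0 \<in> set w" "set w \<subseteq> H"
  shows "e w = 0"
proof -
  obtain us vs where w: "w = us @ 0 # vs"
    using split_list[OF assms(1)] by blast
  have "e (us @ sc 0 0 # vs) = fscale 0 (e (us @ 0 # vs))"
    using assms w by (intro e_scale) auto
  then show ?thesis by (simp add: w)
qed

lemma e_swap:
  assumes "set us \<subseteq> H" "set vs \<subseteq> H" "x \<in> H" "y \<in> H"
  shows "e (us @ x # y # vs) = fscale (ksign (dg x * dg y)) (e (us @ y # x # vs))"
  using symD[OF _ assms(1,2) deg_in[OF assms(3)] deg_in[OF assms(4)]]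
  by (intro ext) (simp add: ev_def pointwise)

abbreviation Sn :: "int \<Rightarrow> ('a, 'k) words set" where "Sn \<equiv> alg_part \<Phi> G"

lemma Sn_S: "F \<in> Sn n \<Longrightarrow> F \<in> S"
  unfolding alg_part_def by (erule set_mp[OF fs.span_mono, rotated]) blast

lemma e_in_Sn: "set w \<subseteq> H \<Longrightarrow> wdeg w = n \<Longrightarrow> e w \<in> Sn n"
  unfolding alg_part_def by (intro fs.span_base) auto

lemma Sn_sub: "fsubspace (Sn n)"
  unfolding alg_part_def by (rule fs.subspace_span)

lemmas Sn_intros = fs.subspace_add[OF Sn_sub] fs.subspace_scale[OF Sn_sub]
  fs.subspace_0[OF Sn_sub] fs.subspace_neg[OF Sn_sub] fs.subspace_diff[OF Sn_sub]

lemma Sn_mem: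
  assumes "F \<in> Sn n" "lin_on (Sn n) f" "fsubspace W" "\<And>w. set w \<subseteq> H \<Longrightarrow> wdeg w = n \<Longrightarrow> f (e w) \<in> W"
  shows "f F \<in> W"
  using assms unfolding alg_part_def by (intro fspan_mem[of F _ f W]) auto

lemma Sn_eq:
  assumes "F \<in> Sn n" "lin_on (Sn n) f" "lin_on (Sn n) g"
    "\<And>w. set w \<subseteq> H \<Longrightarrow> wdeg w = n \<Longrightarrow> f (e w) = g (e w)"
  shows "f F = g F"
  using assms unfolding alg_part_def by (intro fspan_eq[of F _ f g]) auto

lemma e_single_zero: "e [0] = 0"
  using e_null[of "[0]"] G_homs[OF G_zero] by simp

lemma e_single:
  assumes "x \<in> G n"
  shows "e [x] \<in> Sn n"
proof (cases "x = 0")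
  case True
  show ?thesis unfolding True e_single_zero by (rule Sn_intros)
next
  case False
  show ?thesis
    by (rule e_in_Sn) (use G_homs[OF assms] deg_eq[OF assms False] in simp_all)
qed

text \<open>For \<open>x = 0\<close> the signs may differ, but then the word vanishes.\<close>

lemma ksign_single:
  assumes "x \<in> G n"
  shows "fscale (ksign (dg x)) (e [x]) = fscale (ksign n) (e [x])"
proof (cases "x = 0")
  case True
  show ?thesis unfolding True e_single_zero by simp
next
  case False
  show ?thesis unfolding deg_eq[OF assms False] ..
qed

lemma Sn_subset_S: "Sn n \<subseteq> S"
  using Sn_S by blast

lemma Sn_conc:
  assumes F: "F \<in> Sn m" and K: "K \<in> Sn n"
  shows "F \<cdot> K \<in> Sn (m + n)"
proof -
  have "e u \<cdot> K \<in> Sn (m + n)" if u: "set u \<subseteq> H" "wdeg u = m" for u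
    by (rule Sn_mem[OF K lin_on_conc_right[OF e_in_S[OF u(1)] Sn_subset_S] Sn_sub])
      (use u in \<open>auto simp: conc_ev intro!: e_in_Sn\<close>)
  then show ?thesis
    by (intro Sn_mem[OF F lin_on_conc Sn_sub]) auto
qed

text \<open>Graded commutativity: a letter passes a word by successive transpositions, and the signs add up.\<close>

lemma e_move:
  assumes "set us \<subseteq> H" "set vs \<subseteq> H" "x \<in> H" "set v \<subseteq> H"
  shows "e (us @ x # v @ vs) = fscale (ksign (dg x * wdeg v)) (e (us @ v @ x # vs))"
  using assms
proof (induction v arbitrary: us)
  case (Cons y v)
  have "e (us @ x # (y # v) @ vs) = fscale (ksign (dg x * dg y)) (e ((us @ [y]) @ x # v @ vs))"
    using Cons.prems e_swap[of us "v @ vs" x y] by simp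
  also have "\<dots> = fscale (ksign (dg x * wdeg (y # v))) (e (us @ (y # v) @ x # vs))"
    using Cons.prems Cons.IH[of "us @ [y]"] by (simp add: ksign_mult_add)
  finally show ?case .
qed simp

lemma e_commute:
  assumes "set u \<subseteq> H" "set v \<subseteq> H"
  shows "e (u @ v) = fscale (ksign (wdeg u * wdeg v)) (e (v @ u))"
  using assms
proof (induction u arbitrary: v)
  case (Cons x u)
  have "e ((x # u) @ v) = fscale (ksign (wdeg u * wdeg v)) (e [x] \<cdot> e (v @ u))"
    using Cons.prems Cons.IH[of v] conc_ev[of "[x]" "u @ v"]
      conc_scale_right[OF e_in_S e_in_S, of "[x]" "v @ u"] by simp
  also have "e [x] \<cdot> e (v @ u) = e ([] @ x # v @ u)"
    using Cons.prems by (simp add: conc_ev)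
  also have "\<dots> = fscale (ksign (dg x * wdeg v)) (e ([] @ v @ x # u))"
    using Cons.prems by (intro e_move) auto
  finally show ?case by (simp add: ksign_mult_add mult.commute)
qed simp

lemma graded_commute:
  assumes F: "F \<in> Sn m" and K: "K \<in> Sn n"
  shows "F \<cdot> K = fscale (ksign (m * n)) (K \<cdot> F)"
proof -
  have "e u \<cdot> K = fscale (ksign (m * n)) (K \<cdot> e u)" if u: "set u \<subseteq> H" "wdeg u = m" for u
    by (rule Sn_eq[OF K lin_on_conc_right[OF e_in_S[OF u(1)] Sn_subset_S] lin_on_ops(3)[OF lin_on_conc]])
      (use u in \<open>auto simp: conc_ev e_commute[of u]\<close>)
  then show ?thesis
    by (intro Sn_eq[OF F lin_on_conc lin_on_ops(3)[OF lin_on_conc_right[OF Sn_S[OF K] Sn_subset_S]]])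
qed

end

section \<open>Derivations of odd degree\<close>

lemma der_extend_add: "der_extend \<Phi> G f (F + K) = der_extend \<Phi> G f F + der_extend \<Phi> G f K"
  by (simp add: der_extend_def lift_add)

lemma der_extend_scale: "der_extend \<Phi> G f (fscale c F) = fscale c (der_extend \<Phi> G f F)"
  by (simp add: der_extend_def lift_fscale)

lemma lin_on_der: "lin_on S (der_extend \<Phi> G f)"
  by (simp add: lin_on_def der_extend_add der_extend_scale)

context graded_space
begin

definition odd_gen :: "('a \<Rightarrow> ('a, 'k) words) \<Rightarrow> bool"
  where "odd_gen f \<longleftrightarrow> (\<forall>n. \<forall>x\<in>G n. f x \<in> Sn (n - 1) \<and> (\<forall>y\<in>G n. f (x + y) = f x + f y) \<and>
     (\<forall>c. f (sc c x) = fscale c (f x)))"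

lemma odd_genD:
  assumes "odd_gen f" "x \<in> G n"
  shows "f x \<in> Sn (n - 1)" "y \<in> G n \<Longrightarrow> f (x + y) = f x + f y" "f (sc c x) = fscale c (f x)"
  using assms unfolding odd_gen_def by blast+

lemma odd_gen_S: "odd_gen f \<Longrightarrow> x \<in> H \<Longrightarrow> f x \<in> S"
  using odd_genD(1)[OF _ deg_in] Sn_S by blast

text \<open>The Leibniz expansion before passing to classes of words: the summand of \<open>der_extend\<close> at a word.\<close>

definition der_word :: "('a \<Rightarrow> ('a, 'k) words) \<Rightarrow> 'a list \<Rightarrow> ('a, 'k) words" where
  "der_word f w = (\<Sum>i<length w. fscale (ksign (sum_list (map (deg G) (take i w))))
       (conc \<Phi> (ev \<Phi> (take i w)) (conc \<Phi> (f (w ! i)) (ev \<Phi> (drop (Suc i) w)))))"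

lemma der_word_Nil [simp]: "der_word f [] = 0"
  by (simp add: der_word_def)

lemma subset_take_drop: "set w \<subseteq> H \<Longrightarrow> set (take i w) \<subseteq> H" "set w \<subseteq> H \<Longrightarrow> set (drop i w) \<subseteq> H"
  using set_take_subset set_drop_subset by fast+

lemma der_word_S:
  assumes "odd_gen f" "set w \<subseteq> H"
  shows "der_word f w \<in> S"
  unfolding der_word_def
proof (intro fs.span_sum fs.span_scale conc_in_S e_in_S subset_take_drop assms)
  fix i assume "i \<in> {..<length w}"
  then show "f (w ! i) \<in> S"
    using assms by (intro odd_gen_S) (auto dest: nth_mem)
qed

lemma der_word_Cons:
  assumes "odd_gen f" "x \<in> H" "set w \<subseteq> H"
  shows "der_word f (x # w) = f x \<cdot> e w + fscale (ksign (dg x)) (e [x] \<cdot> der_word f w)"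
proof -
  let ?t = "\<lambda>i. e (take i w) \<cdot> (f (w ! i) \<cdot> e (drop (Suc i) w))"
  have eS: "e [x] \<in> S" using assms by (intro e_in_S) auto
  have tS: "?t i \<in> S" if "i < length w" for i
    using that assms by (intro conc_in_S e_in_S subset_take_drop odd_gen_S) (auto dest: nth_mem)
  have step: "e (x # take i w) \<cdot> (f (w ! i) \<cdot> e (drop (Suc i) w)) = e [x] \<cdot> ?t i"
    if "i < length w" for i
  proof -
    have "e (x # take i w) = e [x] \<cdot> e (take i w)"
      using assms subset_take_drop[of w i] by (subst conc_ev) auto
    then show ?thesis
      using that assms eS
      by (simp only:) (intro conc_assoc conc_in_S e_in_S subset_take_drop odd_gen_S, auto dest: nth_mem)
  qed
  have "der_word f (x # w) = e [] \<cdot> (f x \<cdot> e w) +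
      (\<Sum>i<length w. fscale (ksign (dg x + wdeg (take i w))) (e (x # take i w) \<cdot> (f (w ! i) \<cdot> e (drop (Suc i) w))))"
    by (simp add: der_word_def sum.lessThan_Suc_shift del: sum.lessThan_Suc)
  also have "e [] \<cdot> (f x \<cdot> e w) = f x \<cdot> e w"
    using assms by (intro one_conc conc_in_S e_in_S odd_gen_S) auto
  also have "(\<Sum>i<length w. fscale (ksign (dg x + wdeg (take i w))) (e (x # take i w) \<cdot> (f (w ! i) \<cdot> e (drop (Suc i) w)))) =
      (\<Sum>i<length w. fscale (ksign (dg x)) (e [x] \<cdot> fscale (ksign (wdeg (take i w))) (?t i)))"
    using step by (intro sum.cong) (simp_all add: ksign_add conc_scale_right[OF eS tS])
  also have "\<dots> = fscale (ksign (dg x)) (e [x] \<cdot> der_word f w)"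
    unfolding der_word_def fs.scale_sum_right[symmetric]
    by (subst conc_sum_right[OF eS]) (auto intro!: fs.span_scale tS)
  finally show ?thesis .
qed

lemma der_word_Cons':
  assumes "odd_gen f" "x \<in> G n" "set w \<subseteq> H"
  shows "der_word f (x # w) = f x \<cdot> e w + fscale (ksign n) (e [x] \<cdot> der_word f w)"
  using der_word_Cons[OF assms(1) G_homs[OF assms(2)] assms(3)]
  by (simp only: conc_scale_left[symmetric] ksign_single[OF assms(2)])

lemma der_word_append:
  assumes "odd_gen f" "set u \<subseteq> H" "set v \<subseteq> H"
  shows "der_word f (u @ v) = der_word f u \<cdot> e v + fscale (ksign (wdeg u)) (e u \<cdot> der_word f v)"
  using assms(2)
proof (induction u)
  case Nil
  show ?case using one_conc[OF der_word_S[OF assms(1,3)]] by simp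
next
  case (Cons x u)
  have xH: "x \<in> H" and uH: "set u \<subseteq> H" and uvH: "set (u @ v) \<subseteq> H"
    using Cons.prems assms by auto
  have xS: "e [x] \<in> S" using xH by (intro e_in_S) auto
  note mem = der_word_S[OF assms(1)] e_in_S uH uvH assms(3) xS odd_gen_S[OF assms(1) xH]
    conc_in_S fs.span_scale
  have IH: "der_word f (u @ v) = der_word f u \<cdot> e v + fscale (ksign (wdeg u)) (e u \<cdot> der_word f v)"
    using Cons.IH uH by simp
  have "der_word f ((x # u) @ v) =
      f x \<cdot> e (u @ v) + fscale (ksign (dg x)) (e [x] \<cdot> der_word f (u @ v))"
    using der_word_Cons[OF assms(1) xH uvH] by simp
  also have "f x \<cdot> e (u @ v) = (f x \<cdot> e u) \<cdot> e v"
    by (simp only: conc_ev[OF uH assms(3), symmetric]) (intro conc_assoc[symmetric] mem)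
  also have "e [x] \<cdot> der_word f (u @ v) =
      (e [x] \<cdot> der_word f u) \<cdot> e v + fscale (ksign (wdeg u)) (e (x # u) \<cdot> der_word f v)"
  proof -
    have "e [x] \<cdot> der_word f (u @ v) =
       e [x] \<cdot> (der_word f u \<cdot> e v) + e [x] \<cdot> fscale (ksign (wdeg u)) (e u \<cdot> der_word f v)"
      unfolding IH by (intro conc_add_right mem)
    also have "e [x] \<cdot> (der_word f u \<cdot> e v) = (e [x] \<cdot> der_word f u) \<cdot> e v"
      by (intro conc_assoc[symmetric] mem)
    also have "e [x] \<cdot> fscale (ksign (wdeg u)) (e u \<cdot> der_word f v) =
        fscale (ksign (wdeg u)) (e [x] \<cdot> (e u \<cdot> der_word f v))"
      by (intro conc_scale_right mem)
    also have "e [x] \<cdot> (e u \<cdot> der_word f v) = (e [x] \<cdot> e u) \<cdot> der_word f v"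
      by (intro conc_assoc[symmetric] mem)
    also have "e [x] \<cdot> e u = e (x # u)"
      using xH uH by (subst conc_ev) auto
    finally show ?thesis .
  qed
  finally have eq: "der_word f ((x # u) @ v) = (f x \<cdot> e u) \<cdot> e v + fscale (ksign (dg x))
    ((e [x] \<cdot> der_word f u) \<cdot> e v + fscale (ksign (wdeg u)) (e (x # u) \<cdot> der_word f v))" .
  show ?case
    unfolding eq der_word_Cons[OF assms(1) xH uH] conc_add_left conc_scale_left fs.scale_right_distrib
    by (simp add: ksign_add add.assoc)
qed

lemma e_swap':
  assumes "set us \<subseteq> H" "set vs \<subseteq> H" "x \<in> G m" "y \<in> G n"
  shows "e (us @ x # y # vs) = fscale (ksign (m * n)) (e (us @ y # x # vs))"
  using symD[OF _ assms] by (intro ext) (simp add: ev_def pointwise)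

lemma der_word_single:
  assumes "odd_gen f" "x \<in> H"
  shows "der_word f [x] = f x"
  using der_word_Cons[OF assms, of "[]"] conc_one[OF odd_gen_S[OF assms]] assms
  by (simp add: e_in_S)

lemma der_word_swap:
  assumes f: "odd_gen f" and x: "x \<in> G m" and y: "y \<in> G n"
  shows "der_word f [x, y] = fscale (ksign (m * n)) (der_word f [y, x])"
proof -
  have H: "x \<in> H" "y \<in> H" "set [x] \<subseteq> H" "set [y] \<subseteq> H" using x y G_homs by auto
  have "f x \<cdot> e [y] = fscale (ksign ((m - 1) * n)) (e [y] \<cdot> f x)"
    by (rule graded_commute[OF odd_genD(1)[OF f x] e_single[OF y]])
  moreover have "e [x] \<cdot> f y = fscale (ksign (m * (n - 1))) (f y \<cdot> e [x])"
    by (rule graded_commute[OF e_single[OF x] odd_genD(1)[OF f y]])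
  moreover have "ksign ((m - 1) * n) = (ksign (m * n) * ksign n :: 'k)"
    "ksign m * ksign (m * (n - 1)) = (ksign (m * n) :: 'k)"
    by (auto simp: ksign_def)
  ultimately show ?thesis
    unfolding der_word_Cons'[OF f x H(4)] der_word_Cons'[OF f y H(3)]
      der_word_single[OF f H(1)] der_word_single[OF f H(2)]
    by (simp add: fs.scale_right_distrib add.commute)
qed

text \<open>The Leibniz expansion respects a linear relation between words in every context.  The
  relations that define the symmetric algebra (additivity, homogeneity, transposition) are all of this
  shape.  The signed relation \<open>s\<close> is a separate hypothesis because \<open>wdeg\<close> is not determined when a
  letter such as \<open>x + y\<close> is zero.\<close>

lemma der_word_context:
  assumes f: "odd_gen f" and H: "set us \<subseteq> H" "set vs \<subseteq> H" "set p \<subseteq> H" "set q \<subseteq> H" "set r \<subseteq> H"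
    and e: "e p = fscale a (e q) + fscale b (e r)"
    and s: "fscale (ksign (wdeg p)) (e p) =
      fscale a (fscale (ksign (wdeg q)) (e q)) + fscale b (fscale (ksign (wdeg r)) (e r))"
    and d: "der_word f p = fscale a (der_word f q) + fscale b (der_word f r)"
  shows "der_word f (us @ p @ vs) =
    fscale a (der_word f (us @ q @ vs)) + fscale b (der_word f (us @ r @ vs))"
proof -
  have HH: "set (w @ vs) \<subseteq> H" if "set w \<subseteq> H" for w using that H by simp
  note mem = e_in_S[OF H(1)] der_word_S[OF f H(1)] e_in_S[OF HH[OF H(4)]] e_in_S[OF HH[OF H(5)]]
    der_word_S[OF f HH[OF H(4)]] der_word_S[OF f HH[OF H(5)]]
  have ev: "e (p @ vs) = fscale a (e (q @ vs)) + fscale b (e (r @ vs))"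
    unfolding conc_ev[OF H(3,2), symmetric] conc_ev[OF H(4,2), symmetric] conc_ev[OF H(5,2), symmetric]
    by (simp add: e conc_add_left conc_scale_left)
  have "fscale (ksign (wdeg p)) (e p \<cdot> der_word f vs) =
      fscale a (fscale (ksign (wdeg q)) (e q \<cdot> der_word f vs)) +
      fscale b (fscale (ksign (wdeg r)) (e r \<cdot> der_word f vs))"
    using arg_cong[OF s, of "\<lambda>F. F \<cdot> der_word f vs"] by (simp only: conc_add_left conc_scale_left)
  then have dv: "der_word f (p @ vs) = fscale a (der_word f (q @ vs)) + fscale b (der_word f (r @ vs))"
    unfolding der_word_append[OF f H(3,2)] der_word_append[OF f H(4,2)] der_word_append[OF f H(5,2)]
    by (simp only: d conc_add_left conc_scale_left fs.scale_right_distrib) (simp only: ac_simps)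
  show ?thesis
    unfolding der_word_append[OF f H(1) HH[OF H(3)]] der_word_append[OF f H(1) HH[OF H(4)]]
      der_word_append[OF f H(1) HH[OF H(5)]] ev dv
      conc_add_right[OF mem(1) fs.span_scale[OF mem(5)] fs.span_scale[OF mem(6)]]
      conc_add_right[OF mem(2) fs.span_scale[OF mem(3)] fs.span_scale[OF mem(4)]]
      conc_scale_right[OF mem(1) mem(5)] conc_scale_right[OF mem(1) mem(6)]
      conc_scale_right[OF mem(2) mem(3)] conc_scale_right[OF mem(2) mem(4)]
    by (simp add: fs.scale_right_distrib ac_simps)
qed

text \<open>A degree \<open>- 1\<close> map on generators extends to a derivation: the Leibniz expansion is compatible
  with the relations of the symmetric algebra.\<close>

lemma der_word_form:
  assumes f: "odd_gen f" and M: "M \<in> \<Phi>"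
  shows "(\<lambda>w. der_word f w M) \<in> \<Phi>"
proof (rule symI[OF multilinI])
  note ctx = der_word_context[OF f] and der = der_word_single[OF f G_homs]
  fix us vs :: "'a list" assume H: "set us \<subseteq> H" "set vs \<subseteq> H"
  fix x m assume x: "x \<in> G m"
  show "der_word f (us @ (x + y) # vs) M = der_word f (us @ x # vs) M + der_word f (us @ y # vs) M"
    if y: "y \<in> G m" for y
  proof -
    have "e ([] @ (x + y) # []) = e ([] @ x # []) + e ([] @ y # [])"
      using x y by (intro e_add) auto
    then have e: "e [x + y] = e [x] + e [y]" by simp
    have s: "fscale (ksign (wdeg [x + y])) (e [x + y]) =
        fscale 1 (fscale (ksign (wdeg [x])) (e [x])) + fscale 1 (fscale (ksign (wdeg [y])) (e [y]))"
      using ksign_single[OF G_add[OF x y]]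
      by (simp add: ksign_single[OF x] ksign_single[OF y] e fs.scale_right_distrib)
    have "der_word f (us @ [x + y] @ vs) =
        fscale 1 (der_word f (us @ [x] @ vs)) + fscale 1 (der_word f (us @ [y] @ vs))"
      by (rule ctx[OF H _ _ _ _ s])
        (use x y G_add[OF x y] in \<open>simp_all add: G_homs e der odd_genD(2)[OF f x]\<close>)
    then show ?thesis by (simp add: plus_fun_apply[of _ _ M])
  qed
  show "der_word f (us @ sc c x # vs) M = c * der_word f (us @ x # vs) M" for c
  proof -
    have "e ([] @ sc c x # []) = fscale c (e ([] @ x # []))"
      using x G_homs by (intro e_scale) auto
    then have e: "e [sc c x] = fscale c (e [x])" by simp
    have s: "fscale (ksign (wdeg [sc c x])) (e [sc c x]) =
        fscale c (fscale (ksign (wdeg [x])) (e [x])) + fscale 0 (fscale (ksign (wdeg [x])) (e [x]))"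
      using ksign_single[OF G_scale[OF x, of c]] arg_cong[OF ksign_single[OF x], of "fscale c"]
      by (auto simp: e)
    have "der_word f (us @ [sc c x] @ vs) =
        fscale c (der_word f (us @ [x] @ vs)) + fscale 0 (der_word f (us @ [x] @ vs))"
      by (rule ctx[OF H _ _ _ _ s])
        (use x G_scale[OF x, of c] in \<open>simp_all add: G_homs e der odd_genD(3)[OF f x]\<close>)
    then show ?thesis by (simp add: fscale_apply[of _ _ M])
  qed
  show "der_word f (us @ x # y # vs) M = ksign (m * n) * der_word f (us @ y # x # vs) M"
    if y: "y \<in> G n" for n y
  proof -
    have e: "e [x, y] = fscale (ksign (m * n)) (e [y, x])"
      using e_swap'[of "[]" "[]", OF _ _ x y] by simp
    have w: "wdeg [x, y] = wdeg [y, x]" by simp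
    have "der_word f (us @ [x, y] @ vs) =
        fscale (ksign (m * n)) (der_word f (us @ [y, x] @ vs)) + fscale 0 (der_word f (us @ [y, x] @ vs))"
      by (rule ctx[OF H], unfold e w der_word_swap[OF f x y])
        (use x y in \<open>simp_all add: G_homs mult.commute\<close>)
    then show ?thesis by (simp add: fscale_apply[of _ _ M])
  qed
qed

abbreviation der where "der f \<equiv> der_extend \<Phi> G f"

lemma der_ev:
  assumes "odd_gen f" "set w \<subseteq> H"
  shows "der f (e w) = der_word f w"
  unfolding der_extend_def der_word_def[symmetric]
  by (rule lift_in[OF der_word_form[OF assms(1)] der_word_S[OF assms(1)] assms(2)])

lemma der_Nil: "odd_gen f \<Longrightarrow> der f (e []) = 0"
  by (simp add: der_ev)

lemma der_single: "odd_gen f \<Longrightarrow> x \<in> H \<Longrightarrow> der f (e [x]) = f x"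
  using der_ev[of f "[x]"] der_word_single[of f x] by simp

lemma der_zero [simp]: "der f 0 = 0"
  by (simp add: der_extend_def)

text \<open>The Leibniz rule is required for classes of words only, since these span; the rule for
  homogeneous elements is \<open>Leibniz\<close>.\<close>

definition odd_derivation :: "(('a, 'k) words \<Rightarrow> ('a, 'k) words) \<Rightarrow> bool"
  where "odd_derivation D \<longleftrightarrow> (\<forall>F K. D (F + K) = D F + D K) \<and> (\<forall>c F. D (fscale c F) = fscale c (D F)) \<and>
     (\<forall>n. \<forall>F\<in>Sn n. D F \<in> Sn (n - 1)) \<and>
     (\<forall>u v. set u \<subseteq> H \<longrightarrow> set v \<subseteq> H \<longrightarrow> D (e u \<cdot> e v) = D (e u) \<cdot> e v + fscale (ksign (wdeg u)) (e u \<cdot> D (e v)))"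

lemma der_word_Sn:
  assumes "odd_gen f" "set w \<subseteq> H"
  shows "der_word f w \<in> Sn (wdeg w - 1)"
  using assms(2)
proof (induction w)
  case Nil
  show ?case by (simp add: Sn_intros)
next
  case (Cons x w)
  then have x: "x \<in> H" and w: "set w \<subseteq> H" by auto
  have "f x \<cdot> e w \<in> Sn (dg x - 1 + wdeg w)"
    by (intro Sn_conc odd_genD(1)[OF assms(1) deg_in] e_in_Sn x w refl)
  moreover have "e [x] \<cdot> der_word f w \<in> Sn (dg x + (wdeg w - 1))"
    using Cons.IH[OF w] x by (intro Sn_conc e_in_Sn) auto
  ultimately show ?case
    unfolding der_word_Cons[OF assms(1) x w] by (intro Sn_intros) (simp_all add: algebra_simps)
qed

lemma der_odd_derivation:
  assumes "odd_gen f"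
  shows "odd_derivation (der f)"
  unfolding odd_derivation_def
proof (intro conjI allI ballI impI)
  show "der f F \<in> Sn (n - 1)" if "F \<in> Sn n" for n F
    using der_word_Sn[OF assms]
    by (intro Sn_mem[OF that lin_on_der Sn_sub]) (auto simp: der_ev[OF assms])
  show "der f (e u \<cdot> e v) = der f (e u) \<cdot> e v + fscale (ksign (wdeg u)) (e u \<cdot> der f (e v))"
    if "set u \<subseteq> H" "set v \<subseteq> H" for u v
    using that der_word_append[OF assms that] by (simp add: conc_ev der_ev[OF assms])
qed (simp_all add: der_extend_add der_extend_scale)

lemma odd_derivationD:
  assumes "odd_derivation D"
  shows "D (F + K) = D F + D K" "D (fscale c F) = fscale c (D F)" "F \<in> Sn n \<Longrightarrow> D F \<in> Sn (n - 1)"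
  using assms unfolding odd_derivation_def by blast+

lemma lin_on_odd: "odd_derivation D \<Longrightarrow> lin_on T D"
  by (simp add: lin_on_def odd_derivationD)

lemma odd_derivation_zero: "odd_derivation D \<Longrightarrow> D 0 = 0"
  using odd_derivationD(2)[of D 0 0] by simp

lemma odd_derivation_minus: "odd_derivation D \<Longrightarrow> D (- F) = - D F"
  using odd_derivationD(2)[of D "-1" F] by simp

lemma odd_derivation_diff: "odd_derivation D \<Longrightarrow> D (F - K) = D F - D K"
  using odd_derivationD(1)[of D F "- K"] odd_derivation_minus[of D K] by simp

lemma odd_derivation_sum:
  assumes "odd_derivation D" "odd_derivation D'"
  shows "odd_derivation (\<lambda>F. D F + D' F)"
  unfolding odd_derivation_def
proof (intro conjI allI ballI impI)
  show "D F + D' F \<in> Sn (n - 1)" if "F \<in> Sn n" for n F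
    by (rule Sn_intros(1)[OF odd_derivationD(3)[OF assms(1) that] odd_derivationD(3)[OF assms(2) that]])
  fix u v :: "'a list"
  assume uv: "set u \<subseteq> H" "set v \<subseteq> H"
  have mem: "e u \<in> S" "D (e v) \<in> S" "D' (e v) \<in> S"
    using uv assms odd_derivationD(3)[of _ "e v" "wdeg v"] by (auto intro!: e_in_S Sn_S e_in_Sn)
  have "D (e u \<cdot> e v) = D (e u) \<cdot> e v + fscale (ksign (wdeg u)) (e u \<cdot> D (e v))"
    "D' (e u \<cdot> e v) = D' (e u) \<cdot> e v + fscale (ksign (wdeg u)) (e u \<cdot> D' (e v))"
    using assms uv unfolding odd_derivation_def by blast+
  then show "D (e u \<cdot> e v) + D' (e u \<cdot> e v) =
      (D (e u) + D' (e u)) \<cdot> e v + fscale (ksign (wdeg u)) (e u \<cdot> (D (e v) + D' (e v)))"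
    by (simp add: conc_add_left conc_add_right[OF mem] fs.scale_right_distrib algebra_simps)
next
  show "D (F + K) + D' (F + K) = D F + D' F + (D K + D' K)" for F K
    by (simp add: odd_derivationD(1)[OF assms(1)] odd_derivationD(1)[OF assms(2)] algebra_simps)
  show "D (fscale c F) + D' (fscale c F) = fscale c (D F + D' F)" for c F
    by (simp add: odd_derivationD(2)[OF assms(1)] odd_derivationD(2)[OF assms(2)] fs.scale_right_distrib)
qed

lemma Leibniz:
  assumes D: "odd_derivation D" and F: "F \<in> Sn m" and K: "K \<in> Sn n"
  shows "D (F \<cdot> K) = D F \<cdot> K + fscale (ksign m) (F \<cdot> D K)"
proof -
  have lin: "lin_on (Sn i) (\<lambda>K. A \<cdot> K)" if "A \<in> Sn j" for A i j
    by (rule lin_on_conc_right[OF Sn_S[OF that] Sn_subset_S])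
  have linD: "lin_on (Sn i) (\<lambda>K. A \<cdot> D K)" if "A \<in> Sn j" for A i j
    using lin[OF that, of "i - 1"] odd_derivationD[OF D] by (simp add: lin_on_def)
  note comp = lin_on_comp[OF lin_on_odd[OF D]]
  have "D (e u \<cdot> K) = D (e u) \<cdot> K + fscale (ksign m) (e u \<cdot> D K)" if u: "set u \<subseteq> H" "wdeg u = m" for u
  proof -
    have eu: "e u \<in> Sn m" using u by (rule e_in_Sn)
    show ?thesis
      by (rule Sn_eq[OF K comp[OF lin[OF eu]] lin_on_ops(1)[OF lin[OF odd_derivationD(3)[OF D eu]]
            lin_on_ops(3)[OF linD[OF eu]]]]) (use D u in \<open>auto simp: odd_derivation_def\<close>)
  qed
  moreover have "lin_on (Sn m) (\<lambda>F. D F \<cdot> K)"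
    by (simp add: lin_on_def odd_derivationD[OF D] conc_add_left conc_scale_left)
  ultimately show ?thesis
    by (intro Sn_eq[OF F comp[OF lin_on_conc] lin_on_ops(1)[OF _ lin_on_ops(3)[OF lin_on_conc]]])
qed

text \<open>The two mixed terms cancel, because \<open>D F\<close> and \<open>F\<close> have opposite parity.  Therefore
  \<open>D\<^sup>2 = 0\<close> need only be checked on generators.\<close>

lemma square_derivation:
  assumes D: "odd_derivation D" and F: "F \<in> Sn m" and K: "K \<in> Sn n"
  shows "D (D (F \<cdot> K)) = D (D F) \<cdot> K + F \<cdot> D (D K)"
proof -
  note D' = odd_derivationD[OF D]
  have "D (D (F \<cdot> K)) = D (D F \<cdot> K) + fscale (ksign m) (D (F \<cdot> D K))"
    unfolding Leibniz[OF D F K] D' ..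
  also have "D (D F \<cdot> K) = D (D F) \<cdot> K + fscale (ksign (m - 1)) (D F \<cdot> D K)"
    by (rule Leibniz[OF D D'(3)[OF F] K])
  also have "D (F \<cdot> D K) = D F \<cdot> D K + fscale (ksign m) (F \<cdot> D (D K))"
    by (rule Leibniz[OF D F D'(3)[OF K]])
  finally show ?thesis by (simp add: ksign_minus1 fs.scale_right_distrib)
qed

lemma derivation_Nil:
  assumes "odd_derivation D"
  shows "D (e []) = 0"
proof -
  have 1: "e [] \<in> Sn 0" by (rule e_in_Sn) auto
  have "D (e [] \<cdot> e []) = D (e []) \<cdot> e [] + fscale (ksign 0) (e [] \<cdot> D (e []))"
    by (rule Leibniz[OF assms 1 1])
  moreover have "e [] \<cdot> e [] = e []" by (simp add: conc_ev)
  ultimately show ?thesis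
    using Sn_S[OF odd_derivationD(3)[OF assms 1]] by (simp add: one_conc conc_one)
qed

lemma square_zero_word:
  assumes D: "odd_derivation D" and "set w \<subseteq> H" "\<And>x. x \<in> set w \<Longrightarrow> D (D (e [x])) = 0"
  shows "D (D (e w)) = 0"
  using assms(2,3)
proof (induction w)
  case Nil
  show ?case by (simp add: derivation_Nil[OF D] odd_derivation_zero[OF D])
next
  case (Cons x w)
  have "e (x # w) = e [x] \<cdot> e w" using Cons.prems by (simp add: conc_ev)
  then have "D (D (e (x # w))) = D (D (e [x])) \<cdot> e w + e [x] \<cdot> D (D (e w))"
    using Cons.prems square_derivation[OF D e_in_Sn e_in_Sn, of "[x]" _ w] by simp
  then show ?case using Cons e_in_S[of "[x]"] by simp
qed

lemma derivation_cong_word: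
  assumes "odd_derivation D" "odd_derivation D'" "set w \<subseteq> H" "\<And>x. x \<in> set w \<Longrightarrow> D (e [x]) = D' (e [x])"
  shows "D (e w) = D' (e w)"
  using assms(3,4)
proof (induction w)
  case (Cons x w)
  have eq: "e (x # w) = e [x] \<cdot> e w" using Cons.prems by (simp add: conc_ev)
  have mem: "e [x] \<in> Sn (dg x)" "e w \<in> Sn (wdeg w)"
    using Cons.prems by (auto intro: e_in_Sn)
  show ?case
    unfolding eq Leibniz[OF assms(1) mem] Leibniz[OF assms(2) mem] using Cons by simp
qed (simp add: derivation_Nil assms)

end

section \<open>Word length\<close>

lemma weight_proj_add: "weight_proj \<Phi> n (F + K) = weight_proj \<Phi> n F + weight_proj \<Phi> n K"
  by (simp add: weight_proj_def lift_add)

lemma weight_proj_scale: "weight_proj \<Phi> n (fscale c F) = fscale c (weight_proj \<Phi> n F)"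
  by (simp add: weight_proj_def lift_fscale)

lemma weight_proj_zero [simp]: "weight_proj \<Phi> n 0 = 0"
  by (simp add: weight_proj_def)

lemma weight_proj_diff: "weight_proj \<Phi> n (F - K) = weight_proj \<Phi> n F - weight_proj \<Phi> n K"
  by (simp add: weight_proj_def lift_diff)

lemma weight_proj_sum: "weight_proj \<Phi> n (sum f I) = (\<Sum>i\<in>I. weight_proj \<Phi> n (f i))"
  by (induction I rule: infinite_finite_induct) (auto simp: weight_proj_add)

lemma lin_on_weight_proj: "lin_on S (weight_proj \<Phi> n)"
  by (simp add: lin_on_def weight_proj_add weight_proj_scale)

text \<open>Asking for every \<open>M\<close> beyond some \<open>N\<close> makes the condition closed under sums: the maximum
  of two bounds is a bound.\<close>

lemma weight_bounded:
  assumes "F \<in> fspan B" and B: "\<And>b. b \<in> B \<Longrightarrow> \<exists>l. \<forall>k. weight_proj \<Phi> k b = (if k = l then b else 0)"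
  shows "\<exists>N. \<forall>M\<ge>N. weight_proj \<Phi> M F = 0 \<and> F = (\<Sum>l<M. weight_proj \<Phi> l F)"
proof -
  let ?W = "{F. \<exists>N. \<forall>M\<ge>N. weight_proj \<Phi> M F = 0 \<and> F = (\<Sum>l<M. weight_proj \<Phi> l F)}"
  have "fsubspace ?W"
  proof (rule fs.subspaceI)
    fix F K c assume "F \<in> ?W"
    then obtain N where N: "\<And>M. M \<ge> N \<Longrightarrow> weight_proj \<Phi> M F = 0 \<and> F = (\<Sum>l<M. weight_proj \<Phi> l F)"
      by blast
    have "fscale c F = (\<Sum>l<M. weight_proj \<Phi> l (fscale c F))" if "M \<ge> N" for M
      using N[OF that] by (simp only: weight_proj_scale fs.scale_sum_right[symmetric])
    then show "fscale c F \<in> ?W" using N by (auto simp: weight_proj_scale)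
    assume "K \<in> ?W"
    then obtain N' where N': "\<And>M. M \<ge> N' \<Longrightarrow> weight_proj \<Phi> M K = 0 \<and> K = (\<Sum>l<M. weight_proj \<Phi> l K)"
      by blast
    have "F + K = (\<Sum>l<M. weight_proj \<Phi> l (F + K))" if "M \<ge> max N N'" for M
      using N[of M] N'[of M] that by (simp only: weight_proj_add sum.distrib max.bounded_iff)
    moreover have "weight_proj \<Phi> M (F + K) = 0" if "M \<ge> max N N'" for M
      using N[of M] N'[of M] that by (simp add: weight_proj_add)
    ultimately show "F + K \<in> ?W" by blast
  qed simp
  moreover have "b \<in> ?W" if b: "b \<in> B" for b
  proof -
    obtain l where l: "\<And>k. weight_proj \<Phi> k b = (if k = l then b else 0)" using B[OF b] by blast
    have "(\<Sum>k<M. weight_proj \<Phi> k b) = (\<Sum>k<M. if k = l then b else 0)" for M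
      by (intro sum.cong) (simp_all add: l)
    then show ?thesis
      by (intro CollectI exI[of _ "Suc l"]) (simp add: l)
  qed
  ultimately show ?thesis using fspan_mem[OF assms(1) lin_on_ops(4), of ?W] by blast
qed

context graded_space
begin

interpretation V: vector_space sc by (rule vs)

lemma multilin_truncate: "M \<in> multilin sc G \<Longrightarrow> (\<lambda>w. if length w = l then M w else 0) \<in> multilin sc G"
  by (rule multilinI) (auto simp: multilinD)

text \<open>Transposition does not change the length, so the relations of the symmetric algebra are
  homogeneous in length.\<close>

lemma sym_truncate:
  assumes "M \<in> \<Phi>"
  shows "(\<lambda>w. if length w = l then M w else 0) \<in> \<Phi>"
proof (rule symI[OF multilin_truncate[OF sym_multilin[OF assms]]])
  fix us vs m n x y assume *: "set us \<subseteq> H" "set vs \<subseteq> H" "x \<in> G m" "y \<in> G n"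
  show "(if length (us @ x # y # vs) = l then M (us @ x # y # vs) else 0) =
    ksign (m * n) * (if length (us @ y # x # vs) = l then M (us @ y # x # vs) else 0)"
    using symD[OF assms *] by simp
qed

lemma weight_proj_word:
  assumes "set w \<subseteq> H"
  shows "weight_proj \<Phi> l (e w) = (if length w = l then e w else 0)"
  unfolding weight_proj_def
proof (rule lift_in[OF _ _ assms])
  fix M assume M: "M \<in> \<Phi>"
  have "(\<lambda>u. (if length u = l then e u else 0) M) = (\<lambda>w. if length w = l then M w else 0)"
    using M by (auto simp: e_apply pointwise)
  then show "(\<lambda>u. (if length u = l then e u else 0) M) \<in> \<Phi>"
    using sym_truncate[OF M] by simp
qed (auto intro: e_in_S fs.span_zero)

text \<open>Generators embed into the symmetric algebra: a functional on letters, extended by zero to words of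
  other lengths, is a symmetric form.\<close>

lemma e_single_inj:
  assumes "x \<in> G n" "e [x] = 0"
  shows "x = 0"
proof (rule ccontr)
  assume "x \<noteq> 0"
  then have "x \<notin> {0}" by simp
  obtain l where l: "\<And>a b. l (a + b) = l a + l b" "\<And>c a. l (sc c a) = c * l a"
      "l x = 1"
    using separating_functional[OF vs V.subspace_single_0 \<open>x \<notin> {0}\<close>] by blast
  define M where "M w = (case w of [y] \<Rightarrow> l y | _ \<Rightarrow> 0)" for w
  have short: "M w = 0" if "length w \<noteq> 1" for w
    using that by (auto simp: M_def split: list.splits)
  have "M \<in> \<Phi>"
  proof (rule symI[OF multilinI])
    fix us vs :: "'a list" and y z c
    show "M (us @ (y + z) # vs) = M (us @ y # vs) + M (us @ z # vs)"
      by (cases "us = [] \<and> vs = []") (auto simp: short, auto simp: M_def l)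
    show "M (us @ sc c y # vs) = c * M (us @ y # vs)"
      by (cases "us = [] \<and> vs = []") (auto simp: short, auto simp: M_def l)
    show "M (us @ y # z # vs) = ksign (m * n) * M (us @ z # y # vs)" for m n
      by (simp add: short)
  qed
  then have "e [x] M = 1" by (simp add: e_apply M_def l)
  then show False using assms(2) by (simp add: pointwise)
qed

abbreviation SL :: "int \<Rightarrow> nat \<Rightarrow> ('a, 'k) words set"
  where "SL n l \<equiv> fspan {e w | w. set w \<subseteq> H \<and> wdeg w = n \<and> length w = l}"

lemma SL_mem:
  assumes "F \<in> SL n l" "lin_on (SL n l) f" "fsubspace W"
    "\<And>w. set w \<subseteq> H \<Longrightarrow> wdeg w = n \<Longrightarrow> length w = l \<Longrightarrow> f (e w) \<in> W"
  shows "f F \<in> W"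
  by (rule fspan_mem[OF assms(1-3)]) (use assms(4) in auto)

lemma SL_eq:
  assumes "F \<in> SL n l" "lin_on (SL n l) f" "lin_on (SL n l) g"
    "\<And>w. set w \<subseteq> H \<Longrightarrow> wdeg w = n \<Longrightarrow> length w = l \<Longrightarrow> f (e w) = g (e w)"
  shows "f F = g F"
  by (rule fspan_eq[OF assms(1-3)]) (use assms(4) in auto)

lemma SL_Sn: "F \<in> SL n l \<Longrightarrow> F \<in> Sn n"
  unfolding alg_part_def by (erule set_mp[OF fs.span_mono, rotated]) blast

lemma e_in_SL: "set w \<subseteq> H \<Longrightarrow> wdeg w = n \<Longrightarrow> length w = l \<Longrightarrow> e w \<in> SL n l"
  by (rule fs.span_base) blast

lemma e_single_SL:
  assumes "x \<in> G n"
  shows "e [x] \<in> SL n 1"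
proof (cases "x = 0")
  case True
  show ?thesis unfolding True e_single_zero by (rule fs.span_zero)
next
  case False
  show ?thesis
    by (rule e_in_SL) (use G_homs[OF assms] deg_eq[OF assms False] in simp_all)
qed

lemma weight_proj_SL:
  assumes "F \<in> SL n l"
  shows "weight_proj \<Phi> k F = (if k = l then F else 0)"
proof -
  have "lin_on (SL n l) (\<lambda>F. if k = l then F else 0)" by (simp add: lin_on_def)
  from SL_eq[OF assms lin_on_weight_proj this, of \<Phi> k] show ?thesis by (simp add: weight_proj_word)
qed

lemma weight_proj_in_SL:
  assumes "F \<in> Sn n"
  shows "weight_proj \<Phi> l F \<in> SL n l"
  by (rule Sn_mem[OF assms lin_on_weight_proj fs.subspace_span])
    (auto simp: weight_proj_word fs.span_zero intro: e_in_SL)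

lemma length_bounded:
  assumes "F \<in> Sn n"
  obtains N where "\<And>l. l \<ge> N \<Longrightarrow> weight_proj \<Phi> l F = 0" "F = (\<Sum>l<N. weight_proj \<Phi> l F)"
proof -
  have "\<exists>N. \<forall>M\<ge>N. weight_proj \<Phi> M F = 0 \<and> F = (\<Sum>l<M. weight_proj \<Phi> l F)"
    using assms unfolding alg_part_def
  proof (rule weight_bounded)
    fix b assume "b \<in> {ev \<Phi> w | w. set w \<subseteq> H \<and> wdeg w = n}"
    then obtain w where "b = e w" "set w \<subseteq> H" by blast
    then show "\<exists>l. \<forall>k. weight_proj \<Phi> k b = (if k = l then b else 0)"
      by (auto simp: weight_proj_word)
  qed
  then show ?thesis using that by blast
qed

lemma e_single_linear:
  "x \<in> G n \<Longrightarrow> y \<in> G n \<Longrightarrow> e [x + y] = e [x] + e [y]" "x \<in> G n \<Longrightarrow> e [sc c x] = fscale c (e [x])"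
  using e_add[of "[]" "[]" x n y] e_scale[of "[]" "[]" x c] G_homs by simp_all

lemma SL_1:
  assumes "F \<in> SL n 1"
  obtains x where "x \<in> G n" "F = e [x]"
proof -
  have "fsubspace ((\<lambda>x. e [x]) ` G n)"
  proof (rule fs.subspaceI)
    show "0 \<in> (\<lambda>x. e [x]) ` G n" using G_zero e_single_zero by (metis image_eqI)
    show "F + K \<in> (\<lambda>x. e [x]) ` G n" if "F \<in> (\<lambda>x. e [x]) ` G n" "K \<in> (\<lambda>x. e [x]) ` G n" for F K
      using that G_add by (auto simp: e_single_linear(1)[symmetric])
    show "fscale c F \<in> (\<lambda>x. e [x]) ` G n" if "F \<in> (\<lambda>x. e [x]) ` G n" for F c
      using that G_scale by (auto simp: e_single_linear(2)[symmetric])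
  qed
  moreover have "e w \<in> (\<lambda>x. e [x]) ` G n" if "set w \<subseteq> H" "wdeg w = n" "length w = 1" for w
    using that deg_in by (cases w) auto
  ultimately have "F \<in> (\<lambda>x. e [x]) ` G n" by (intro SL_mem[OF assms lin_on_ops(4)])
  then show ?thesis using that by blast
qed

lemma SL_0:
  assumes "F \<in> SL n 0" "n \<noteq> 0"
  shows "F = 0"
  by (rule SL_eq[OF assms(1) lin_on_ops(4,5)]) (use assms(2) in auto)

lemma SL_subset_S: "SL n l \<subseteq> S"
  using SL_Sn Sn_S by blast

lemma SL_conc:
  assumes F: "F \<in> SL m k" and K: "K \<in> SL n l"
  shows "F \<cdot> K \<in> SL (m + n) (k + l)"
proof -
  have "e u \<cdot> K \<in> SL (m + n) (k + l)" if u: "set u \<subseteq> H" "wdeg u = m" "length u = k" for u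
    by (rule SL_mem[OF K lin_on_conc_right[OF e_in_S[OF u(1)] SL_subset_S] fs.subspace_span])
      (use u in \<open>auto simp: conc_ev intro!: e_in_SL\<close>)
  then show ?thesis
    by (intro SL_mem[OF F lin_on_conc fs.subspace_span]) auto
qed

text \<open>One of the \<open>k + 1\<close> letters is replaced by words of length \<open>l\<close>.\<close>

lemma der_word_SL:
  assumes f: "odd_gen f" and l: "\<And>x n. x \<in> G n \<Longrightarrow> f x \<in> SL (n - 1) l"
    and "set w \<subseteq> H" "length w = Suc k"
  shows "der_word f w \<in> SL (wdeg w - 1) (k + l)"
  using assms(3,4)
proof (induction w arbitrary: k)
  case (Cons x w)
  then have x: "x \<in> H" and w: "set w \<subseteq> H" "length w = k" by auto
  have "f x \<cdot> e w \<in> SL (dg x - 1 + wdeg w) (l + k)"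
    by (intro SL_conc l[OF deg_in] e_in_SL x w refl)
  moreover have "e [x] \<cdot> der_word f w \<in> SL (dg x + (wdeg w - 1)) (k + l)"
  proof (cases k)
    case 0
    then have "w = []" using w by simp
    moreover have "e [x] \<cdot> 0 = 0" using x by (intro conc_zero_right e_in_S) simp
    ultimately show ?thesis by (simp add: fs.span_zero)
  next
    case (Suc k')
    have "e [x] \<cdot> der_word f w \<in> SL (dg x + (wdeg w - 1)) (1 + (k' + l))"
      using Cons.IH[OF w(1), of k'] x w Suc by (intro SL_conc e_in_SL) auto
    then show ?thesis using Suc by simp
  qed
  ultimately show ?case
    unfolding der_word_Cons[OF f x w(1)]
    by (intro fs.span_add fs.span_scale) (simp_all add: algebra_simps)
qed simp

lemma der_SL_0:
  assumes f: "odd_gen f" and F: "F \<in> SL n 0"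
  shows "der f F = 0"
  by (rule SL_eq[OF F lin_on_der lin_on_ops(5)]) (use der_Nil[OF f] in auto)

end

section \<open>Graded cobrackets\<close>

text \<open>Elements of a tensor square are tested on forms that vanish on words whose length is not \<open>2\<close>.\<close>

abbreviation two :: "('a \<Rightarrow> 'a \<Rightarrow> 'b::zero) \<Rightarrow> 'a list \<Rightarrow> 'b"
  where "two B w \<equiv> (case w of [x, y] \<Rightarrow> B x y | _ \<Rightarrow> 0)"

lemma two_other: "length w \<noteq> 2 \<Longrightarrow> two B w = 0"
  by (auto split: list.splits)

context graded_space
begin

definition graded_map :: "int \<Rightarrow> ('a \<Rightarrow> 'a) \<Rightarrow> bool"
  where "graded_map k f \<longleftrightarrow> (\<forall>n. \<forall>x\<in>G n. f x \<in> G (n - k) \<and> (\<forall>y\<in>G n. f (x + y) = f x + f y) \<and>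
     (\<forall>c. f (sc c x) = sc c (f x)))"

lemma graded_mapD:
  assumes "graded_map k f" "x \<in> G n"
  shows "f x \<in> G (n - k)" "y \<in> G n \<Longrightarrow> f (x + y) = f x + f y" "f (sc c x) = sc c (f x)"
  using assms unfolding graded_map_def by blast+

lemma graded_map_zero: "graded_map k f \<Longrightarrow> f 0 = 0"
  using graded_mapD(3)[OF _ G_zero, of k f 0] by simp

lemma graded_map_id: "graded_map 0 (\<lambda>x. x)"
  by (simp add: graded_map_def)

lemma multilin_pair:
  assumes M: "M \<in> multilin sc G" and y: "y \<in> H"
  shows "x \<in> G n \<Longrightarrow> x' \<in> G n \<Longrightarrow> M [x + x', y] = M [x, y] + M [x', y]"
    "x \<in> G n \<Longrightarrow> M [sc c x, y] = c * M [x, y]"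
    "x \<in> G n \<Longrightarrow> x' \<in> G n \<Longrightarrow> M [y, x + x'] = M [y, x] + M [y, x']"
    "x \<in> G n \<Longrightarrow> M [y, sc c x] = c * M [y, x]"
    "M [0, y] = 0" "M [y, 0] = 0"
  using multilinD[OF M, of "[]" "[y]" x n] multilinD[OF M, of "[y]" "[]" x n] y
    multilinD(2)[OF M, of "[]" "[y]" 0 _ 0, OF _ _ G_zero] multilinD(2)[OF M, of "[y]" "[]" 0 _ 0, OF _ _ G_zero]
  by simp_all

text \<open>A coefficient depending on degrees may be computed from any degrees of the letters: if they
  differ from the chosen ones, a letter is zero and so is the value of the form.\<close>

lemma pair_value:
  assumes M: "M \<in> multilin sc G" and f: "graded_map i f" "graded_map j g" and x: "x \<in> G p" "y \<in> G q"
  shows "s (dg x) (dg y) * M [f x, g y] = s p q * M [f x, g y]"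
    "s (dg x) (dg y) * M [g y, f x] = s p q * M [g y, f x]"
proof -
  have "f x \<in> H" "g y \<in> H" using graded_mapD(1)[OF f(1) x(1)] graded_mapD(1)[OF f(2) x(2)] G_homs by auto
  then have "M [f x, g y] = 0 \<and> M [g y, f x] = 0" if "x = 0 \<or> y = 0"
    using that graded_map_zero[OF f(1)] graded_map_zero[OF f(2)] multilin_pair(5,6)[OF M] by auto
  then show "s (dg x) (dg y) * M [f x, g y] = s p q * M [f x, g y]"
    "s (dg x) (dg y) * M [g y, f x] = s p q * M [g y, f x]"
    using deg_eq[OF x(1)] deg_eq[OF x(2)] by (cases "x = 0 \<or> y = 0"; simp)+
qed

lemma pair_value_id:
  assumes "M \<in> multilin sc G" "x \<in> G p" "y \<in> G q"
  shows "s (dg x) (dg y) * M [x, y] = s p q * M [x, y]" "s (dg x) (dg y) * M [y, x] = s p q * M [y, x]"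
  by (rule pair_value[OF assms(1) graded_map_id graded_map_id assms(2,3)])+

lemma two_form:
  assumes "\<And>m n x x' y. x \<in> G m \<Longrightarrow> x' \<in> G m \<Longrightarrow> y \<in> G n \<Longrightarrow> B (x + x') y = B x y + B x' y"
    and "\<And>m n x y c. x \<in> G m \<Longrightarrow> y \<in> G n \<Longrightarrow> B (sc c x) y = c * B x y"
    and "\<And>m n x x' y. x \<in> G m \<Longrightarrow> x' \<in> G m \<Longrightarrow> y \<in> G n \<Longrightarrow> B y (x + x') = B y x + B y x'"
    and "\<And>m n x y c. x \<in> G m \<Longrightarrow> y \<in> G n \<Longrightarrow> B y (sc c x) = c * B y x"
  shows "two B \<in> multilin sc G"
proof (rule multilinI)
  fix us vs :: "'a list" and n x y c assume *: "set us \<subseteq> H" "set vs \<subseteq> H" "x \<in> G n"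
  consider z m where "us = []" "vs = [z]" "z \<in> G m" | z m where "us = [z]" "vs = []" "z \<in> G m"
    | "length us + length vs \<noteq> 1"
    using * deg_in by (cases us; cases vs) auto
  note cs = this
  show "two B (us @ (x + y) # vs) = two B (us @ x # vs) + two B (us @ y # vs)" if "y \<in> G n"
    by (rule cs) (use * that in \<open>simp_all add: two_other assms(1,3)\<close>)
  show "two B (us @ sc c x # vs) = c * two B (us @ x # vs)"
    by (rule cs) (use * in \<open>simp_all add: two_other assms(2,4)\<close>)
qed

text \<open>The bilinear forms below are combinations of such twists of a given form, with \<open>s\<close> a Koszul sign or a condition on degrees.\<close>

lemma pair_form:
  assumes M: "M \<in> multilin sc G" and f: "graded_map i f" "graded_map j g"
  shows "two (\<lambda>a b. s (dg a) (dg b) * M [f a, g b]) \<in> multilin sc G"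
    "two (\<lambda>a b. s (dg a) (dg b) * M [g b, f a]) \<in> multilin sc G"
proof -
  note v = pair_value[OF M f, where s = s] and fD = graded_mapD[OF f(1)] and gD = graded_mapD[OF f(2)]
  note hf = G_homs[OF fD(1)] and hg = G_homs[OF gD(1)]
  note lin = multilin_pair(1,3)[OF M hg fD(1) fD(1)] multilin_pair(2,4)[OF M hg fD(1)]
    multilin_pair(1,3)[OF M hf gD(1) gD(1)] multilin_pair(2,4)[OF M hf gD(1)]
  show "two (\<lambda>a b. s (dg a) (dg b) * M [f a, g b]) \<in> multilin sc G"
    by (rule two_form; (subst v(1), (assumption | rule G_add G_scale)+)+)
      (simp_all add: fD(2,3) gD(2,3) lin distrib_left)
  show "two (\<lambda>a b. s (dg a) (dg b) * M [g b, f a]) \<in> multilin sc G"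
    by (rule two_form; (subst v(2), (assumption | rule G_add G_scale)+)+)
      (simp_all add: fD(2,3) gD(2,3) lin distrib_left)
qed

end

lemma homs_shift: "homs (shift m G) = homs G"
  unfolding homs_def shift_def by (auto) (metis add_diff_cancel_right')

text \<open>A positively graded space with an antisymmetric cobracket; the last axiom is
  \<open>\<tau>\<^sub>(\<^sub>1\<^sub>2\<^sub>) \<delta> x = - \<delta> x\<close>, expressed on forms.  The co-Jacobi identity will appear in the form
  \<open>d\<^sub>2\<^sup>2 = 0\<close>.\<close>

locale graded_cobracket =
  fixes G :: "int \<Rightarrow> ('m \<Rightarrow> 'k::field_char_0) set" and \<delta> :: "('m \<Rightarrow> 'k) \<Rightarrow> ('m \<Rightarrow> 'k, 'k) words"
  assumes G_sub: "\<And>n. fsubspace (G n)"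
    and G_disj: "\<And>m n x. x \<in> G m \<Longrightarrow> x \<in> G n \<Longrightarrow> m \<noteq> n \<Longrightarrow> x = 0"
    and G_pos: "\<And>n x. n \<le> 0 \<Longrightarrow> x \<in> G n \<Longrightarrow> x = 0"
    and \<delta>_add: "\<And>n x y. x \<in> G n \<Longrightarrow> y \<in> G n \<Longrightarrow> \<delta> (x + y) = \<delta> x + \<delta> y"
    and \<delta>_scale: "\<And>n x c. x \<in> G n \<Longrightarrow> \<delta> (fscale c x) = fscale c (\<delta> x)"
    and \<delta>_deg: "\<And>n x. x \<in> G n \<Longrightarrow>
      \<delta> x \<in> fspan {ev (multilin fscale G) [a, b] | a b p q. a \<in> G p \<and> b \<in> G q \<and> p + q = n}"
    and \<delta>_anti: "\<And>n x M. x \<in> G n \<Longrightarrow> M \<in> multilin fscale G \<Longrightarrow>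
      \<delta> x (two (\<lambda>a b. ksign (deg G a * deg G b) * M [b, a])) = - \<delta> x M"
begin

sublocale Ten: graded_space fscale G
  using G_sub G_disj vector_space_fscale by unfold_locales

sublocale graded_space fscale "shift (- 1) G"
  using G_sub G_disj vector_space_fscale by unfold_locales (auto simp: shift_def)

abbreviation evT where "evT w \<equiv> ev (multilin fscale G) w"
abbreviation TS where
  "TS n \<equiv> fspan {ev (multilin fscale G) [a, b] | a b p q. a \<in> G p \<and> b \<in> G q \<and> p + q = n}"
abbreviation cprod (infixl "\<cdot>" 70) where "F \<cdot> K \<equiv> conc \<Phi> F K"

lemma H_eq: "homs (shift (- 1) G) = homs G"
  by (rule homs_shift)

lemma in_shift: "x \<in> shift (- 1) G n \<longleftrightarrow> x \<in> G (n + 1)"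
  by (simp add: shift_def)

lemma in_shift': "x \<in> G n \<longleftrightarrow> x \<in> shift (- 1) G (n - 1)"
  by (simp add: shift_def)

lemma H_G: "x \<in> G n \<Longrightarrow> x \<in> homs (shift (- 1) G)"
  unfolding H_eq by (rule Ten.G_homs)

lemma TS_mem:
  assumes "t \<in> TS n" "lin_on (TS n) f" "fsubspace W"
    "\<And>a b p q. a \<in> G p \<Longrightarrow> b \<in> G q \<Longrightarrow> p + q = n \<Longrightarrow> f (evT [a, b]) \<in> W"
  shows "f t \<in> W"
  by (rule fspan_mem[OF assms(1-3)]) (use assms(4) in blast)

lemma TS_eq:
  assumes "t \<in> TS n" "lin_on (TS n) f" "lin_on (TS n) g"
    "\<And>a b p q. a \<in> G p \<Longrightarrow> b \<in> G q \<Longrightarrow> p + q = n \<Longrightarrow> f (evT [a, b]) = g (evT [a, b])"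
  shows "f t = g t"
  by (rule fspan_eq[OF assms(1-3)]) (use assms(4) in blast)

lemma TS_S: "t \<in> TS n \<Longrightarrow> t \<in> Ten.T.S"
  by (rule TS_mem[OF _ lin_on_ops(4) fs.subspace_span])
    (use Ten.G_homs in \<open>auto intro!: Ten.T.e_in_S\<close>)

lemma TS_local:
  assumes "t \<in> TS n" "M \<in> multilin fscale G" "N \<in> multilin fscale G"
    and "\<And>a b p q. a \<in> G p \<Longrightarrow> b \<in> G q \<Longrightarrow> M [a, b] = N [a, b]"
  shows "t M = t N"
  using assms(1)
proof (induction rule: fspan_induct)
  case (base b)
  then show ?case using assms(2-) by (auto simp: ev_def)
qed (simp_all add: pointwise)

abbreviation flip where "flip M \<equiv> two (\<lambda>a b. ksign (deg G a * deg G b) * M [b, a])"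

lemma flip_form: "M \<in> multilin fscale G \<Longrightarrow> flip M \<in> multilin fscale G"
  by (rule Ten.pair_form(2)[OF _ Ten.graded_map_id Ten.graded_map_id, where s = "\<lambda>p q. ksign (p * q)"])

lemma sym_multilin_G: "M \<in> \<Phi> \<Longrightarrow> M \<in> multilin fscale G"
  using sym_multilin[of M] multilinD[of M] Ten.multilinI[of M]
  by (metis (no_types, lifting) H_eq in_shift')

section \<open>The quadratic part of the differential\<close>

text \<open>Desuspends both factors of a tensor and multiplies them; the sign comes from moving
  \<open>s\<^sup>-\<^sup>1\<close> past the first factor.  The quadratic part of the differential is \<open>- \<mu> \<delta> / 2\<close>.\<close>

definition mu :: "('m \<Rightarrow> 'k, 'k) words \<Rightarrow> ('m \<Rightarrow> 'k, 'k) words"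
  where "mu = lift \<Phi> (two (\<lambda>x y. fscale (ksign (deg G x)) (e [x] \<cdot> e [y])))"

lemma lin_on_mu: "lin_on T mu"
  unfolding mu_def by (rule lin_on_lift)

lemma mu_add: "mu (s + t) = mu s + mu t"
  and mu_scale: "mu (fscale c t) = fscale c (mu t)"
  and mu_diff: "mu (s - t) = mu s - mu t" and mu_zero [simp]: "mu 0 = 0"
  by (simp_all add: mu_def lift_add lift_fscale lift_diff)

lemma cobar_d2_mu: "cobar_d2 G \<delta> x = fscale (- (1 / 2)) (mu (\<delta> x))"
  unfolding cobar_d2_def mu_def cobar_forms_def ..

lemma mu_form: "M \<in> \<Phi> \<Longrightarrow> two (\<lambda>x y. ksign (deg G x) * M [x, y]) \<in> multilin fscale G"
  by (rule Ten.pair_form(1)[OF sym_multilin_G Ten.graded_map_id Ten.graded_map_id, where s = "\<lambda>p q. ksign p"])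

lemma mu_apply:
  assumes "t \<in> TS n" "M \<in> \<Phi>"
  shows "mu t M = t (two (\<lambda>x y. ksign (deg G x) * M [x, y]))"
proof -
  have "t (\<lambda>w. two (\<lambda>x y. fscale (ksign (deg G x)) (e [x] \<cdot> e [y])) w M) =
      t (two (\<lambda>x y. ksign (deg G x) * M [x, y]))"
  proof (rule Ten.T.S_local[OF TS_S[OF assms(1)] mu_form[OF assms(2)]])
    fix w assume w: "set w \<subseteq> homs G"
    show "two (\<lambda>x y. fscale (ksign (deg G x)) (e [x] \<cdot> e [y])) w M = two (\<lambda>x y. ksign (deg G x) * M [x, y]) w"
    proof (cases "length w = 2")
      case True
      then obtain x y where "w = [x, y]"
        by (cases w; cases "tl w") auto
      then show ?thesis using w H_eq assms(2) conc_ev[of "[x]" "[y]"]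
        by (simp add: fscale_apply e_apply)
    qed (simp add: two_other pointwise)
  qed
  then show ?thesis using assms(2) by (simp add: mu_def lift_def)
qed

lemma mu_ev:
  assumes "a \<in> G p" "b \<in> G q"
  shows "mu (evT [a, b]) = fscale (ksign p) (e [a, b])"
proof
  fix M
  have t: "evT [a, b] \<in> TS (p + q)" by (rule fs.span_base) (use assms in blast)
  show "mu (evT [a, b]) M = fscale (ksign p) (e [a, b]) M"
  proof (cases "M \<in> \<Phi>")
    case True
    have "ksign (deg G a) * M [a, b] = ksign p * M [a, b]"
      by (rule Ten.pair_value_id(1)[OF sym_multilin_G[OF True] assms, where s = "\<lambda>p q. ksign p"])
    then show ?thesis
      using mu_apply[OF t True] mu_form[OF True] True by (simp add: Ten.T.e_apply e_apply fscale_apply)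
  qed (simp add: mu_def lift_def fscale_apply ev_def)
qed

lemma e_pair_SL:
  assumes "a \<in> G p" "b \<in> G q"
  shows "e [a, b] \<in> SL (p + q - 2) 2"
proof -
  have "e [a] \<cdot> e [b] \<in> SL ((p - 1) + (q - 1)) (1 + 1)"
    using assms by (intro SL_conc e_single_SL) (simp_all add: in_shift'[symmetric])
  moreover have "e [a] \<cdot> e [b] = e [a, b]"
    using H_G[OF assms(1)] H_G[OF assms(2)] by (simp add: conc_ev)
  ultimately show ?thesis by (simp add: algebra_simps numeral_2_eq_2)
qed

lemma mu_SL: "t \<in> TS n \<Longrightarrow> mu t \<in> SL (n - 2) 2"
  by (rule TS_mem[OF _ lin_on_mu fs.subspace_span])
    (use mu_ev e_pair_SL in \<open>auto intro: fs.span_scale\<close>)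

text \<open>Desuspension exchanges symmetric and antisymmetric tensors, so on antisymmetric tensors nothing is
  lost by passing to the symmetric algebra.  Concretely, the symmetrisation \<open>N\<close> of a form
  \<open>M\<close> with respect to the shifted degrees is a symmetric form, and \<open>\<mu> t\<close> takes the value \<open>2 t M\<close>
  at \<open>N\<close>.\<close>

lemma mu_inj:
  assumes t: "t \<in> TS n" and anti: "\<And>M. M \<in> multilin fscale G \<Longrightarrow> t (flip M) = - t M"
    and "mu t = 0"
  shows "t = 0"
proof
  fix M
  show "t M = 0 M"
  proof (cases "M \<in> multilin fscale G")
    case False
    then show ?thesis using Ten.T.S_off[OF TS_S[OF t]] by (simp add: pointwise)
  next
    case True
    \<comment> \<open>Both orders of the two factors are combined so that \<open>N\<close> is symmetric for the degrees lowered by \<open>1\<close>.\<close>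
    define N where "N = (\<lambda>w. two (\<lambda>a b. ksign (deg G a) * M [a, b]) w +
        (- 1) * two (\<lambda>a b. ksign (deg G a) * ksign (deg G a * deg G b) * M [b, a]) w)"
    have N_eq: "N [a, b] = ksign p * (M [a, b] - ksign (p * q) * M [b, a])" if "a \<in> G p" "b \<in> G q" for a b p q
    proof -
      have "N [a, b] = ksign (deg G a) * M [a, b] - ksign (deg G a) * ksign (deg G a * deg G b) * M [b, a]"
        by (simp add: N_def)
      also have "\<dots> = ksign p * M [a, b] - ksign p * ksign (p * q) * M [b, a]"
        unfolding Ten.pair_value_id(1)[OF True that, where s = "\<lambda>p q. ksign p"]
          Ten.pair_value_id(2)[OF True that, where s = "\<lambda>p q. ksign p * ksign (p * q)"] ..
      finally show ?thesis by (simp add: algebra_simps)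
    qed
    have N_lin: "N \<in> multilin fscale G"
      unfolding N_def
      using Ten.pair_form[OF True Ten.graded_map_id Ten.graded_map_id, where s = "\<lambda>p q. ksign p"]
        Ten.pair_form[OF True Ten.graded_map_id Ten.graded_map_id, where s = "\<lambda>p q. ksign p * ksign (p * q)"]
      by (intro Ten.multilin_add Ten.multilin_scale)
    have "N \<in> \<Phi>"
    proof (rule symI)
      show "N \<in> multilin fscale (shift (- 1) G)"
        using Ten.multilinD[OF N_lin] by (intro multilinI) (auto simp: H_eq in_shift)
      fix us vs m n x y
      assume "x \<in> shift (- 1) G m" "y \<in> shift (- 1) G n"
      then have xy: "x \<in> G (m + 1)" "y \<in> G (n + 1)" by (simp_all add: in_shift)
      show "N (us @ x # y # vs) = ksign (m * n) * N (us @ y # x # vs)"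
      proof (cases "us = [] \<and> vs = []")
        case True
        have "ksign (m * n) * (ksign (n + 1) * (M [y, x] - ksign ((n + 1) * (m + 1)) * M [x, y])) =
            ksign (m + 1) * (M [x, y] - ksign ((m + 1) * (n + 1)) * M [y, x])"
          by (auto simp: ksign_def)
        then show ?thesis
          using True N_eq[OF xy] N_eq[OF xy(2,1)] by (simp only: append_Nil)
      next
        case False
        then have l: "length (us @ x # y # vs) \<noteq> 2" "length (us @ y # x # vs) \<noteq> 2" by auto
        show ?thesis unfolding N_def two_other[OF l(1)] two_other[OF l(2)] by simp
      qed
    qed
    from mu_apply[OF t this] assms(3) have 0: "t (two (\<lambda>x y. ksign (deg G x) * N [x, y])) = 0"
      by (simp add: pointwise)
    note fl = flip_form[OF True]
    have B: "(\<lambda>w. M w + (- 1) * flip M w) \<in> multilin fscale G"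
      by (intro Ten.multilin_add Ten.multilin_scale True fl)
    have "t (two (\<lambda>x y. ksign (deg G x) * N [x, y])) = t (\<lambda>w. M w + (- 1) * flip M w)"
      by (rule TS_local[OF t mu_form[OF \<open>N \<in> \<Phi>\<close>] B]) (simp add: N_def algebra_simps)
    also have "\<dots> = t M + (- 1) * t (flip M)"
      unfolding Ten.T.S_plus[OF TS_S[OF t] True Ten.multilin_scale[OF fl]] Ten.T.S_times[OF TS_S[OF t] fl] ..
    also have "\<dots> = 2 * t M" using anti[OF True] by simp
    finally show ?thesis using 0 by (simp add: pointwise)
  qed
qed

lemma d2_in_SL: "x \<in> G n \<Longrightarrow> cobar_d2 G \<delta> x \<in> SL (n - 2) 2"
  unfolding cobar_d2_mu by (intro fs.span_scale mu_SL \<delta>_deg)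

lemma odd_gen_d2: "odd_gen (cobar_d2 G \<delta>)"
  unfolding odd_gen_def
proof (intro allI ballI conjI)
  fix n x assume x: "x \<in> shift (- 1) G n"
  then have x': "x \<in> G (n + 1)" by (simp add: in_shift)
  show "cobar_d2 G \<delta> x \<in> Sn (n - 1)"
    using SL_Sn[OF d2_in_SL[OF x']] by simp
  show "cobar_d2 G \<delta> (x + y) = cobar_d2 G \<delta> x + cobar_d2 G \<delta> y" if "y \<in> shift (- 1) G n" for y
    using that x' by (simp add: cobar_d2_mu in_shift \<delta>_add mu_add fs.scale_right_distrib)
  show "cobar_d2 G \<delta> (fscale c x) = fscale c (cobar_d2 G \<delta> x)" for c
    using x' by (simp add: cobar_d2_mu \<delta>_scale mu_scale mult.commute)
qed

end

section \<open>The curved differential\<close>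

context graded_space
begin

lemma weight_proj_der:
  assumes f: "odd_gen f" and l: "\<And>x n. x \<in> G n \<Longrightarrow> f x \<in> SL (n - 1) l" and F: "F \<in> Sn n"
  shows "weight_proj \<Phi> (k + l) (der f F) = der f (weight_proj \<Phi> (Suc k) F)"
    and "j < l \<Longrightarrow> weight_proj \<Phi> j (der f F) = 0"
proof -
  have wd: "weight_proj \<Phi> (k + l) (der f (e w)) = der f (weight_proj \<Phi> (Suc k) (e w)) \<and>
    (j < l \<longrightarrow> weight_proj \<Phi> j (der f (e w)) = 0)" if w: "set w \<subseteq> H" for w
  proof (cases "length w")
    case 0
    then show ?thesis using der_Nil[OF f] weight_proj_word[OF w, of "Suc k"] by simp
  next
    case (Suc i)
    have "der f (e w) \<in> SL (wdeg w - 1) (i + l)"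
      using der_word_SL[OF f l w Suc] by (simp add: der_ev[OF f w])
    then show ?thesis
      using Suc by (auto simp: weight_proj_SL weight_proj_word[OF w])
  qed
  show "weight_proj \<Phi> (k + l) (der f F) = der f (weight_proj \<Phi> (Suc k) F)"
    by (rule Sn_eq[OF F lin_on_comp[OF lin_on_weight_proj lin_on_der] lin_on_comp[OF lin_on_der lin_on_weight_proj]])
      (use wd in blast)
  show "weight_proj \<Phi> j (der f F) = 0" if "j < l"
    by (rule Sn_eq[OF F lin_on_comp[OF lin_on_weight_proj lin_on_der] lin_on_ops(5)])
      (use wd that in blast)
qed

lemma weight_proj_ext:
  assumes "F \<in> Sn n" "K \<in> Sn n" "\<And>l. weight_proj \<Phi> l F = weight_proj \<Phi> l K"
  shows "F = K"
proof -
  have FK: "F - K \<in> Sn n" using assms by (intro Sn_intros)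
  obtain N where "F - K = (\<Sum>l<N. weight_proj \<Phi> l (F - K))"
    using length_bounded[OF FK] by blast
  then show ?thesis by (simp add: weight_proj_diff assms(3))
qed

end

context graded_cobracket
begin

abbreviation lin_deg :: "(('m \<Rightarrow> 'k) \<Rightarrow> ('m \<Rightarrow> 'k)) \<Rightarrow> bool"
  where "lin_deg \<equiv> Ten.graded_map 1"

lemmas lin_degD = Ten.graded_mapD[where k = 1]

lemma lin_degI:
  assumes "\<And>n x. x \<in> G n \<Longrightarrow> d x \<in> G (n - 1)" "\<And>n x y. x \<in> G n \<Longrightarrow> y \<in> G n \<Longrightarrow> d (x + y) = d x + d y"
    "\<And>n x c. x \<in> G n \<Longrightarrow> d (fscale c x) = fscale c (d x)"
  shows "lin_deg d"
  unfolding Ten.graded_map_def using assms by blast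

lemmas lin_deg_zero = Ten.graded_map_zero[where k = 1]

lemma d1_in_SL:
  assumes "lin_deg d" "x \<in> shift (- 1) G n"
  shows "cobar_d1 G d x \<in> SL (n - 1) 1"
proof -
  have "d x \<in> shift (- 1) G (n - 1)"
    using lin_degD(1)[OF assms(1), of x "n + 1"] assms(2) by (simp add: in_shift)
  then show ?thesis
    unfolding cobar_d1_def cobar_forms_def by (intro fs.span_neg e_single_SL)
qed

lemma odd_gen_d1:
  assumes d: "lin_deg d"
  shows "odd_gen (cobar_d1 G d)"
  unfolding odd_gen_def
proof (intro allI ballI conjI)
  fix n x assume x: "x \<in> shift (- 1) G n"
  then have x': "x \<in> G (n + 1)" by (simp add: in_shift)
  have dx: "d x \<in> G n" using lin_degD(1)[OF d x'] by simp
  show "cobar_d1 G d x \<in> Sn (n - 1)"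
    using SL_Sn[OF d1_in_SL[OF d x]] .
  show "cobar_d1 G d (x + y) = cobar_d1 G d x + cobar_d1 G d y" if "y \<in> shift (- 1) G n" for y
    using lin_degD(1,2)[OF d x'] lin_degD(1)[OF d, of y "n + 1"] that e_single_linear(1)[of "d x" "n - 1" "d y"]
    by (simp add: cobar_d1_def cobar_forms_def in_shift)
  show "cobar_d1 G d (fscale c x) = fscale c (cobar_d1 G d x)" for c
    using lin_degD(1,3)[OF d x'] e_single_linear(2)[of "d x" "n - 1"]
    by (simp add: cobar_d1_def cobar_forms_def in_shift)
qed

end

text \<open>The cobar differential without its linear part.  The last two axioms are what Koszulness
  provides.  The linear part \<open>d\<close> stays a parameter of \<open>D\<close>, since it is constructed from these data.\<close>

locale curved_cobar = graded_cobracket G \<delta>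
  for G :: "int \<Rightarrow> ('m \<Rightarrow> 'k::field_char_0) set" and \<delta> +
  fixes h :: "('m \<Rightarrow> 'k) \<Rightarrow> 'k"
  assumes h_add: "\<And>n x y. x \<in> G n \<Longrightarrow> y \<in> G n \<Longrightarrow> h (x + y) = h x + h y"
    and h_scale: "\<And>n x c. x \<in> G n \<Longrightarrow> h (fscale c x) = c * h x"
    and h_deg: "\<And>n x. x \<in> G n \<Longrightarrow> n \<noteq> 2 \<Longrightarrow> h x = 0"
    and d2_square: "\<And>n F. F \<in> Sn n \<Longrightarrow> der (cobar_d2 G \<delta>) (der (cobar_d2 G \<delta>) F) = 0"
    and d2_exact: "\<And>n F. n \<noteq> 0 \<Longrightarrow> F \<in> Sn n \<Longrightarrow> der (cobar_d2 G \<delta>) F = 0 \<Longrightarrow>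
      \<exists>K\<in>Sn (n + 1). F = der (cobar_d2 G \<delta>) K"
begin

abbreviation D0 where "D0 \<equiv> der (cobar_d0 G h)"
abbreviation D1 where "D1 d \<equiv> der (cobar_d1 G d)"
abbreviation D2 where "D2 \<equiv> der (cobar_d2 G \<delta>)"
abbreviation D where "D d \<equiv> cobar_diff G \<delta> d h"
abbreviation P where "P l F \<equiv> weight_proj \<Phi> l F"

lemma d0_in_SL:
  assumes "x \<in> shift (- 1) G n"
  shows "cobar_d0 G h x \<in> SL (n - 1) 0"
proof (cases "n = 1")
  case True
  have "e [] \<in> SL 0 0" by (rule e_in_SL) auto
  then show ?thesis
    unfolding cobar_d0_def cobar_forms_def True by (intro fs.span_scale) simp
next
  case False
  then have "h x = 0" using assms h_deg by (auto simp: in_shift)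
  then show ?thesis
    unfolding cobar_d0_def by (simp add: fs.span_zero)
qed

lemma odd_gen_d0: "odd_gen (cobar_d0 G h)"
  unfolding odd_gen_def
proof (intro allI ballI conjI)
  fix n x assume x: "x \<in> shift (- 1) G n"
  then have x': "x \<in> G (n + 1)" by (simp add: in_shift)
  show "cobar_d0 G h x \<in> Sn (n - 1)"
    by (rule SL_Sn[OF d0_in_SL[OF x]])
  show "cobar_d0 G h (x + y) = cobar_d0 G h x + cobar_d0 G h y" if "y \<in> shift (- 1) G n" for y
    using that x' by (simp add: cobar_d0_def h_add in_shift fs.scale_left_distrib)
  show "cobar_d0 G h (fscale c x) = fscale c (cobar_d0 G h x)" for c
    using x' by (simp add: cobar_d0_def h_scale)
qed

lemma d2_in_SL': "x \<in> shift (- 1) G n \<Longrightarrow> cobar_d2 G \<delta> x \<in> SL (n - 1) 2"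
  using d2_in_SL[of x "n + 1"] by (simp add: in_shift)

lemma D_eq: "D d F = D0 F + D1 d F + D2 F"
  unfolding cobar_diff_def cobar_forms_def ..

lemma D_odd:
  assumes "lin_deg d"
  shows "odd_derivation (D d)"
proof -
  have "odd_derivation (\<lambda>F. (D0 F + D1 d F) + D2 F)"
    by (intro odd_derivation_sum der_odd_derivation odd_gen_d0 odd_gen_d1 odd_gen_d2 assms)
  then show ?thesis using D_eq[of d] by presburger
qed

lemma D_single:
  assumes "lin_deg d" "x \<in> G n"
  shows "D d (e [x]) = fscale (h x) (e []) - e [d x] + cobar_d2 G \<delta> x"
  unfolding D_eq
    der_single[OF odd_gen_d0 H_G[OF assms(2)]] der_single[OF odd_gen_d1[OF assms(1)] H_G[OF assms(2)]]
    der_single[OF odd_gen_d2 H_G[OF assms(2)]] cobar_d0_def cobar_d1_def cobar_forms_def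
  by simp

lemma P_D0: "F \<in> Sn n \<Longrightarrow> P k (D0 F) = D0 (P (Suc k) F)"
  using weight_proj_der(1)[OF odd_gen_d0 d0_in_SL, of F n k] by simp

lemma P_D1:
  assumes d: "lin_deg d" and F: "F \<in> Sn n"
  shows "P k (D1 d F) = D1 d (P k F)"
proof (cases k)
  case 0
  then show ?thesis
    using weight_proj_der(2)[OF odd_gen_d1[OF d] d1_in_SL[OF d] F, of 0]
      der_SL_0[OF odd_gen_d1[OF d] weight_proj_in_SL[OF F]] by simp
next
  case (Suc i)
  then show ?thesis
    using weight_proj_der(1)[OF odd_gen_d1[OF d] d1_in_SL[OF d] F, of i] by simp
qed

lemma P_D2_Suc:
  assumes F: "F \<in> Sn n"
  shows "P (Suc k) (D2 F) = D2 (P k F)"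
proof (cases k)
  case 0
  then show ?thesis
    using weight_proj_der(2)[OF odd_gen_d2 d2_in_SL' F, of 1]
      der_SL_0[OF odd_gen_d2 weight_proj_in_SL[OF F]] by simp
next
  case (Suc i)
  then show ?thesis
    using weight_proj_der(1)[OF odd_gen_d2 d2_in_SL' F, of i] by simp
qed

lemma P_D2_0: "F \<in> Sn n \<Longrightarrow> P 0 (D2 F) = 0"
  using weight_proj_der(2)[OF odd_gen_d2 d2_in_SL', of F n 0] by simp

text \<open>The terms come from words that are longer by one letter, of the same length, and shorter by one letter.\<close>

lemma P_D_Suc:
  assumes "lin_deg d" "F \<in> Sn n"
  shows "P (Suc k) (D d F) = D0 (P (Suc (Suc k)) F) + D1 d (P (Suc k) F) + D2 (P k F)"
  unfolding D_eq weight_proj_add P_D0[OF assms(2)] P_D1[OF assms] P_D2_Suc[OF assms(2)] ..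

text \<open>As \<open>D2\<close> raises the length by exactly one, a primitive can be cut down to a single length.\<close>

lemma D2_exact_length:
  assumes n: "n \<noteq> 0" and F: "F \<in> SL n l" and "D2 F = 0"
  shows "l = 0 \<Longrightarrow> F = 0" and "l = Suc k \<Longrightarrow> \<exists>K\<in>SL (n + 1) k. F = D2 K"
proof -
  obtain K where K: "K \<in> Sn (n + 1)" "F = D2 K"
    using d2_exact[OF n SL_Sn[OF F] assms(3)] by blast
  have F': "F = P l (D2 K)" using K weight_proj_SL[OF F, of l] by simp
  show "l = 0 \<Longrightarrow> F = 0" using F' P_D2_0[OF K(1)] by simp
  show "\<exists>K\<in>SL (n + 1) k. F = D2 K" if "l = Suc k"
    using F' P_D2_Suc[OF K(1)] weight_proj_in_SL[OF K(1)] that by auto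
qed

text \<open>A \<open>d\<^sub>2\<close>-cycle of length \<open>1\<close> is the boundary of an element of length \<open>0\<close>, that is of a
  scalar, and derivations kill scalars.\<close>

lemma d2_inj:
  assumes x: "x \<in> G n" and "n \<ge> 2" and "cobar_d2 G \<delta> x = 0"
  shows "x = 0"
proof -
  have x': "x \<in> shift (- 1) G (n - 1)" using x by (simp add: in_shift)
  have "D2 (e [x]) = 0" using der_single[OF odd_gen_d2 H_G[OF x]] assms by simp
  moreover have "n - 1 \<noteq> 0" using assms(2) by simp
  ultimately have "\<exists>K\<in>SL (n - 1 + 1) 0. e [x] = D2 K"
    by (intro D2_exact_length(2)[OF _ e_single_SL[OF x']]) simp_all
  then obtain K where K: "K \<in> SL (n - 1 + 1) 0" "e [x] = D2 K" by blast
  have "e [x] = 0" using der_SL_0[OF odd_gen_d2 K(1)] K(2) by simp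
  then show ?thesis by (rule e_single_inj[OF x'])
qed

section \<open>Acyclicity in nonzero degrees\<close>

text \<open>Induction on a bound for the length of the words in the cycle: its part of maximal length is a
  \<open>d\<^sub>2\<close>-cycle, and a primitive \<open>K\<close> of it for \<open>d\<^sub>2\<close> lowers the bound when \<open>D K\<close> is subtracted.\<close>

lemma D_acyclic:
  assumes d: "lin_deg d" and sq: "\<And>n F. F \<in> Sn n \<Longrightarrow> D d (D d F) = 0"
    and n: "n \<noteq> 0" and F: "F \<in> Sn n" and "D d F = 0"
  shows "\<exists>K\<in>Sn (n + 1). F = D d K"
proof -
  note lin = odd_derivationD[OF D_odd[OF d]] odd_derivation_diff[OF D_odd[OF d]]
  have "\<exists>K\<in>Sn (n + 1). F = D d K" if "\<And>l. l \<ge> N \<Longrightarrow> P l F = 0" "F \<in> Sn n" "D d F = 0" for N F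
    using that
  proof (induction N arbitrary: F)
    case 0
    then have "F = 0" by (intro weight_proj_ext[OF _ Sn_intros(3)]) auto
    then show ?case using odd_derivation_zero[OF D_odd[OF d]] Sn_intros(3) by metis
  next
    case (Suc N)
    have "P (Suc N) (D d F) = 0" using Suc.prems by simp
    then have "D2 (P N F) = 0"
      using Suc.prems(1) by (simp add: P_D_Suc[OF d Suc.prems(2)])
    then have ex: "\<exists>K\<in>Sn (n + 1). P N F = P N (D d K) \<and> (\<forall>l>N. P l (D d K) = 0)"
    proof (cases N)
      case 0
      then have "P N F = 0"
        using D2_exact_length(1)[OF n weight_proj_in_SL[OF Suc.prems(2)], of 0] \<open>D2 (P N F) = 0\<close> by simp
      then show ?thesis
        by (intro bexI[of _ 0]) (simp_all add: odd_derivation_zero[OF D_odd[OF d]] Sn_intros(3))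
    next
      case (Suc k)
      then obtain K where K: "K \<in> SL (n + 1) k" "P N F = D2 K"
        using D2_exact_length(2)[OF n weight_proj_in_SL[OF Suc.prems(2)], of N] \<open>D2 (P N F) = 0\<close> by blast
      have KS: "K \<in> Sn (n + 1)" using SL_Sn[OF K(1)] .
      have PK: "P l K = (if l = k then K else 0)" for l by (rule weight_proj_SL[OF K(1)])
      have "P l (D d K) = 0" if "l > N" for l
        using that Suc by (cases l) (auto simp: P_D_Suc[OF d KS] PK)
      moreover have "P N (D d K) = D2 K"
        using Suc by (simp add: P_D_Suc[OF d KS] PK)
      ultimately show ?thesis using KS K(2) by (intro bexI[of _ K]) auto
    qed
    then obtain K where K: "K \<in> Sn (n + 1)" "P N F = P N (D d K)" "\<forall>l>N. P l (D d K) = 0" by blast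
    have DK: "D d K \<in> Sn n" using lin(3)[OF K(1)] by simp
    have "\<exists>K'\<in>Sn (n + 1). F - D d K = D d K'"
    proof (rule Suc.IH)
      show "F - D d K \<in> Sn n" by (rule Sn_intros(5)[OF Suc.prems(2) DK])
      show "D d (F - D d K) = 0" using Suc.prems(3) sq[OF K(1)] by (simp add: lin(4))
      show "P l (F - D d K) = 0" if "l \<ge> N" for l
        using that K(2,3) Suc.prems(1)[of l] by (cases "l = N") (simp_all add: weight_proj_diff)
    qed
    then obtain K' where "K' \<in> Sn (n + 1)" "F = D d (K' + K)"
      by (auto simp: lin(1) algebra_simps)
    then show ?case using Sn_intros(1)[OF _ K(1)] by blast
  qed
  moreover obtain N where "\<And>l. l \<ge> N \<Longrightarrow> P l F = 0" using length_bounded[OF F] by blast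
  ultimately show ?thesis using F assms(5) by blast
qed

section \<open>Corestriction of the coderivation\<close>

text \<open>The subalgebra generated by the letters of degree at most \<open>N\<close>.\<close>

abbreviation SB where "SB N \<equiv> fspan {e w | w. set w \<subseteq> (\<Union>n\<in>{..N}. G n)}"

lemma SB_H: "set w \<subseteq> (\<Union>n\<in>{..N}. G n) \<Longrightarrow> set w \<subseteq> homs (shift (- 1) G)"
  using H_G by blast

lemma SB_mono: "N \<le> N' \<Longrightarrow> F \<in> SB N \<Longrightarrow> F \<in> SB N'"
  by (erule set_mp[OF fs.span_mono, rotated]) force

lemma e_in_SB: "set w \<subseteq> (\<Union>n\<in>{..N}. G n) \<Longrightarrow> e w \<in> SB N"
  by (rule fs.span_base) blast

lemma SB_single: "x \<in> G n \<Longrightarrow> n \<le> N \<Longrightarrow> e [x] \<in> SB N"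
  by (rule e_in_SB) auto

text \<open>In \<open>\<delta> x\<close> both tensor factors have positive degree, hence degree at most \<open>n - 1\<close>.\<close>

lemma d2_SB:
  assumes "x \<in> G n"
  shows "cobar_d2 G \<delta> x \<in> SB (n - 1)"
proof -
  have "e [a, b] \<in> SB (n - 1)" if ab: "a \<in> G p" "b \<in> G q" "p + q = n" for a b p q
  proof (cases "p \<ge> 1 \<and> q \<ge> 1")
    case True
    then have "p \<le> n - 1" "q \<le> n - 1" using ab by auto
    then show ?thesis by (intro e_in_SB) (use ab in auto)
  next
    case False
    then have "a = 0 \<or> b = 0" using G_pos[OF _ ab(1)] G_pos[OF _ ab(2)] by force
    then have "e [a, b] = 0" using H_G[OF ab(1)] H_G[OF ab(2)] by (intro e_null) auto
    then show ?thesis by (simp add: fs.span_zero)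
  qed
  then have "mu (\<delta> x) \<in> SB (n - 1)"
    by (intro TS_mem[OF \<delta>_deg[OF assms] lin_on_mu fs.subspace_span])
      (simp add: mu_ev fs.span_scale)
  then show ?thesis unfolding cobar_d2_mu by (rule fs.span_scale)
qed

lemma D_cong_SB:
  assumes d: "lin_deg d" "lin_deg d'" and agree: "\<And>n x. n \<le> N \<Longrightarrow> x \<in> G n \<Longrightarrow> d x = d' x"
    and F: "F \<in> SB N"
  shows "D d F = D d' F"
proof (rule fspan_eq[OF F lin_on_odd[OF D_odd[OF d(1)]] lin_on_odd[OF D_odd[OF d(2)]]])
  fix b assume "b \<in> {e w | w. set w \<subseteq> (\<Union>n\<in>{..N}. G n)}"
  then obtain w where w: "b = e w" "set w \<subseteq> (\<Union>n\<in>{..N}. G n)" by blast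
  have "D d (e [x]) = D d' (e [x])" if x: "x \<in> set w" for x
  proof -
    obtain n where n: "n \<le> N" "x \<in> G n" using w(2) x by blast
    show ?thesis unfolding D_single[OF d(1) n(2)] D_single[OF d(2) n(2)] agree[OF n] ..
  qed
  then show "D d b = D d' b" unfolding w(1)
    by (intro derivation_cong_word[OF D_odd[OF d(1)] D_odd[OF d(2)] SB_H[OF w(2)]])
qed

lemma D_square_SB:
  assumes d: "lin_deg d" and sq: "\<And>n x. n \<le> N \<Longrightarrow> x \<in> G n \<Longrightarrow> D d (D d (e [x])) = 0"
    and F: "F \<in> SB N"
  shows "D d (D d F) = 0"
proof (rule fspan_eq[OF F lin_on_comp[OF lin_on_odd lin_on_odd, OF D_odd D_odd, OF d d] lin_on_ops(5)])
  fix b assume "b \<in> {e w | w. set w \<subseteq> (\<Union>n\<in>{..N}. G n)}"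
  then obtain w where w: "b = e w" "set w \<subseteq> (\<Union>n\<in>{..N}. G n)" by blast
  show "D d (D d b) = 0" unfolding w(1)
    by (rule square_zero_word[OF D_odd[OF d] SB_H[OF w(2)]]) (use w(2) sq in blast)
qed

lemma D_single_SB:
  assumes "lin_deg d" "x \<in> G n" "n \<le> N"
  shows "D d (e [x]) \<in> SB N"
proof -
  have "d x \<in> G (n - 1)" using lin_degD(1)[OF assms(1,2)] .
  then have "e [d x] \<in> SB N" using assms by (intro SB_single[of _ "n - 1"]) auto
  moreover have "e [] \<in> SB N" by (rule e_in_SB) simp
  moreover have "cobar_d2 G \<delta> x \<in> SB N" using SB_mono[OF _ d2_SB[OF assms(2)], of N] assms by simp
  ultimately show ?thesis unfolding D_single[OF assms(1,2)]
    by (intro fs.span_add fs.span_diff fs.span_scale)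
qed

text \<open>The part of the differential of a generator in length \<open>2\<close> is \<open>d\<^sub>2\<close>, which is injective.\<close>

lemma corestriction_unique:
  assumes d: "lin_deg d" and x: "x \<in> G n" "y \<in> G n" and "n \<ge> 2" and "D d (e [x]) = D d (e [y])"
  shows "x = y"
proof -
  have xy: "x - y \<in> G n" using G_sub x fs.subspace_diff by blast
  have "e [x - y + y] = e [x - y] + e [y]"
    using xy x by (intro e_single_linear(1)[where n = "n - 1"]) (simp_all add: in_shift)
  then have "D d (e [x - y]) = 0"
    using odd_derivationD(1)[OF D_odd[OF d], of "e [x - y]" "e [y]"] assms(5) by simp
  then have "P 2 (D d (e [x - y])) = 0" by simp
  moreover have "e [x - y] \<in> SL (n - 1) 1" using xy by (intro e_single_SL) (simp add: in_shift)
  ultimately have "D2 (e [x - y]) = 0"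
    using P_D_Suc[OF d SL_Sn, of "e [x - y]" "n - 1" 1 1]
    by (simp add: numeral_2_eq_2 weight_proj_SL)
  then have "cobar_d2 G \<delta> (x - y) = 0" using der_single[OF odd_gen_d2 H_G[OF xy]] by simp
  then show ?thesis using d2_inj[OF xy assms(4)] by simp
qed

text \<open>The element \<open>D (d\<^sub>2 x)\<close> is a cycle because \<open>d\<^sub>2 x\<close> is a combination of words in letters of degree at
  most \<open>N\<close>.  It has no part of length \<open>3\<close> or more, as \<open>d\<^sub>2\<^sup>2 = 0\<close>.  Its part of length \<open>2\<close> is
  therefore a \<open>d\<^sub>2\<close>-cycle, so it equals \<open>d\<^sub>2 y\<close> for a generator \<open>y\<close>.  The difference of \<open>D (d\<^sub>2 x)\<close>
  and the differential of \<open>y\<close> is a cycle with words of length at most \<open>1\<close>, and the same argument in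
  lengths \<open>1\<close> and \<open>0\<close> shows that it is zero.  Exactness in the degree \<open>N - 2\<close> of this cycle requires
  \<open>N \<ge> 3\<close>.\<close>

lemma corestriction_exists:
  assumes d: "lin_deg d" and sq: "\<And>m x. m \<le> N \<Longrightarrow> x \<in> G m \<Longrightarrow> D d (D d (e [x])) = 0"
    and N: "N \<ge> 3" and x: "x \<in> G (N + 1)"
  shows "\<exists>y\<in>G N. D d (cobar_d2 G \<delta> x) = D d (e [y])"
proof -
  note odd = D_odd[OF d]
  let ?n = "N - 2"
  let ?z = "cobar_d2 G \<delta> x"
  let ?c = "D d ?z"
  have z: "?z \<in> SL (N - 1) 2" "?z \<in> SB N" using d2_in_SL[OF x] d2_SB[OF x] by simp_all
  have c: "?c \<in> Sn ?n" using odd_derivationD(3)[OF odd SL_Sn[OF z(1)]] by (simp add: algebra_simps)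
  have Dc: "D d ?c = 0" by (rule D_square_SB[OF d sq z(2)])
  have D2z: "D2 ?z = 0"
    using d2_square[OF e_single[of x N]] x der_single[OF odd_gen_d2 H_G[OF x]] by (simp add: in_shift)
  have Pz: "P l ?z = (if l = 2 then ?z else 0)" for l by (rule weight_proj_SL[OF z(1)])
  have Pc: "P (Suc k) ?c = 0" if "k \<ge> 2" for k
    using that D2z unfolding P_D_Suc[OF d SL_Sn[OF z(1)]] Pz by simp
  have "P 3 (D d ?c) = 0" using Dc by simp
  then have "D2 (P 2 ?c) = 0"
    using P_D_Suc[OF d c, of 2] Pc[of 2] Pc[of 3] by (simp add: eval_nat_numeral)
  moreover have "?n \<noteq> 0" using N by simp
  ultimately have "\<exists>K\<in>SL (?n + 1) 1. P 2 ?c = D2 K"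
    by (intro D2_exact_length(2)[OF _ weight_proj_in_SL[OF c]]) simp_all
  then obtain K where K: "K \<in> SL (?n + 1) 1" "P 2 ?c = D2 K" by blast
  obtain y where y: "y \<in> shift (- 1) G (?n + 1)" "K = e [y]" using SL_1[OF K(1)] .
  then have yG: "y \<in> G N" by (simp add: in_shift)
  have De: "D d (e [y]) \<in> Sn ?n"
    using odd_derivationD(3)[OF odd e_single[OF y(1)]] by simp
  let ?r = "?c - D d (e [y])"
  have r: "?r \<in> Sn ?n" by (rule Sn_intros(5)[OF c De])
  have Dr: "D d ?r = 0"
    using Dc sq[OF _ yG] by (simp add: odd_derivation_diff[OF odd])
  have Pe: "P l (e [y]) = (if l = 1 then e [y] else 0)" for l
    by (rule weight_proj_SL[OF e_single_SL[OF y(1)]])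
  have Pr: "P (Suc (Suc k)) ?r = 0" for k
  proof (cases k)
    case 0
    have "P 2 (D d (e [y])) = D2 (e [y])"
      using P_D_Suc[OF d e_single[OF y(1)], of 1] by (simp add: numeral_2_eq_2 Pe)
    then show ?thesis using K(2) 0 y(2) by (simp add: weight_proj_diff numeral_2_eq_2)
  next
    case (Suc i)
    then show ?thesis using Pc[of "Suc k"] P_D_Suc[OF d e_single[OF y(1)], of "Suc k"]
      by (simp add: weight_proj_diff Pe)
  qed
  have "P 2 (D d ?r) = 0" using Dr by simp
  then have D2r: "D2 (P 1 ?r) = 0"
    using P_D_Suc[OF d r, of 1] Pr[of 0] Pr[of 1] by (simp add: numeral_2_eq_2)
  obtain u where u: "u \<in> shift (- 1) G ?n" "P 1 ?r = e [u]"
    using SL_1[OF weight_proj_in_SL[OF r, of 1]] by blast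
  then have uG: "u \<in> G (N - 1)" by (simp add: in_shift)
  have "cobar_d2 G \<delta> u = 0" using D2r u(2) der_single[OF odd_gen_d2 H_G[OF uG]] by simp
  then have "u = 0" using d2_inj[OF uG] N by simp
  then have P1: "P 1 ?r = 0" using u(2) e_single_zero by simp
  have P0: "P 0 ?r = 0" using SL_0[OF weight_proj_in_SL[OF r, of 0]] \<open>?n \<noteq> 0\<close> by simp
  have "P l ?r = 0" for l
    using P0 P1 Pr[of "l - 2"] by (cases l; cases "l - 1") (auto simp: )
  then have "?r = 0" by (intro weight_proj_ext[OF r Sn_intros(3)]) simp
  then show ?thesis using yG by auto
qed

end

section \<open>Coderivations\<close>

context graded_cobracket
begin

lemma Sn_neg:
  assumes "F \<in> Sn n" "n < 0"
  shows "F = 0"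
proof (rule Sn_eq[OF assms(1) lin_on_ops(4,5)])
  fix w assume w: "set w \<subseteq> homs (shift (- 1) G)" "wdeg w = n"
  have "\<exists>x\<in>set w. deg (shift (- 1) G) x < 0"
  proof (rule ccontr)
    assume "\<not> ?thesis"
    then have "0 \<le> wdeg w" by (intro sum_list_nonneg) (auto simp: not_less)
    then show False using w assms(2) by simp
  qed
  then obtain x where x: "x \<in> set w" "deg (shift (- 1) G) x < 0" by blast
  then have "x \<in> shift (- 1) G (deg (shift (- 1) G) x)" using w(1) by (intro deg_in) blast
  then have "x = 0" using x(2) by (intro G_pos[of "deg (shift (- 1) G) x + 1"]) (simp_all add: in_shift)
  then show "e w = 0" using x(1) w(1) by (intro e_null) simp_all
qed

text \<open>The extension \<open>d \<otimes> 1 + 1 \<otimes> d\<close> of a degree \<open>- 1\<close> map to the tensor square, with the Koszul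
  sign.\<close>

abbreviation Td where
  "Td d \<equiv> lift (multilin fscale G) (\<lambda>w. case w of
          [x, y] \<Rightarrow> ev (multilin fscale G) [d x, y] +
                    fscale (ksign (deg G x)) (ev (multilin fscale G) [x, d y])
        | _ \<Rightarrow> 0)"

lemma Td_form:
  assumes "lin_deg d" and "M \<in> multilin fscale G"
  shows "two (\<lambda>x y. M [d x, y] + ksign (deg G x) * M [x, d y]) \<in> multilin fscale G"
proof -
  have "two (\<lambda>x y. M [d x, y] + ksign (deg G x) * M [x, d y]) =
      (\<lambda>w. two (\<lambda>x y. 1 * M [d x, y]) w + two (\<lambda>x y. ksign (deg G x) * M [x, d y]) w)"
    by (auto split: list.splits)
  then show ?thesis
    using Ten.multilin_add[OF Ten.pair_form(1)[OF assms(2,1) Ten.graded_map_id, where s = "\<lambda>_ _. 1"]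
        Ten.pair_form(1)[OF assms(2) Ten.graded_map_id assms(1), where s = "\<lambda>p _. ksign p"]] by simp
qed

lemma Td_apply:
  assumes "M \<in> multilin fscale G"
  shows "Td d t M = t (two (\<lambda>x y. M [d x, y] + ksign (deg G x) * M [x, d y]))"
proof -
  have "(\<lambda>w. (case w of [x, y] \<Rightarrow> evT [d x, y] + fscale (ksign (deg G x)) (evT [x, d y]) | _ \<Rightarrow> 0) M) =
     two (\<lambda>x y. M [d x, y] + ksign (deg G x) * M [x, d y])"
    using assms by (intro ext) (auto simp: pointwise ev_def split: list.splits)
  then show ?thesis using assms by (simp add: lift_def)
qed

lemma Td_ev:
  assumes "lin_deg d" "a \<in> G p" "b \<in> G q"
  shows "Td d (evT [a, b]) = evT [d a, b] + fscale (ksign p) (evT [a, d b])"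
proof
  fix M
  show "Td d (evT [a, b]) M = (evT [d a, b] + fscale (ksign p) (evT [a, d b])) M"
  proof (cases "M \<in> multilin fscale G")
    case True
    note Ten.pair_value(1)[OF True Ten.graded_map_id assms, where s = "\<lambda>p _. ksign p"]
    then show ?thesis
      using Td_form[OF assms(1) True] True by (simp add: Td_apply ev_def pointwise)
  qed (simp add: lift_def ev_def pointwise)
qed

lemma lin_on_Td: "lin_on T (Td d)"
  by (rule lin_on_lift)

lemma evT_TS: "a \<in> G p \<Longrightarrow> b \<in> G q \<Longrightarrow> p + q = n \<Longrightarrow> evT [a, b] \<in> TS n"
  by (rule fs.span_base) blast

lemma Td_TS:
  assumes d: "lin_deg d" and "t \<in> TS n"
  shows "Td d t \<in> TS (n - 1)"
proof (rule TS_mem[OF assms(2) lin_on_Td fs.subspace_span])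
  fix a b p q assume ab: "a \<in> G p" "b \<in> G q" "p + q = n"
  have "evT [d a, b] \<in> TS (n - 1)" "evT [a, d b] \<in> TS (n - 1)"
    by (rule evT_TS[OF lin_degD(1)[OF d ab(1)] ab(2)] evT_TS[OF ab(1) lin_degD(1)[OF d ab(2)]]; use ab(3) in simp)+
  then show "Td d (evT [a, b]) \<in> TS (n - 1)"
    unfolding Td_ev[OF d ab(1,2)] by (intro fs.span_add fs.span_scale)
qed

lemma Td_anti:
  assumes d: "lin_deg d" and t: "t \<in> TS n"
    and anti: "\<And>M. M \<in> multilin fscale G \<Longrightarrow> t (flip M) = - t M"
    and M: "M \<in> multilin fscale G"
  shows "Td d t (flip M) = - Td d t M"
proof -
  let ?D = "\<lambda>M. two (\<lambda>x y. M [d x, y] + ksign (deg G x) * M [x, d y])"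
  note fM = flip_form[OF M] and DM = Td_form[OF d M]
  have eq: "t (?D (flip M)) = t (flip (?D M))"
  proof (rule TS_local[OF t Td_form[OF d fM] flip_form[OF DM]])
    fix a b p q assume ab: "a \<in> G p" "b \<in> G q"
    note da = lin_degD(1)[OF d ab(1)] and db = lin_degD(1)[OF d ab(2)]
    note id = Ten.graded_map_id
    have "?D (flip M) [a, b] = ksign (deg G (d a) * deg G b) * M [b, d a] +
        ksign (deg G a) * (ksign (deg G a * deg G (d b)) * M [d b, a])" by simp
    also have "\<dots> = ksign ((p - 1) * q) * M [b, d a] + ksign p * (ksign (p * (q - 1)) * M [d b, a])"
      unfolding Ten.pair_value_id(2)[OF M ab(1) db, where s = "\<lambda>i j. ksign (i * j)"]
        Ten.pair_value_id(2)[OF M da ab(2), where s = "\<lambda>i j. ksign (i * j)"]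
      using Ten.pair_value(2)[OF M id d ab, where s = "\<lambda>i _. ksign i * ksign (p * (q - 1))"]
      by (simp add: mult.assoc del: mult_cancel_left mult_cancel_right)
    also have "\<dots> = ksign (p * q) * (M [d b, a] + ksign q * M [b, d a])"
      by (auto simp: ksign_def algebra_simps)
    also have "\<dots> = ksign (p * q) * ?D M [b, a]"
      using Ten.pair_value(2)[OF M d id ab, where s = "\<lambda>_ j. ksign j"]
      by (simp only: list.case)
    also have "\<dots> = flip (?D M) [a, b]"
      using Ten.pair_value_id(2)[OF DM ab, where s = "\<lambda>i j. ksign (i * j)"] by (simp only: list.case)
    finally show "?D (flip M) [a, b] = flip (?D M) [a, b]" .
  qed
  show ?thesis
    unfolding Td_apply[OF fM] Td_apply[OF M] eq by (rule anti[OF DM])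
qed

text \<open>Up to sign \<open>d\<close> on letters is the linear part \<open>d\<^sub>1\<close> of the differential, and \<open>d\<^sub>1\<close> is a derivation.\<close>

lemma mu_Td:
  assumes d: "lin_deg d" and t: "t \<in> TS n"
  shows "mu (Td d t) = der (cobar_d1 G d) (mu t)"
proof (rule TS_eq[OF t lin_on_comp[OF lin_on_mu lin_on_Td] lin_on_comp[OF lin_on_der lin_on_mu]])
  fix a b p q assume word: "a \<in> G p" "b \<in> G q" "p + q = n"
  note odd = odd_gen_d1[OF d]
  note da = lin_degD(1)[OF d word(1)] and db = lin_degD(1)[OF d word(2)]
  note H = H_G[OF word(1)] H_G[OF word(2)] H_G[OF da] H_G[OF db]
  have ea: "a \<in> shift (- 1) G (p - 1)" using word by (simp add: in_shift)
  have "der (cobar_d1 G d) (e [a, b]) = der_word (cobar_d1 G d) [a, b]"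
    using H by (intro der_ev[OF odd]) simp
  also have "\<dots> = cobar_d1 G d a \<cdot> e [b] + fscale (ksign (p - 1)) (e [a] \<cdot> cobar_d1 G d b)"
    using der_word_Cons'[OF odd ea, of "[b]"] H der_word_single[OF odd H(2)] by simp
  also have "cobar_d1 G d a \<cdot> e [b] = - e [d a, b]"
    using H by (simp add: cobar_d1_def cobar_forms_def conc_minus_left conc_ev)
  also have "e [a] \<cdot> cobar_d1 G d b = - e [a, d b]"
    using H by (simp add: cobar_d1_def cobar_forms_def conc_minus_right e_in_S conc_ev)
  finally show "mu (Td d (evT [a, b])) = der (cobar_d1 G d) (mu (evT [a, b]))"
    unfolding Td_ev[OF d word(1,2)] mu_add mu_scale mu_ev[OF da word(2)] mu_ev[OF word(1) db]
      mu_ev[OF word(1,2)] der_extend_scale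
    by (simp add: ksign_minus1 fs.scale_right_distrib fs.scale_right_diff_distrib)
qed

end

context curved_cobar
begin

text \<open>In length \<open>2\<close> the equation \<open>D\<^sup>2 = 0\<close> on a generator reads \<open>d\<^sub>1 d\<^sub>2 + d\<^sub>2 d\<^sub>1 = 0\<close>, which is
  \<open>\<mu>\<close> applied to the coderivation identity.\<close>

lemma coderivation_if_square_zero:
  assumes d: "lin_deg d" and x: "x \<in> G n" and sq: "D d (D d (e [x])) = 0"
  shows "\<delta> (d x) = Td d (\<delta> x)"
proof -
  note dx = lin_degD(1)[OF d x]
  have ex: "e [x] \<in> SL (n - 1) 1" using x by (intro e_single_SL) (simp add: in_shift)
  have dex: "e [d x] \<in> SL (n - 2) 1" using dx by (intro e_single_SL) (simp add: in_shift)
  have F: "D d (e [x]) \<in> Sn (n - 2)"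
    using odd_derivationD(3)[OF D_odd[OF d] SL_Sn[OF ex]] by (simp add: algebra_simps)
  have e0: "e [] \<in> SL 0 0" by (rule e_in_SL) auto
  have P: "P l (D d (e [x])) = (if l = 0 then fscale (h x) (e []) else 0) - (if l = 1 then e [d x] else 0)
      + (if l = 2 then cobar_d2 G \<delta> x else 0)" for l
    unfolding D_single[OF d x] weight_proj_add weight_proj_diff weight_proj_scale
    unfolding weight_proj_SL[OF e0] weight_proj_SL[OF dex] weight_proj_SL[OF d2_in_SL[OF x]] by simp
  have "P 2 (D d (D d (e [x]))) = 0" using sq by simp
  then have "D1 d (cobar_d2 G \<delta> x) + D2 (- e [d x]) = 0"
    using P_D_Suc[OF d F, of 1] by (simp add: P numeral_2_eq_2)
  then have "D1 d (cobar_d2 G \<delta> x) = cobar_d2 G \<delta> (d x)"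
    using der_single[OF odd_gen_d2 H_G[OF dx]]
      odd_derivation_minus[OF der_odd_derivation[OF odd_gen_d2], of "e [d x]"] by simp
  then have "fscale (- (1 / 2)) (mu (Td d (\<delta> x))) = fscale (- (1 / 2)) (mu (\<delta> (d x)))"
    unfolding cobar_d2_mu der_extend_scale mu_Td[OF d \<delta>_deg[OF x]] .
  then have eq: "mu (Td d (\<delta> x)) = mu (\<delta> (d x))" by simp
  let ?t = "\<delta> (d x) - Td d (\<delta> x)"
  have t: "?t \<in> TS (n - 1)"
    by (rule fs.span_diff[OF \<delta>_deg[OF dx] Td_TS[OF d \<delta>_deg[OF x]]])
  have anti: "?t (flip M) = - ?t M" if M: "M \<in> multilin fscale G" for M
  proof -
    have "\<delta> x (flip M') = - \<delta> x M'" if "M' \<in> multilin fscale G" for M'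
      using that by (rule \<delta>_anti[OF x])
    from Td_anti[where t = "\<delta> x", OF d \<delta>_deg[OF x] this M] have 1: "Td d (\<delta> x) (flip M) = - Td d (\<delta> x) M" .
    have 2: "\<delta> (d x) (flip M) = - \<delta> (d x) M" using M by (rule \<delta>_anti[OF dx])
    show ?thesis unfolding minus_apply[of _ _ M] minus_apply[of _ _ "flip M"] 1 2 by simp
  qed
  have "mu ?t = 0" unfolding mu_diff eq by simp
  from mu_inj[where t = "?t", OF t anti this] have "?t = 0" .
  then show ?thesis by simp
qed

text \<open>By induction on the degree both coderivations agree on the tensor factors of \<open>\<delta> x\<close>, so their
  difference at \<open>x\<close> is in the kernel of \<open>\<delta>\<close>, where \<open>d\<^sub>2\<close> vanishes.  The difference has degree
  \<open>n - 1\<close>, and \<open>d\<^sub>2\<close> is injective there as soon as \<open>n \<ge> 3\<close>.\<close>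

lemma coderivation_unique:
  assumes d: "lin_deg d" "lin_deg d'"
    and co: "\<And>n x. x \<in> G n \<Longrightarrow> \<delta> (d x) = Td d (\<delta> x)" "\<And>n x. x \<in> G n \<Longrightarrow> \<delta> (d' x) = Td d' (\<delta> x)"
    and agree: "\<And>x. x \<in> G 2 \<Longrightarrow> d x = d' x"
    and x: "x \<in> G n"
  shows "d x = d' x"
proof -
  have "\<forall>x\<in>G (int m). d x = d' x" for m
  proof (induction m rule: less_induct)
    case (less m)
    show ?case
    proof
      fix x assume x: "x \<in> G (int m)"
      note dx = lin_degD(1)[OF d(1) x] lin_degD(1)[OF d(2) x]
      consider "m \<le> 1" | "m = 2" | "m \<ge> 3" by linarith
      then show "d x = d' x"
      proof cases
        case 1
        then show ?thesis using G_pos[OF _ dx(1)] G_pos[OF _ dx(2)] by simp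
      next
        case 2
        then show ?thesis using agree x by simp
      next
        case 3
        have same: "d a = d' a" if "a \<in> G p" "b \<in> G q" "p + q = int m" "b \<noteq> 0" for a b p q
        proof (cases "p \<le> 0")
          case True
          then show ?thesis using G_pos[OF True that(1)] lin_deg_zero d by simp
        next
          case False
          have "q > 0" using G_pos[OF _ that(2)] that(4) by force
          then have "nat p < m" "a \<in> G (int (nat p))" using that False by auto
          then show ?thesis using less by blast
        qed
        have "Td d t = Td d' t" if "t \<in> TS (int m)" for t
        proof (rule TS_eq[OF that lin_on_Td lin_on_Td])
          fix a b p q assume ab: "a \<in> G p" "b \<in> G q" "p + q = int m"
          have z: "evT [a, b'] = 0 \<and> evT [b', a] = 0" if "a = 0" "b' \<in> homs G" for a b'
            using that by (intro conjI ext) (simp_all add: ev_def pointwise Ten.multilin_pair(5,6))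
          show "Td d (evT [a, b]) = Td d' (evT [a, b])"
          proof (cases "a = 0 \<or> b = 0")
            case True
            note hom = Ten.G_homs lin_degD(1)[OF d(1), THEN Ten.G_homs] lin_degD(1)[OF d(2), THEN Ten.G_homs]
            have "d a = 0 \<and> d' a = 0 \<or> b = 0" "d b = 0 \<and> d' b = 0 \<or> a = 0"
              using True lin_deg_zero[OF d(1)] lin_deg_zero[OF d(2)] by auto
            then have "evT [d a, b] = 0" "evT [a, d b] = 0" "evT [d' a, b] = 0" "evT [a, d' b] = 0"
              using z hom[OF ab(1)] hom[OF ab(2)] by metis+
            then show ?thesis unfolding Td_ev[OF d(1) ab(1,2)] Td_ev[OF d(2) ab(1,2)] by simp
          next
            case False
            then have "d a = d' a" "d b = d' b"
              using same[OF ab] same[OF ab(2,1)] ab(3) by auto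
            then show ?thesis unfolding Td_ev[OF d(1) ab(1,2)] Td_ev[OF d(2) ab(1,2)] by simp
          qed
        qed
        then have eq: "\<delta> (d x) = \<delta> (d' x)"
          using co(1)[OF x] co(2)[OF x] \<delta>_deg[OF x] by simp
        have diff: "d x - d' x \<in> G (int m - 1)" using G_sub dx fs.subspace_diff by blast
        have "\<delta> (d x - d' x) + \<delta> (d' x) = \<delta> (d x)"
          using \<delta>_add[OF diff dx(2)] by simp
        then have "\<delta> (d x - d' x) = 0" using eq by simp
        then have "cobar_d2 G \<delta> (d x - d' x) = 0" by (simp add: cobar_d2_mu)
        then have "d x - d' x = 0" using d2_inj[OF diff] 3 by simp
        then show ?thesis by simp
      qed
    qed
  qed
  from this[of "nat n"] show ?thesis
    using x G_pos[OF _ x] lin_deg_zero[OF d(1)] lin_deg_zero[OF d(2)] by (cases "n < 0") auto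
qed

section \<open>Existence of the coderivation\<close>

text \<open>On \<open>G (N + 1)\<close> the curvature \<open>h\<close> vanishes, and the new map takes \<open>x\<close> to the unique \<open>y\<close> with
  \<open>D (d\<^sub>2 x) = D (s\<^sup>-\<^sup>1 y)\<close>; this is the equation \<open>D\<^sup>2 (s\<^sup>-\<^sup>1 x) = 0\<close>.\<close>

lemma extend_step:
  assumes d: "lin_deg d" and sq: "\<And>n x. n \<le> N \<Longrightarrow> x \<in> G n \<Longrightarrow> D d (D d (e [x])) = 0"
    and N: "N \<ge> 2"
    and base: "\<And>x. N = 2 \<Longrightarrow> x \<in> G 3 \<Longrightarrow> \<exists>y\<in>G 2. D d (cobar_d2 G \<delta> x) = D d (e [y])"
  shows "\<exists>d'. lin_deg d' \<and> (\<forall>n\<le>N. \<forall>x\<in>G n. d' x = d x) \<and>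
    (\<forall>n\<le>N + 1. \<forall>x\<in>G n. D d' (D d' (e [x])) = 0)"
proof -
  note odd = D_odd[OF d]
  let ?Q = "\<lambda>x y. y \<in> G N \<and> D d (cobar_d2 G \<delta> x) = D d (e [y])"
  have ex: "\<exists>y. ?Q x y" if "x \<in> G (N + 1)" for x
  proof (cases "N = 2")
    case True
    then show ?thesis using base[of x] that by auto
  next
    case False
    then have "N \<ge> 3" using N by simp
    have "\<exists>y\<in>G N. D d (cobar_d2 G \<delta> x) = D d (e [y])"
      by (rule corestriction_exists[OF d _ \<open>N \<ge> 3\<close> that]) (rule sq)
    then show ?thesis by blast
  qed
  have uniq: "y = z" if "?Q x y" "?Q x z" for x y z
    using corestriction_unique[OF d, of y N z] N that by simp
  define c where "c x = (THE y. ?Q x y)" for x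
  have cI: "c x = y" if "?Q x y" for x y
    unfolding c_def by (rule the_equality[where P = "?Q x", OF that]) (rule uniq[OF _ that])
  have c: "?Q x (c x)" if x: "x \<in> G (N + 1)" for x
  proof -
    obtain y where y: "?Q x y" using ex[OF x] by blast
    show ?thesis unfolding cI[OF y] by (rule y)
  qed
  define d' where "d' x = (if x \<in> G (N + 1) then c x else d x)" for x
  have c_add: "c (x + y) = c x + c y" if "x \<in> G (N + 1)" "y \<in> G (N + 1)" for x y
  proof (rule cI, intro conjI)
    have cx: "c x \<in> G N" "c y \<in> G N" using c that by auto
    show "c x + c y \<in> G N" by (rule Ten.G_add[OF cx])
    have "e [c x + c y] = e [c x] + e [c y]"
      using cx by (intro e_single_linear(1)[where n = "N - 1"]) (simp_all add: in_shift)
    then show "D d (cobar_d2 G \<delta> (x + y)) = D d (e [c x + c y])"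
      using c[OF that(1)] c[OF that(2)] odd_genD(2)[OF odd_gen_d2, of x N y] that
      by (simp add: in_shift odd_derivationD(1)[OF odd])
  qed
  have c_scale: "c (fscale r x) = fscale r (c x)" if "x \<in> G (N + 1)" for x r
  proof (rule cI, intro conjI)
    have cx: "c x \<in> G N" using c that by auto
    show "fscale r (c x) \<in> G N" by (rule Ten.G_scale[OF cx])
    have "e [fscale r (c x)] = fscale r (e [c x])"
      using cx by (intro e_single_linear(2)[where n = "N - 1"]) (simp_all add: in_shift)
    then show "D d (cobar_d2 G \<delta> (fscale r x)) = D d (e [fscale r (c x)])"
      using c[OF that(1)] odd_genD(3)[OF odd_gen_d2, of x N r] that
      by (simp add: in_shift odd_derivationD(2)[OF odd])
  qed
  have c0: "c 0 = 0" using c_scale[OF Ten.G_zero, of 0] by simp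
  have other: "d' x = d x" if "x \<in> G n" "n \<noteq> N + 1" for x n
    using G_disj[OF that(1), of "N + 1"] that(2) lin_deg_zero[OF d] c0 by (auto simp: d'_def)
  have d': "lin_deg d'"
  proof (rule lin_degI)
    fix n x assume x: "x \<in> G n"
    show "d' x \<in> G (n - 1)"
      using x c[of x] other[OF x] lin_degD(1)[OF d x] by (cases "n = N + 1") (auto simp: d'_def)
    show "d' (x + y) = d' x + d' y" if "y \<in> G n" for y
      using x that c_add[of x y] other[of _ n] Ten.G_add[OF x that] lin_degD(2)[OF d x that]
      by (cases "n = N + 1") (auto simp: d'_def)
    show "d' (fscale r x) = fscale r (d' x)" for r
      using x c_scale[of x r] other[of _ n] Ten.G_scale[OF x, of r] lin_degD(3)[OF d x, of r]
      by (cases "n = N + 1") (auto simp: d'_def)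
  qed
  have cong: "D d' F = D d F" if "F \<in> SB N" for F
    by (rule D_cong_SB[OF d' d _ that]) (use other in auto)
  have "D d' (D d' (e [x])) = 0" if "n \<le> N + 1" "x \<in> G n" for n x
  proof (cases "n = N + 1")
    case False
    then have "n \<le> N" using that by simp
    then show ?thesis
      using cong[OF SB_single[OF that(2)]] cong[OF D_single_SB[OF d that(2)]] sq[OF _ that(2)] by simp
  next
    case True
    then have x: "x \<in> G (N + 1)" using that by simp
    have cx: "c x \<in> G N" "D d (cobar_d2 G \<delta> x) = D d (e [c x])" using c[OF x] by auto
    have "h x = 0" using h_deg[OF x] N by simp
    then have "D d' (e [x]) = cobar_d2 G \<delta> x - e [c x]"
      using D_single[OF d' x] x by (simp add: d'_def)
    moreover have "D d' (cobar_d2 G \<delta> x) = D d (cobar_d2 G \<delta> x)"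
      using cong d2_SB[OF x] by simp
    moreover have "D d' (e [c x]) = D d (e [c x])"
      using cong[OF SB_single[OF cx(1)]] by simp
    ultimately show ?thesis using cx(2) by (simp add: odd_derivation_diff[OF D_odd[OF d']])
  qed
  then show ?thesis using d' other by (intro exI[of _ d']) auto
qed

text \<open>Stage \<open>k\<close> of the construction settles the degrees up to \<open>k + 2\<close>, and later stages keep these
  values, so the stages glue.\<close>

theorem differential_exists:
  assumes d: "lin_deg d0"
    and base: "\<And>x. x \<in> G 3 \<Longrightarrow> \<exists>y\<in>G 2. D d0 (cobar_d2 G \<delta> x) = D d0 (e [y])"
  shows "\<exists>d. lin_deg d \<and> (\<forall>x\<in>G 2. d x = d0 x) \<and> (\<forall>n. \<forall>x\<in>G n. D d (D d (e [x])) = 0)"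
proof -
  let ?P = "\<lambda>k d. lin_deg d \<and> (\<forall>n\<le>2. \<forall>x\<in>G n. d x = d0 x) \<and>
      (\<forall>n\<le>int k + 2. \<forall>x\<in>G n. D d (D d (e [x])) = 0)"
  let ?Q = "\<lambda>k d d'. \<forall>n\<le>int k + 2. \<forall>x\<in>G n. d' x = d x"
  have "\<exists>f. \<forall>k. ?P k (f k) \<and> ?Q k (f k) (f (Suc k))"
  proof (rule dependent_nat_choice)
    \<comment> \<open>For letters of degree at most \<open>2\<close> the square lies in negative degree.\<close>
    have "D d0 (D d0 (e [x])) = 0" if "n \<le> 2" "x \<in> G n" for n x
    proof (rule Sn_neg)
      have "e [x] \<in> Sn (n - 1)" using that by (intro e_single) (simp add: in_shift)
      then show "D d0 (D d0 (e [x])) \<in> Sn (n - 1 - 1 - 1)"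
        by (intro odd_derivationD(3)[OF D_odd[OF d]])
    qed (use that in simp)
    then show "\<exists>f. ?P 0 f" using d by (intro exI[of _ d0]) simp
  next
    fix f k assume P: "?P k f"
    have "\<exists>y\<in>G 2. D f (cobar_d2 G \<delta> x) = D f (e [y])" if x: "x \<in> G 3" for x
    proof -
      have cong: "D f F = D d0 F" if "F \<in> SB 2" for F
        by (rule D_cong_SB[OF _ d _ that]) (use P in auto)
      obtain y where y: "y \<in> G 2" "D d0 (cobar_d2 G \<delta> x) = D d0 (e [y])" using base[OF x] by blast
      have "cobar_d2 G \<delta> x \<in> SB 2" using d2_SB[OF x] by simp
      then show ?thesis using y cong[of "cobar_d2 G \<delta> x"] cong[OF SB_single[OF y(1), of 2]]
        by (intro bexI[of _ y]) simp_all
    qed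
    then have "\<exists>d'. lin_deg d' \<and> (\<forall>n\<le>int k + 2. \<forall>x\<in>G n. d' x = f x) \<and>
      (\<forall>n\<le>int k + 2 + 1. \<forall>x\<in>G n. D d' (D d' (e [x])) = 0)"
      using P by (intro extend_step) simp_all
    then obtain d' where d': "lin_deg d'" "\<forall>n\<le>int k + 2. \<forall>x\<in>G n. d' x = f x"
      "\<forall>n\<le>int k + 2 + 1. \<forall>x\<in>G n. D d' (D d' (e [x])) = 0" by blast
    have "d' x = d0 x" if "n \<le> 2" "x \<in> G n" for n x
    proof -
      have "n \<le> int k + 2" using that by simp
      then have "d' x = f x" using d'(2) that(2) by blast
      then show ?thesis using P that by simp
    qed
    moreover have "int (Suc k) + 2 = int k + 2 + 1" by simp
    ultimately show "\<exists>f'. ?P (Suc k) f' \<and> ?Q k f f'"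
      using d' by (intro exI[of _ d']) (simp only: simp_thms, blast)
  qed
  then obtain f where f: "\<And>k. ?P k (f k)" "\<And>k. ?Q k (f k) (f (Suc k))" by blast
  have mono: "f (k + j) x = f k x" if "n \<le> int k + 2" "x \<in> G n" for k j n x
    using that
  proof (induction j)
    case (Suc j)
    have "n \<le> int (k + j) + 2" using Suc.prems by simp
    then have "f (Suc (k + j)) x = f (k + j) x" using f(2)[of "k + j"] Suc.prems by blast
    then show ?case using Suc by simp
  qed simp
  \<comment> \<open>Degree \<open>n\<close> is settled at stage \<open>n\<close>.\<close>
  define d where "d x = f (nat (deg G x)) x" for x
  have eq: "d x = f k x" if "x \<in> G n" "n \<le> int k + 2" for x n k
  proof (cases "x = 0")
    case True
    then show ?thesis using lin_deg_zero f(1) by (simp add: d_def)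
  next
    case False
    have n: "deg G x = n" by (rule Ten.deg_eq[OF that(1) False])
    show ?thesis
    proof (cases "nat n \<le> k")
      case True
      then show ?thesis using mono[of n "nat n" x "k - nat n"] that by (simp add: d_def n)
    next
      case False
      then show ?thesis using mono[of n k x "nat n - k"] that by (simp add: d_def n)
    qed
  qed
  have d_lin: "lin_deg d"
  proof (rule lin_degI)
    fix n x assume x: "x \<in> G n"
    have le: "n \<le> int (nat n) + 2" by simp
    note fk = f(1)[of "nat n", THEN conjunct1] and eqn = eq[OF _ le]
    show "d x \<in> G (n - 1)" using lin_degD(1)[OF fk x] eqn[OF x] by simp
    show "d (x + y) = d x + d y" if "y \<in> G n" for y
      using lin_degD(2)[OF fk x that] eqn[OF x] eqn[OF that] eqn[OF Ten.G_add[OF x that]] by simp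
    show "d (fscale r x) = fscale r (d x)" for r
      using lin_degD(3)[OF fk x] eqn[OF x] eqn[OF Ten.G_scale[OF x]] by simp
  qed
  have "D d (D d (e [x])) = 0" if x: "x \<in> G n" for n x
  proof -
    define k where "k = nat n"
    have le: "n \<le> int k + 2" by (simp add: k_def)
    have fk: "lin_deg (f k)" using f(1) by blast
    have cong: "D d F = D (f k) F" if "F \<in> SB (int k + 2)" for F
      by (rule D_cong_SB[OF d_lin fk _ that]) (rule eq)
    show ?thesis
      using cong[OF SB_single[OF x le]] cong[OF D_single_SB[OF fk x le]] f(1)[of k] le x by simp
  qed
  moreover have "d x = d0 x" if "x \<in> G 2" for x
  proof -
    have "\<forall>n\<le>2. \<forall>x\<in>G n. f 0 x = d0 x" using f(1)[of 0] by blast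
    then have "f 0 x = d0 x" using that by blast
    then show ?thesis using eq[OF that, of 0] by simp
  qed
  ultimately show ?thesis using d_lin by blast
qed

lemma D_square:
  assumes d: "lin_deg d" and sq: "\<And>n x. x \<in> G n \<Longrightarrow> D d (D d (e [x])) = 0" and F: "F \<in> Sn n"
  shows "D d (D d F) = 0"
proof (rule Sn_eq[OF F lin_on_comp[OF lin_on_odd[OF D_odd[OF d]] lin_on_odd[OF D_odd[OF d]]] lin_on_ops(5)])
  fix w assume w: "set w \<subseteq> homs (shift (- 1) G)"
  show "D d (D d (e w)) = 0"
  proof (rule square_zero_word[OF D_odd[OF d] w])
    fix x assume "x \<in> set w"
    then have "x \<in> homs G" using w H_eq by blast
    then show "D d (D d (e [x])) = 0" by (rule sq[OF Ten.deg_in])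
  qed
qed

end

section \<open>The symmetric algebra of a vector space and its quotients\<close>

context graded_space
begin

text \<open>The converse of restricting a functional to words; with \<open>functional_form\<close> it identifies symmetric
  forms with functionals on the algebra.\<close>

lemma functional_is_form:
  assumes l: "\<And>a b. l (a + b) = l a + l b" "\<And>c a. l (fscale c a) = c * l a"
  shows "(\<lambda>w. l (e w)) \<in> \<Phi>"
proof (rule symI[OF multilinI])
  fix us vs :: "'a list" and m n x y c
  assume H: "set us \<subseteq> H" "set vs \<subseteq> H"
  show "l (e (us @ (x + y) # vs)) = l (e (us @ x # vs)) + l (e (us @ y # vs))"
    if "x \<in> G n" "y \<in> G n" unfolding e_add[OF H that] l ..
  show "l (e (us @ sc c x # vs)) = c * l (e (us @ x # vs))"
    if "x \<in> G n" unfolding e_scale[OF H G_homs[OF that]] l ..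
  show "l (e (us @ x # y # vs)) = ksign (m * n) * l (e (us @ y # x # vs))"
    if "x \<in> G m" "y \<in> G n" unfolding e_swap'[OF H that] l ..
qed

end

locale ground_space =
  fixes sc :: "'k::field_char_0 \<Rightarrow> 'v::ab_group_add \<Rightarrow> 'v"
  assumes vsp: "vector_space sc"
begin

interpretation VV: vector_space sc by (rule vsp)

sublocale graded_space sc degree_zero
proof
  show "module.subspace sc (degree_zero n)" for n
    by (auto simp: degree_zero_def VV.subspace_UNIV VV.subspace_single_0)
qed (auto simp: vsp degree_zero_def split: if_splits)

abbreviation sprod (infixl "\<cdot>" 70) where "F \<cdot> K \<equiv> conc \<Phi> F K"

lemma homs_UNIV: "homs degree_zero = UNIV"
  by (auto simp: homs_def degree_zero_def)

lemma symV_eq: "symV_forms sc = \<Phi>"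
  by (simp add: symV_forms_def)

lemma e_S: "e w \<in> S"
  by (rule e_in_S) (simp add: homs_UNIV)

lemma conc_e: "e u \<cdot> e v = e (u @ v)"
  by (rule conc_ev) (simp_all add: homs_UNIV)

lemma S_eq: "S = fspan (range e)"
  by (rule arg_cong[of _ _ fspan]) (auto simp: homs_UNIV)

lemma wdeg_zero: "0 \<notin> set w \<Longrightarrow> wdeg w = 0"
proof (induction w)
  case (Cons x w)
  have "x \<in> degree_zero 0" by (simp add: degree_zero_def)
  then have "dg x = 0" using Cons.prems by (intro deg_eq) auto
  then show ?case using Cons by simp
qed simp

lemma e_Sn_0: "e w \<in> Sn 0"
proof (cases "0 \<in> set w")
  case True
  then have "e w = 0" by (rule e_null) (simp add: homs_UNIV)
  then show ?thesis by (simp add: Sn_intros)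
next
  case False
  then show ?thesis by (intro e_in_Sn wdeg_zero) (simp_all add: homs_UNIV)
qed

lemma S_mem:
  assumes "F \<in> S" "lin_on S f" "fsubspace W" "\<And>w. f (e w) \<in> W"
  shows "f F \<in> W"
  by (rule fspan_mem[OF assms(1-3)]) (use assms(4) in auto)

lemma S_ext:
  assumes "F \<in> S" "lin_on S f" "lin_on S g" "\<And>w. f (e w) = g (e w)"
  shows "f F = g F"
  by (rule fspan_eq[OF assms(1-3)]) (use assms(4) in auto)

lemma S_Sn_0: "F \<in> S \<longleftrightarrow> F \<in> Sn 0"
  using S_mem[OF _ lin_on_ops(4) Sn_sub e_Sn_0] Sn_S by blast

lemma commute: "F \<in> S \<Longrightarrow> K \<in> S \<Longrightarrow> F \<cdot> K = K \<cdot> F"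
  using graded_commute[of F 0 K 0] by (simp add: S_Sn_0)

lemma e_plus: "e (us @ (x + y) # vs) = e (us @ x # vs) + e (us @ y # vs)"
  by (rule e_add[of _ _ _ 0]) (simp_all add: homs_UNIV degree_zero_def)

lemma e_sc: "e (us @ sc c x # vs) = fscale c (e (us @ x # vs))"
  by (rule e_scale) (simp_all add: homs_UNIV)

section \<open>Ideals and quotients\<close>

lemma ideal_in_S:
  assumes "P \<subseteq> S"
  shows "ideal sc P \<subseteq> S"
  unfolding ideal_def symV_eq
  by (intro fs.span_minimal fs.subspace_span) (use assms S_Sn_0 conc_in_S in blast)

lemma ideal_sub: "fsubspace (ideal sc P)"
  unfolding ideal_def by (rule fs.subspace_span)

lemma ideal_mult:
  assumes P: "P \<subseteq> S" and F: "F \<in> S" and r: "r \<in> ideal sc P"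
  shows "F \<cdot> r \<in> ideal sc P"
proof -
  note lin = lin_on_conc_right[OF F ideal_in_S[OF P, unfolded ideal_def symV_eq]]
  show ?thesis
    using r unfolding ideal_def symV_eq
  proof (rule fspan_mem[OF _ lin fs.subspace_span])
    fix b assume "b \<in> {F \<cdot> r |F r. F \<in> Sn 0 \<and> r \<in> P}"
    then obtain K p where b: "b = K \<cdot> p" "K \<in> S" "p \<in> P" using S_Sn_0 by blast
    have "F \<cdot> b = (F \<cdot> K) \<cdot> p" unfolding b(1) using b P F by (intro conc_assoc[symmetric]) auto
    moreover have "F \<cdot> K \<in> Sn 0" using conc_in_S[OF F b(2)] S_Sn_0 by blast
    ultimately show "F \<cdot> b \<in> fspan {F \<cdot> r |F r. F \<in> Sn 0 \<and> r \<in> P}"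
      using b(3) by (intro fs.span_base) blast
  qed
qed

lemma ideal_base:
  assumes "P \<subseteq> S" "p \<in> P"
  shows "p \<in> ideal sc P"
proof -
  have "e [] \<cdot> p = p" using assms by (intro one_conc) auto
  then show ?thesis unfolding ideal_def symV_eq
    by (intro fs.span_base) (use assms e_Sn_0[of "[]"] in \<open>metis (mono_tags, lifting) mem_Collect_eq\<close>)
qed

lemma quot_forms_sym: "M \<in> quot_forms sc P \<Longrightarrow> M \<in> \<Phi>"
  by (simp add: quot_forms_def symV_eq)

text \<open>Forms that vanish on an ideal are stable under prescribing a prefix or a suffix, so the
  quotient algebra is again an algebra of words.\<close>

lemma quot_conc_forms:
  assumes P: "P \<subseteq> S"
  shows "conc_forms (quot_forms sc P) UNIV"
proof
  note IS = subsetD[OF ideal_in_S[OF P]]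
  show "(\<lambda>_. 0) \<in> quot_forms sc P"
    using zero S_null[OF IS] by (simp add: quot_forms_def symV_eq)
  show "(\<lambda>w. M w + N w) \<in> quot_forms sc P" if "M \<in> quot_forms sc P" "N \<in> quot_forms sc P" for M N
  proof -
    have "r (\<lambda>w. M w + N w) = 0" if "r \<in> ideal sc P" for r
    proof -
      have "r M = 0" "r N = 0" "M \<in> \<Phi>" "N \<in> \<Phi>"
        using that \<open>M \<in> quot_forms sc P\<close> \<open>N \<in> quot_forms sc P\<close> by (auto simp: quot_forms_def symV_eq)
      then show ?thesis using S_plus[OF IS[OF that]] by simp
    qed
    then show ?thesis using that add by (simp add: quot_forms_def symV_eq)
  qed
  show "(\<lambda>w. c * M w) \<in> quot_forms sc P" if "M \<in> quot_forms sc P" for M c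
  proof -
    have "r (\<lambda>w. c * M w) = 0" if "r \<in> ideal sc P" for r
    proof -
      have "r M = 0" "M \<in> \<Phi>"
        using that \<open>M \<in> quot_forms sc P\<close> by (auto simp: quot_forms_def symV_eq)
      then show ?thesis using S_times[OF IS[OF that]] by simp
    qed
    then show ?thesis using that scale by (simp add: quot_forms_def symV_eq)
  qed
  show "N \<in> quot_forms sc P" if "M \<in> quot_forms sc P" "\<And>w. set w \<subseteq> UNIV \<Longrightarrow> N w = M w" for M N
    using that by (metis ext subset_UNIV)
next
  fix M u assume M: "M \<in> quot_forms sc P"
  note M' = quot_forms_sym[OF M]
  have l: "(\<lambda>v. M (u @ v)) \<in> \<Phi>" using left[OF M'] by (simp add: homs_UNIV)
  have r: "(\<lambda>v. M (v @ u)) \<in> \<Phi>" using right[OF M'] by (simp add: homs_UNIV)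
  have *: "r (\<lambda>v. M (u @ v)) = 0 \<and> r (\<lambda>v. M (v @ u)) = 0" if "r \<in> ideal sc P" for r
  proof -
    have rS: "r \<in> S" using that ideal_in_S[OF P] by auto
    have "e u \<cdot> r \<in> ideal sc P" by (rule ideal_mult[OF P e_S that])
    then have 0: "(e u \<cdot> r) M = 0" using M by (simp add: quot_forms_def)
    moreover have "(e u \<cdot> r) M = r (\<lambda>v. M (u @ v))"
      using inner_form[OF rS M'] by (simp add: conc_apply M' e_apply)
    moreover have "(r \<cdot> e u) M = r (\<lambda>v. e u (\<lambda>w. M (v @ w)))"
      by (simp add: conc_apply M')
    moreover have "\<dots> = r (\<lambda>v. M (v @ u))"
    proof (rule S_local[OF rS r])
      fix w have "(\<lambda>v. M (w @ v)) \<in> \<Phi>" using left[OF M'] by (simp add: homs_UNIV)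
      then show "e u (\<lambda>v. M (w @ v)) = M (w @ u)" by (simp add: e_apply)
    qed
    ultimately show ?thesis using commute[OF rS e_S[of u]] by simp
  qed
  show "(\<lambda>v. M (u @ v)) \<in> quot_forms sc P" "(\<lambda>v. M (v @ u)) \<in> quot_forms sc P"
    using * l r by (auto simp: quot_forms_def symV_eq)
qed

definition proj :: "('v, 'k) words set \<Rightarrow> ('v, 'k) words \<Rightarrow> ('v, 'k) words"
  where "proj P F = (\<lambda>M. if M \<in> quot_forms sc P then F M else 0)"

lemma proj_e: "proj P (e w) = ev (quot_forms sc P) w"
  by (auto simp: proj_def ev_def quot_forms_sym)

lemma proj_linear: "proj P (F + K) = proj P F + proj P K" "proj P (fscale c F) = fscale c (proj P F)"
    "proj P 0 = 0"
  by (auto simp: proj_def pointwise fun_eq_iff)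

lemma lin_on_proj: "lin_on T (proj P)"
  by (simp add: lin_on_def proj_linear)

lemma proj_ideal: "r \<in> ideal sc P \<Longrightarrow> proj P r = 0"
  by (auto simp: proj_def quot_forms_def pointwise fun_eq_iff)

text \<open>An element outside the ideal is separated from it by a functional, which is a form on the quotient.\<close>

lemma proj_kernel:
  assumes P: "P \<subseteq> S" and F: "F \<in> S" "proj P F = 0"
  shows "F \<in> ideal sc P"
proof (rule ccontr)
  assume "F \<notin> ideal sc P"
  then obtain l where l: "\<And>a b. l (a + b) = l a + l b" "\<And>c a. l (fscale c a) = c * l a"
    "\<And>a. a \<in> ideal sc P \<Longrightarrow> l a = 0" "l F = 1"
    using separating_functional[OF vector_space_fscale ideal_sub] by blast
  let ?M = "\<lambda>w. l (e w)"
  have M: "?M \<in> \<Phi>" by (rule functional_is_form[OF l(1,2)])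
  have app: "K ?M = l K" if "K \<in> S" for K
    by (rule functional_form[OF l(1,2) that M])
  have "?M \<in> quot_forms sc P"
    unfolding quot_forms_def symV_eq
  proof (intro CollectI conjI ballI M)
    fix r assume r: "r \<in> ideal sc P"
    then show "r ?M = 0" using app[OF subsetD[OF ideal_in_S[OF P] r]] l(3) by simp
  qed
  then have "proj P F ?M = 1" using app[OF F(1)] l(4) by (simp add: proj_def)
  then show False using F(2) by (simp add: pointwise)
qed

lemma quot_alg_0: "quot_alg sc P 0 = fspan (range (ev (quot_forms sc P)))"
proof -
  have z: "ev (quot_forms sc P) w = 0" if "0 \<in> set w" for w
    using e_null[of w] that proj_e[of P w] proj_linear(3) by (simp add: homs_UNIV)
  have "range (ev (quot_forms sc P)) \<subseteq> quot_alg sc P 0"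
  proof
    fix x assume "x \<in> range (ev (quot_forms sc P))"
    then obtain w where x: "x = ev (quot_forms sc P) w" by blast
    show "x \<in> quot_alg sc P 0"
    proof (cases "0 \<in> set w")
      case True
      then show ?thesis using z x by (simp add: quot_alg_def alg_part_def fs.span_zero)
    next
      case False
      then show ?thesis using x wdeg_zero[OF False]
        unfolding quot_alg_def alg_part_def by (intro fs.span_base) (auto simp: homs_UNIV)
    qed
  qed
  then have "fspan (range (ev (quot_forms sc P))) \<subseteq> quot_alg sc P 0"
    unfolding quot_alg_def alg_part_def by (intro fs.span_minimal fs.subspace_span)
  moreover have "quot_alg sc P 0 \<subseteq> fspan (range (ev (quot_forms sc P)))"
    unfolding quot_alg_def alg_part_def by (rule fs.span_mono) auto
  ultimately show ?thesis by blast
qed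

lemma quot_alg_other:
  assumes "n \<noteq> 0"
  shows "quot_alg sc P n = {0}"
proof -
  have "ev (quot_forms sc P) w = 0" if "wdeg w = n" for w
  proof -
    have "0 \<in> set w" using wdeg_zero that assms by blast
    then have "e w = 0" by (rule e_null) (simp add: homs_UNIV)
    then show ?thesis using proj_linear(3) by (simp add: proj_e[symmetric])
  qed
  then have "quot_alg sc P n \<subseteq> {0}"
    unfolding quot_alg_def alg_part_def by (intro fs.span_minimal fs.subspace_single_0) auto
  moreover have "0 \<in> quot_alg sc P n" unfolding quot_alg_def alg_part_def by (rule fs.span_zero)
  ultimately show ?thesis by blast
qed

section \<open>Filtration by polynomial degree\<close>

lemma weight_proj_e: "weight_proj \<Phi> l (e w) = (if length w = l then e w else 0)"
  by (rule weight_proj_word) (simp add: homs_UNIV)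

lemma upto_eq: "symV_upto sc n = fspan {e w | w. length w \<le> n}"
  by (simp add: symV_upto_def symV_eq)

lemma upto_S: "F \<in> symV_upto sc n \<Longrightarrow> F \<in> S"
  unfolding upto_eq S_eq by (erule set_mp[OF fs.span_mono, rotated]) blast

lemma upto_weight:
  assumes "F \<in> symV_upto sc n"
  shows "F = (\<Sum>l\<le>n. weight_proj \<Phi> l F)"
proof (rule fspan_eq[OF assms[unfolded upto_eq] lin_on_ops(4)])
  show "lin_on (fspan {e w |w. length w \<le> n}) (\<lambda>F. \<Sum>l\<le>n. weight_proj \<Phi> l F)"
    by (simp add: lin_on_def weight_proj_add weight_proj_scale sum.distrib fs.scale_sum_right)
  fix b assume "b \<in> {e w |w. length w \<le> n}"
  then obtain w where w: "b = e w" "length w \<le> n" by blast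
  have "(\<Sum>l\<le>n. weight_proj \<Phi> l b) = (\<Sum>l\<le>n. if l = length w then e w else 0)"
    unfolding w(1) by (intro sum.cong) (auto simp: weight_proj_e)
  then show "b = (\<Sum>l\<le>n. weight_proj \<Phi> l b)" using w by simp
qed

lemma weight_proj_upto:
  assumes "F \<in> S" "l \<le> n"
  shows "weight_proj \<Phi> l F \<in> symV_upto sc n"
  unfolding upto_eq
  by (rule S_mem[OF assms(1) lin_on_weight_proj fs.subspace_span])
    (use assms(2) in \<open>auto simp: weight_proj_e intro: fs.span_base fs.span_zero\<close>)

lemma weight_1:
  assumes "F \<in> S"
  shows "\<exists>v. weight_proj \<Phi> 1 F = e [v]"
proof -
  have "fsubspace (range (\<lambda>v. e [v]))"
  proof (rule fs.subspaceI)
    show "0 \<in> range (\<lambda>v. e [v])" using e_single_zero by (metis rangeI)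
    show "x + y \<in> range (\<lambda>v. e [v])" if "x \<in> range (\<lambda>v. e [v])" "y \<in> range (\<lambda>v. e [v])" for x y
      using that e_plus[of "[]" _ _ "[]"] by auto (metis append_Nil rangeI)
    show "fscale c x \<in> range (\<lambda>v. e [v])" if "x \<in> range (\<lambda>v. e [v])" for c x
      using that e_sc[of "[]" c _ "[]"] by auto (metis append_Nil rangeI)
  qed
  then have "weight_proj \<Phi> 1 F \<in> range (\<lambda>v. e [v])"
  proof (rule S_mem[OF assms lin_on_weight_proj])
    show "weight_proj \<Phi> 1 (e w) \<in> range (\<lambda>v. e [v])" for w
      using e_single_zero by (cases w; cases "tl w") (auto simp: weight_proj_e intro: range_eqI[of _ _ 0])
  qed
  then show ?thesis by blast
qed

lemma weight_0:
  assumes "F \<in> S"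
  shows "\<exists>c. weight_proj \<Phi> 0 F = fscale c (e [])"
proof -
  have "weight_proj \<Phi> 0 F \<in> fspan {e []}"
  proof (rule S_mem[OF assms lin_on_weight_proj fs.subspace_span])
    show "weight_proj \<Phi> 0 (e w) \<in> fspan {e []}" for w
      by (cases w) (auto simp: weight_proj_e intro: fs.span_base fs.span_zero)
  qed
  then show ?thesis by (auto simp: fs.span_singleton)
qed

lemma e_single_inj': "e [u] = e [v] \<Longrightarrow> u = v"
  using e_plus[of "[]" "u - v" v "[]"] e_single_inj[of "u - v" 0]
  by (simp add: degree_zero_def)

lemma e_Nil_nonzero: "e [] \<noteq> 0"
proof
  assume 0: "e [] = 0"
  have "(\<lambda>w. if w = [] then 1 else 0) \<in> \<Phi>"
    by (rule symI[OF multilinI]) auto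
  then have "e [] (\<lambda>w. if w = [] then 1 else 0) = 1" by (simp add: e_apply)
  then show False using 0 by (simp add: pointwise)
qed

end

section \<open>Shuffles\<close>

lemma shuffle_sum_Nil_right [simp]: "shuffle_sum M us [] = M us"
  by (cases us) auto

lemma shuffle_sum_zero [simp]: "shuffle_sum (\<lambda>_. 0) us vs = 0"
proof (induction "length us + length vs" arbitrary: us vs rule: less_induct)
  case less
  then show ?case by (cases us; cases vs) auto
qed

lemma shuffle_sum_add:
  "shuffle_sum (\<lambda>w. M w + N w) us vs = shuffle_sum M us vs + shuffle_sum N us vs"
proof (induction M us vs arbitrary: N rule: shuffle_sum.induct)
  case (3 M u us v vs)
  then show ?case
    using 3(1)[of "\<lambda>w. N (u # w)"] 3(2)[of "\<lambda>w. N (v # w)"] by (simp add: algebra_simps)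
qed auto

lemma shuffle_sum_cong:
  assumes "\<And>w. length w = length us + length vs \<Longrightarrow> M w = N w"
  shows "shuffle_sum M us vs = shuffle_sum N us vs"
  using assms
proof (induction M us vs arbitrary: N rule: shuffle_sum.induct)
  case (3 M u us v vs)
  have "shuffle_sum (\<lambda>w. M (u # w)) us (v # vs) = shuffle_sum (\<lambda>w. N (u # w)) us (v # vs)"
    by (rule 3(1)) (simp add: 3(3))
  moreover have "shuffle_sum (\<lambda>w. M (v # w)) (u # us) vs = shuffle_sum (\<lambda>w. N (v # w)) (u # us) vs"
    by (rule 3(2)) (simp add: 3(3))
  ultimately show ?case by simp
qed auto

text \<open>A linear functional may be moved out of a signed sum over shuffles; linearity is needed only on
  the subspace \<open>C\<close> that contains all the terms.\<close>

lemma shuffle_sum_functional: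
  fixes g :: "'v list \<Rightarrow> 'm \<Rightarrow> 'k::field"
  assumes C: "fsubspace C" and g: "\<And>w. length w = length us + length vs \<Longrightarrow> g w \<in> C"
    and l: "\<And>a b. a \<in> C \<Longrightarrow> b \<in> C \<Longrightarrow> l (a + b) = l a + l b" "\<And>c a. a \<in> C \<Longrightarrow> l (fscale c a) = c * l a"
  shows "(\<lambda>m. shuffle_sum (\<lambda>w. g w m) us vs) \<in> C \<and>
    shuffle_sum (\<lambda>w. l (g w)) us vs = l (\<lambda>m. shuffle_sum (\<lambda>w. g w m) us vs)"
  using g
proof (induction "\<lambda>w. l (g w)" us vs arbitrary: g rule: shuffle_sum.induct)
  case (3 u us v vs g)
  let ?a = "\<lambda>m. shuffle_sum (\<lambda>w. g (u # w) m) us (v # vs)"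
  let ?b = "\<lambda>m. shuffle_sum (\<lambda>w. g (v # w) m) (u # us) vs"
  have a: "?a \<in> C" "shuffle_sum (\<lambda>w. l (g (u # w))) us (v # vs) = l ?a"
    using 3(1)[of "\<lambda>w. g (u # w)"] 3(3) by simp_all
  have b: "?b \<in> C" "shuffle_sum (\<lambda>w. l (g (v # w))) (u # us) vs = l ?b"
    using 3(2)[of "\<lambda>w. g (v # w)"] 3(3) by simp_all
  let ?s = "ksign (int (length (u # us))) :: 'k"
  have eq: "(\<lambda>m. shuffle_sum (\<lambda>w. g w m) (u # us) (v # vs)) = ?a + fscale ?s ?b"
    by (rule ext) (simp add: pointwise)
  have sb: "fscale ?s ?b \<in> C" by (rule fs.subspace_scale[OF C b(1)])
  have "l (?a + fscale ?s ?b) = l ?a + ?s * l ?b"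
    using l(1)[OF a(1) sb] l(2)[OF b(1)] by simp
  then show ?case unfolding eq using fs.subspace_add[OF C a(1) sb] a(2) b(2) by simp
qed auto

abbreviation splits :: "('v list \<Rightarrow> 'v list \<Rightarrow> 'k::field) \<Rightarrow> 'v list \<Rightarrow> 'k"
  where "splits B w \<equiv> (\<Sum>i\<le>length w. B (take i w) (drop i w))"

lemma splits_Cons: "splits B (u # w) = B [] (u # w) + splits (\<lambda>a. B (u # a)) w"
  by (simp add: sum.atMost_Suc_shift del: sum.atMost_Suc)

text \<open>Deconcatenation is a morphism for the shuffle product: to cut a shuffle of \<open>us\<close> and \<open>vs\<close> is
  to cut both words and to shuffle the two pairs of pieces.  The sign arises from moving the last
  \<open>length us - i\<close> letters of \<open>us\<close> past the first \<open>j\<close> letters of \<open>vs\<close>.\<close>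

lemma shuffle_splits:
  fixes B :: "'v list \<Rightarrow> 'v list \<Rightarrow> 'k::field"
  shows "shuffle_sum (splits B) us vs = (\<Sum>i\<le>length us. \<Sum>j\<le>length vs.
     ksign ((int (length us) - int i) * int j) *
       shuffle_sum (\<lambda>a. shuffle_sum (B a) (drop i us) (drop j vs)) (take i us) (take j vs))"
proof (induction "length us + length vs" arbitrary: B us vs rule: less_induct)
  case (less us vs B)
  show ?case
  proof (cases "us = [] \<or> vs = []")
    case True
    then show ?thesis by auto
  next
    case False
    then obtain u us' v vs' where uv: "us = u # us'" "vs = v # vs'"
      by (meson list.exhaust)
    let ?p = "length us'" and ?q = "length vs'"
    let ?s = "ksign (int ?p + 1) :: 'k"
    \<comment> \<open>Each summand cuts a shuffle; grouped by the first piece being empty, or starting with \<open>u\<close>, or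
      starting with \<open>v\<close>.\<close>
    define F where "F i j = ksign ((int (length us) - int i) * int j) *
       shuffle_sum (\<lambda>a. shuffle_sum (B a) (drop i us) (drop j vs)) (take i us) (take j vs)" for i j
    define X where "X i j = ksign ((int ?p - int i) * int j) *
       shuffle_sum (\<lambda>a. shuffle_sum (B (u # a)) (drop i us') (drop j vs)) (take i us') (take j vs)" for i j
    define Y where "Y i j = ksign ((int (length us) - int i) * int j) *
       shuffle_sum (\<lambda>a. shuffle_sum (B (v # a)) (drop i us) (drop j vs')) (take i us) (take j vs')" for i j
    have split: "shuffle_sum (\<lambda>w. splits B (z # w)) as bs =
        shuffle_sum (\<lambda>w. B [] (z # w)) as bs + shuffle_sum (splits (\<lambda>a. B (z # a))) as bs" for z as bs
      unfolding splits_Cons shuffle_sum_add ..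
    have IH1: "shuffle_sum (splits (\<lambda>a. B (u # a))) us' vs = (\<Sum>i\<le>?p. \<Sum>j\<le>Suc ?q. X i j)"
      using less[of us' vs "\<lambda>a. B (u # a)"] uv unfolding X_def by simp
    have IH2: "shuffle_sum (splits (\<lambda>a. B (v # a))) us vs' = (\<Sum>i\<le>Suc ?p. \<Sum>j\<le>?q. Y i j)"
      using less[of us vs' "\<lambda>a. B (v # a)"] uv unfolding Y_def by simp
    have F00: "F 0 0 = shuffle_sum (B []) us vs" by (simp add: F_def)
    have F_0: "F (Suc i) 0 = X i 0" for i by (simp add: F_def X_def uv)
    have F0_: "F 0 (Suc j) = ?s * Y 0 j" for j
      by (auto simp: F_def Y_def uv ksign_def)
    have F_: "F (Suc i) (Suc j) = X i (Suc j) + ?s * Y (Suc i) j" if "i \<le> ?p" for i j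
    proof -
      have "ksign ((int ?p - int i) * (1 + int j)) * ksign (1 + int i) =
          (?s * ksign ((int ?p - int i) * int j) :: 'k)"
        by (auto simp: ksign_def)
      moreover have "F (Suc i) (Suc j) = ksign ((int ?p - int i) * (1 + int j)) *
          (shuffle_sum (\<lambda>a. shuffle_sum (B (u # a)) (drop i us') (drop (Suc j) vs)) (take i us') (take (Suc j) vs) +
           ksign (1 + int i) * shuffle_sum (\<lambda>a. shuffle_sum (B (v # a)) (drop i us') (drop j vs')) (take (Suc i) us) (take j vs'))"
        using that by (simp add: F_def uv min_def)
      ultimately show ?thesis
        by (simp add: X_def Y_def uv distrib_left[of "ksign _"] mult.assoc[symmetric])
    qed
    have "shuffle_sum (splits B) us vs =
        shuffle_sum (\<lambda>w. splits B (u # w)) us' vs + ?s * shuffle_sum (\<lambda>w. splits B (v # w)) us vs'"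
      unfolding uv shuffle_sum.simps by (simp add: add.commute)
    also have "\<dots> = shuffle_sum (B []) us vs + (\<Sum>i\<le>?p. \<Sum>j\<le>Suc ?q. X i j) +
        ?s * (\<Sum>i\<le>Suc ?p. \<Sum>j\<le>?q. Y i j)"
      unfolding split IH1 IH2 unfolding uv shuffle_sum.simps by (simp add: algebra_simps del: sum.atMost_Suc)
    also have "\<dots> = (\<Sum>i\<le>Suc ?p. \<Sum>j\<le>Suc ?q. F i j)"
      unfolding sum.atMost_Suc_shift F00 F_0 F0_
      by (simp add: F_ sum.distrib sum_distrib_left algebra_simps del: sum.atMost_Suc)
    finally show ?thesis unfolding F_def uv by simp
  qed
qed

section \<open>The cofree Lie coalgebra\<close>

context ground_space
begin

interpretation VV: vector_space sc by (rule vsp)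

text \<open>A space concentrated in one degree has the same multilinear forms whatever that degree is.\<close>

lemma multilin_shift: "multilin sc (shift 1 degree_zero) = multilin sc degree_zero"
proof -
  have plain: "multilin sc G = {M. \<forall>us vs x y c. M (us @ (x + y) # vs) = M (us @ x # vs) + M (us @ y # vs) \<and>
      M (us @ sc c x # vs) = c * M (us @ x # vs)}" if n: "G n = UNIV" for G :: "int \<Rightarrow> 'v set" and n
  proof -
    have H: "homs G = UNIV" using n by (auto simp: homs_def)
    show ?thesis unfolding multilin_def H
    proof (intro equalityI subsetI CollectI allI)
      fix M us vs x y c
      assume "M \<in> {M. \<forall>us vs n x y c. set us \<subseteq> UNIV \<longrightarrow> set vs \<subseteq> UNIV \<longrightarrow> x \<in> G n \<longrightarrow> y \<in> G n \<longrightarrow>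
         M (us @ (x + y) # vs) = M (us @ x # vs) + M (us @ y # vs) \<and> M (us @ sc c x # vs) = c * M (us @ x # vs)}"
      then show "M (us @ (x + y) # vs) = M (us @ x # vs) + M (us @ y # vs) \<and>
          M (us @ sc c x # vs) = c * M (us @ x # vs)"
        using n by blast
    qed blast
  qed
  show ?thesis
    using plain[of degree_zero 0] plain[of "shift 1 degree_zero" 1] by (simp add: degree_zero_def shift_def)
qed

abbreviation LF where "LF \<equiv> lie_forms sc"
abbreviation le where "le w \<equiv> ev (lie_forms sc) w"
abbreviation CL where "CL \<equiv> cofree_lie sc"

lemma LF_D:
  assumes "M \<in> LF"
  shows "M [] = 0" "us \<noteq> [] \<Longrightarrow> vs \<noteq> [] \<Longrightarrow> shuffle_sum M us vs = 0"
    "M (us @ (x + y) # vs) = M (us @ x # vs) + M (us @ y # vs)"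
    "M (us @ sc c x # vs) = c * M (us @ x # vs)"
  using assms multilinD[of M us vs x 0]
  by (simp_all add: lie_forms_def multilin_shift homs_UNIV degree_zero_def)

lemma LF_I:
  assumes "M [] = 0" "\<And>us vs. us \<noteq> [] \<Longrightarrow> vs \<noteq> [] \<Longrightarrow> shuffle_sum M us vs = 0"
    "\<And>us vs x y. M (us @ (x + y) # vs) = M (us @ x # vs) + M (us @ y # vs)"
    "\<And>us vs x c. M (us @ sc c x # vs) = c * M (us @ x # vs)"
  shows "M \<in> LF"
  unfolding lie_forms_def multilin_shift using assms by (auto intro: multilinI)

lemma le_add: "le (us @ (x + y) # vs) = le (us @ x # vs) + le (us @ y # vs)"
  by (rule ext) (auto simp: ev_def pointwise LF_D)

lemma le_scale: "le (us @ sc c x # vs) = fscale c (le (us @ x # vs))"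
  by (rule ext) (auto simp: ev_def pointwise LF_D)

lemma le_Nil: "le [] = 0"
  by (rule ext) (auto simp: ev_def pointwise LF_D)

lemma le_shuffle:
  assumes "us \<noteq> []" "vs \<noteq> []"
  shows "(\<lambda>m. shuffle_sum (\<lambda>w. le w m) us vs) = 0"
proof
  fix m
  show "shuffle_sum (\<lambda>w. le w m) us vs = 0 m"
    using LF_D(2)[OF _ assms] by (cases "m \<in> LF") (auto simp: ev_def pointwise)
qed

lemma CL_sub: "fsubspace (CL n)"
  unfolding cofree_lie_def by (rule fs.subspace_span)

lemma le_CL: "int (length w) = n \<Longrightarrow> le w \<in> CL n"
  unfolding cofree_lie_def by (rule fs.span_base) blast

lemma LF_truncate:
  assumes "M \<in> LF"
  shows "(\<lambda>w. if length w = l then M w else 0) \<in> LF"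
proof (rule LF_I)
  fix us vs :: "'v list" assume ne: "us \<noteq> []" "vs \<noteq> []"
  show "shuffle_sum (\<lambda>w. if length w = l then M w else 0) us vs = 0"
  proof (cases "length us + length vs = l")
    case True
    then have "shuffle_sum (\<lambda>w. if length w = l then M w else 0) us vs = shuffle_sum M us vs"
      by (intro shuffle_sum_cong) simp
    then show ?thesis using LF_D(2)[OF assms ne] by simp
  next
    case False
    then have "shuffle_sum (\<lambda>w. if length w = l then M w else 0) us vs = shuffle_sum (\<lambda>_. 0) us vs"
      by (intro shuffle_sum_cong) simp
    then show ?thesis by simp
  qed
qed (auto simp: LF_D[OF assms])

lemma weight_proj_le: "weight_proj LF l (le w) = (if length w = l then le w else 0)"
  unfolding weight_proj_def
proof (rule lift_ev)
  fix M assume M: "M \<in> LF"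
  have "(\<lambda>u. (if length u = l then le u else 0) M) = (\<lambda>w. if length w = l then M w else 0)"
    using M by (auto simp: ev_def pointwise)
  then show "(\<lambda>u. (if length u = l then le u else 0) M) \<in> LF" using LF_truncate[OF M] by simp
qed (auto simp: ev_def pointwise)

lemma weight_proj_CL:
  assumes "x \<in> CL n"
  shows "weight_proj LF l x = (if int l = n then x else 0)"
  using assms unfolding cofree_lie_def
  by (induction rule: fspan_induct) (auto simp: weight_proj_le weight_proj_add weight_proj_scale)

lemma CL_pos:
  assumes "x \<in> CL n" "n \<le> 0"
  shows "x = 0"
  by (rule fspan_eq[OF assms(1)[unfolded cofree_lie_def] lin_on_ops(4,5)]) (use assms(2) le_Nil in auto)

lemma CL_disj: "x \<in> CL m \<Longrightarrow> x \<in> CL n \<Longrightarrow> m \<noteq> n \<Longrightarrow> x = 0"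
proof (cases "m \<le> 0")
  case False
  assume x: "x \<in> CL m" "x \<in> CL n" "m \<noteq> n"
  then show ?thesis using weight_proj_CL[OF x(1), of "nat m"] weight_proj_CL[OF x(2), of "nat m"] False by simp
qed (rule CL_pos)

sublocale C: graded_space fscale "cofree_lie sc"
  by unfold_locales (auto simp: CL_sub intro: CL_disj vector_space_fscale)

abbreviation evC where "evC w \<equiv> ev (multilin fscale (cofree_lie sc)) w"
abbreviation CF where "CF \<equiv> multilin fscale (cofree_lie sc)"

lemma le_homs: "le w \<in> homs CL"
  by (rule C.G_homs[OF le_CL[OF refl]])

text \<open>The antisymmetrised pairing of the two parts of a word; the Lie cobracket is its sum over all
  deconcatenations, see \<open>cobracket_le\<close>.\<close>

definition cobr :: "(('v, 'k) words list \<Rightarrow> 'k) \<Rightarrow> 'v list \<Rightarrow> 'v list \<Rightarrow> 'k"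
  where "cobr M a b = M [le a, le b] - ksign (int (length a) * int (length b)) * M [le b, le a]"

lemma cobr_shuffle:
  assumes M: "M \<in> CF" and ne: "us \<noteq> []" "vs \<noteq> []"
  shows "shuffle_sum (\<lambda>a. cobr M a b) us vs = 0" "shuffle_sum (cobr M b) us vs = 0"
proof -
  let ?n = "int (length us + length vs)"
  let ?s = "ksign (?n * int (length b)) :: 'k"
  have z: "shuffle_sum (\<lambda>w. l (le w)) us vs = 0"
    if "\<And>a b. a \<in> CL ?n \<Longrightarrow> b \<in> CL ?n \<Longrightarrow> l (a + b) = l a + l b"
      "\<And>c a. a \<in> CL ?n \<Longrightarrow> l (fscale c a) = c * l a" for l
  proof -
    have "shuffle_sum (\<lambda>w. l (le w)) us vs = l (\<lambda>m. shuffle_sum (\<lambda>w. le w m) us vs)"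
      by (rule shuffle_sum_functional[OF CL_sub _ that, THEN conjunct2]) (auto intro: le_CL)
    also have "\<dots> = l (fscale 0 0)" unfolding le_shuffle[OF ne] by simp
    also have "\<dots> = 0" using that(2)[OF C.G_zero, of 0] by simp
    finally show ?thesis .
  qed
  note CF = C.multilin_pair(1-4)[OF M le_homs[of b]]
  have "shuffle_sum (\<lambda>a. cobr M a b) us vs =
      shuffle_sum (\<lambda>a. M [le a, le b] - ?s * M [le b, le a]) us vs"
    by (rule shuffle_sum_cong) (simp add: cobr_def)
  also have "\<dots> = 0"
    by (rule z[of "\<lambda>x. M [x, le b] - ?s * M [le b, x]"]) (simp_all add: CF algebra_simps)
  finally show "shuffle_sum (\<lambda>a. cobr M a b) us vs = 0" .
  have "shuffle_sum (cobr M b) us vs =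
      shuffle_sum (\<lambda>a. M [le b, le a] - ?s * M [le a, le b]) us vs"
    by (rule shuffle_sum_cong) (simp add: cobr_def mult.commute)
  also have "\<dots> = 0"
    by (rule z[of "\<lambda>x. M [le b, x] - ?s * M [x, le b]"]) (simp_all add: CF algebra_simps)
  finally show "shuffle_sum (cobr M b) us vs = 0" .
qed

lemma cobr_Nil:
  assumes "M \<in> CF"
  shows "cobr M [] b = 0" "cobr M b [] = 0"
  using C.multilin_pair(5,6)[OF assms le_homs[of b]] by (simp_all add: cobr_def le_Nil)

text \<open>The Lie cobracket is well defined.  When a shuffle product is cut, all terms contain a
  shuffle of nonempty pieces and vanish, except the two in which the cut separates \<open>us\<close> from
  \<open>vs\<close>.  These cancel by antisymmetry.\<close>

lemma cobr_form:
  assumes M: "M \<in> CF"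
  shows "splits (cobr M) \<in> LF"
proof (rule LF_I)
  show "splits (cobr M) [] = 0" using cobr_Nil[OF M] by simp
next
  fix us vs :: "'v list" assume ne: "us \<noteq> []" "vs \<noteq> []"
  let ?t = "\<lambda>i j. ksign ((int (length us) - int i) * int j) *
       shuffle_sum (\<lambda>a. shuffle_sum (cobr M a) (drop i us) (drop j vs)) (take i us) (take j vs)"
  let ?p = "length us" and ?q = "length vs"
  have t: "?t i j = (if i = ?p \<and> j = 0 then cobr M us vs
      else if i = 0 \<and> j = ?q then ksign (int ?p * int ?q) * cobr M vs us else 0)"
    if "i \<le> ?p" "j \<le> ?q" for i j
  proof -
    consider "i < ?p" "j < ?q" | "i = ?p" "j = 0" | "i = ?p" "j > 0" | "i = 0" "j = ?q" | "0 < i" "i < ?p" "j = ?q"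
      using \<open>i \<le> ?p\<close> \<open>j \<le> ?q\<close> by linarith
    then show ?thesis
    proof cases
      case 1
      then have "drop i us \<noteq> []" "drop j vs \<noteq> []" by auto
      then have "shuffle_sum (cobr M a) (drop i us) (drop j vs) = 0" for a
        by (rule cobr_shuffle(2)[OF M])
      then show ?thesis using 1 by simp
    next
      case 3
      then have "take j vs \<noteq> []" using ne by auto
      then show ?thesis using 3 ne cobr_shuffle(1)[OF M ne(1)] by simp
    next
      case 5
      then have "take i us \<noteq> []" using ne by auto
      then show ?thesis using 5 ne cobr_shuffle(1)[OF M _ ne(2)] by simp
    qed (use ne in auto)
  qed
  have pq: "?p \<noteq> 0" "?q \<noteq> 0" using ne by auto
  have "shuffle_sum (splits (cobr M)) us vs = (\<Sum>i\<le>?p. \<Sum>j\<le>?q. ?t i j)"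
    by (rule shuffle_splits)
  also have "\<dots> = (\<Sum>i\<le>?p. \<Sum>j\<le>?q. (if i = ?p then if j = 0 then cobr M us vs else 0 else 0) +
      (if i = 0 then if j = ?q then ksign (int ?p * int ?q) * cobr M vs us else 0 else 0))"
    by (intro sum.cong refl) (use t pq in auto)
  also have "\<dots> = cobr M us vs + ksign (int ?p * int ?q) * cobr M vs us"
    unfolding sum.distrib by (simp add: sum.If_cases)
  also have "\<dots> = 0"
    by (simp add: cobr_def algebra_simps)
  finally show "shuffle_sum (splits (cobr M)) us vs = 0" .
next
  have aux: "(\<Sum>i\<le>length (us @ z # vs). f i) = (\<Sum>i\<le>length us. f i) + (\<Sum>k\<le>length vs. f (Suc (length us + k)))"
    for us vs :: "'v list" and z and f :: "nat \<Rightarrow> 'k"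
  proof -
    have "{..length (us @ z # vs)} = {..length us} \<union> (\<lambda>k. Suc (length us + k)) ` {..length vs}"
    proof (intro equalityI subsetI)
      fix i assume "i \<in> {..length (us @ z # vs)}"
      then show "i \<in> {..length us} \<union> (\<lambda>k. Suc (length us + k)) ` {..length vs}"
        by (cases "i \<le> length us") (auto intro!: image_eqI[of _ _ "i - Suc (length us)"])
    qed auto
    then have "sum f {..length (us @ z # vs)} =
        sum f {..length us} + sum f ((\<lambda>k. Suc (length us + k)) ` {..length vs})"
      by (simp only:) (intro sum.union_disjoint, auto)
    also have "sum f ((\<lambda>k. Suc (length us + k)) ` {..length vs}) = (\<Sum>k\<le>length vs. f (Suc (length us + k)))"
      by (subst sum.reindex) (auto simp: inj_on_def)
    finally show ?thesis .
  qed
  have add: "cobr M a (us @ (x + y) # vs) = cobr M a (us @ x # vs) + cobr M a (us @ y # vs)"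
    "cobr M (us @ (x + y) # vs) a = cobr M (us @ x # vs) a + cobr M (us @ y # vs) a" for a us x y vs
    using C.multilin_pair(1,3)[OF M le_homs[of a] le_CL[of "us @ x # vs", OF refl] le_CL[of "us @ y # vs"]]
    by (simp_all add: cobr_def le_add algebra_simps)
  have scale: "cobr M a (us @ sc c x # vs) = c * cobr M a (us @ x # vs)"
    "cobr M (us @ sc c x # vs) a = c * cobr M (us @ x # vs) a" for a us c x vs
    using C.multilin_pair(2,4)[OF M le_homs[of a] le_CL[of "us @ x # vs", OF refl]]
    by (simp_all add: cobr_def le_scale algebra_simps)
  fix us vs :: "'v list" and x y :: 'v and c :: 'k
  have dr: "drop i (us @ z # vs) = drop i us @ z # vs" if "i \<in> {..length us}" for i z
    using that by simp
  have tk: "take i (us @ z # vs) = take i us" if "i \<in> {..length us}" for i z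
    using that by simp
  have eq: "splits (cobr M) (us @ z # vs) =
      (\<Sum>i\<le>length us. cobr M (take i us) (drop i us @ z # vs)) +
      (\<Sum>k\<le>length vs. cobr M (us @ z # take k vs) (drop k vs))" for z
    unfolding aux by (intro arg_cong2[of _ _ _ _ "(+)"] sum.cong) (auto simp: dr tk)
  show "splits (cobr M) (us @ (x + y) # vs) = splits (cobr M) (us @ x # vs) + splits (cobr M) (us @ y # vs)"
    unfolding eq add sum.distrib by simp
  show "splits (cobr M) (us @ sc c x # vs) = c * splits (cobr M) (us @ x # vs)"
    unfolding eq scale sum_distrib_left[symmetric] by (simp add: distrib_left)
qed

text \<open>The cuts into an empty and a full word contribute zero, so the sum may run over all cuts.\<close>

lemma cobracket_le:
  assumes M: "M \<in> CF"
  shows "cofree_cobracket sc (le w) M = splits (cobr M) w"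
proof -
  let ?f = "\<lambda>w. \<Sum>i \<in> {1..<length w}.
       let x = le (take i w); y = le (drop i w) in
       evC [x, y] - fscale (ksign (int i * int (length w - i))) (evC [y, x])"
  have "?f u M = splits (cobr M) u" for u
  proof -
    have sm: "(\<Sum>i\<in>I. g i) M = (\<Sum>i\<in>I. g i M)" for I :: "nat set" and g :: "nat \<Rightarrow> (_, 'k) words"
      by (induction I rule: infinite_finite_induct) (auto simp: pointwise)
    have "?f u M = (\<Sum>i\<in>{1..<length u}. cobr M (take i u) (drop i u))"
      unfolding sm by (intro sum.cong) (auto simp: cobr_def Let_def pointwise C.T.e_apply[OF M] min_def)
    also have "\<dots> = splits (cobr M) u"
      by (rule sum.mono_neutral_left) (auto simp: cobr_Nil[OF M] not_less le_Suc_eq Suc_le_eq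
          intro!: cobr_Nil[OF M] dest!: le_antisym)
    finally show ?thesis .
  qed
  then have "(\<lambda>u. ?f u M) = splits (cobr M)" by (intro ext)
  then have "le w (\<lambda>u. ?f u M) = splits (cobr M) w"
    using cobr_form[OF M] by (simp only: ev_def if_True)
  then show ?thesis
    unfolding cofree_cobracket_def lift_def using M by (simp only: if_True)
qed

end

context ground_space
begin

interpretation VV: vector_space sc by (rule vsp)

section \<open>Weights one and two\<close>

abbreviation iot :: "'v \<Rightarrow> ('v, 'k) words" where "iot v \<equiv> le [v]"

lemma iot_add: "iot (u + v) = iot u + iot v" and iot_scale: "iot (sc c u) = fscale c (iot u)"
  using le_add[of "[]" u v "[]"] le_scale[of "[]" c u "[]"] by simp_all

lemma iot_zero: "iot 0 = 0"
  using iot_scale[of 0 0] by simp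

lemma iot_CL: "iot v \<in> CL 1"
  by (rule le_CL) simp

lemma CL_1:
  assumes "x \<in> CL 1"
  obtains v where "x = iot v"
proof -
  have "fsubspace (range iot)"
    by (rule fs.subspaceI) (auto simp: iot_add[symmetric] iot_scale[symmetric] intro: range_eqI[where x = 0] simp: iot_zero)
  moreover have "{le w | w. int (length w) = 1} \<subseteq> range iot"
    by (auto simp: length_Suc_conv)
  ultimately have "CL 1 \<subseteq> range iot" unfolding cofree_lie_def by (intro fs.span_minimal)
  then show ?thesis using assms that by blast
qed

text \<open>A functional on \<open>V\<close> vanishes on shuffles of nonempty words when it is extended by zero to words
  of other lengths.\<close>

lemma iot_inj:
  assumes "iot u = iot v"
  shows "u = v"
proof -
  have "iot (u - v) = 0"
    using iot_add[of "u - v" v] assms by simp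
  moreover have "u - v = 0" if 0: "iot (u - v) = 0"
  proof (rule ccontr)
    assume "u - v \<noteq> 0"
    then obtain l where l: "\<And>a b. l (a + b) = l a + l b" "\<And>c a. l (sc c a) = c * l a" "l (u - v) = 1"
      using separating_functional[OF vsp VV.subspace_single_0, of "u - v"] by blast
    define M where "M w = (case w of [y] \<Rightarrow> l y | _ \<Rightarrow> 0)" for w
    have short: "M w = 0" if "length w \<noteq> 1" for w
      using that by (auto simp: M_def split: list.splits)
    have "M \<in> LF"
    proof (rule LF_I)
      show "M [] = 0" by (simp add: M_def)
      fix us vs :: "'v list"
      show "shuffle_sum M us vs = 0" if "us \<noteq> []" "vs \<noteq> []"
      proof -
        have "length us > 0" "length vs > 0" using that by auto
        then have "length us + length vs \<noteq> 1" by linarith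
        then have "shuffle_sum M us vs = shuffle_sum (\<lambda>_. 0) us vs"
          by (intro shuffle_sum_cong short) simp
        then show ?thesis by simp
      qed
      fix y z c
      show "M (us @ (y + z) # vs) = M (us @ y # vs) + M (us @ z # vs)"
        by (cases "us = [] \<and> vs = []") (auto simp: short, auto simp: M_def l)
      show "M (us @ sc c y # vs) = c * M (us @ y # vs)"
        by (cases "us = [] \<and> vs = []") (auto simp: short, auto simp: M_def l)
    qed
    then have "iot (u - v) M = 1" by (simp add: ev_def M_def l)
    then show False using 0 by (simp add: pointwise)
  qed
  ultimately show ?thesis by simp
qed

abbreviation Sym2 where "Sym2 \<equiv> fspan {e w | w. length w = 2}"

lemma Sym2_S: "x \<in> Sym2 \<Longrightarrow> x \<in> S"
  unfolding S_eq by (erule set_mp[OF fs.span_mono, rotated]) blast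

lemma Sym2_pairs: "{e w | w. length w = 2} = {e [v, w] | v w. True}"
proof -
  have "\<exists>a b. w = [a, b]" if "length w = 2" for w :: "'v list"
    using that by (cases w; cases "tl w") auto
  then show ?thesis by fastforce
qed

lemma Sym2_mem:
  assumes "x \<in> Sym2" "lin_on Sym2 f" "fsubspace W" "\<And>v w. f (e [v, w]) \<in> W"
  shows "f x \<in> W"
  by (rule fspan_mem[OF assms(1-3)]) (use assms(4) in \<open>auto simp: Sym2_pairs\<close>)

lemma weight_2_Sym2: "F \<in> S \<Longrightarrow> weight_proj \<Phi> 2 F \<in> Sym2"
  by (rule S_mem[OF _ lin_on_weight_proj fs.subspace_span])
    (auto simp: weight_proj_e intro: fs.span_base fs.span_zero)

lemma form_degree_zero:
  assumes M: "M \<in> multilin sc degree_zero" and swap: "\<And>us vs x y. M (us @ x # y # vs) = M (us @ y # x # vs)"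
  shows "M \<in> \<Phi>"
proof (rule symI[OF M])
  fix us vs :: "'v list" and m n :: int and x y :: 'v
  assume xy: "x \<in> degree_zero m" "y \<in> degree_zero n"
  show "M (us @ x # y # vs) = ksign (m * n) * M (us @ y # x # vs)"
  proof (cases "m = 0 \<or> n = 0")
    case True
    then show ?thesis using swap[of us x y vs] by auto
  next
    case False
    then have "x = 0" using xy by (simp add: degree_zero_def)
    moreover have "M (us @ sc 0 0 # vs) = 0" for us vs
      using multilinD(2)[OF M, of us vs 0 0 0] by (simp add: homs_UNIV degree_zero_def)
    ultimately have "M (us @ x # y # vs) = 0" by simp
    then show ?thesis using swap[of us x y vs] by simp
  qed
qed

text \<open>The signed shuffle of two letters \<open>x\<close>, \<open>y\<close> of degree \<open>1\<close> is \<open>x y - y x\<close>, so in length \<open>2\<close> a Lie form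
  is a symmetric bilinear form.  This is the identification of \<open>s\<^sup>2 Sym\<^sup>2(V)\<close> with the weight \<open>2\<close> part.\<close>

lemma LF_truncate_sym:
  assumes "M \<in> LF"
  shows "(\<lambda>w. if length w = 2 then M w else 0) \<in> \<Phi>"
proof (rule form_degree_zero)
  show "(\<lambda>w. if length w = 2 then M w else 0) \<in> multilin sc degree_zero"
    using LF_D(3,4)[OF assms] by (intro multilinI) simp_all
  fix us vs x y
  show "(if length (us @ x # y # vs) = 2 then M (us @ x # y # vs) else 0) =
      (if length (us @ y # x # vs) = 2 then M (us @ y # x # vs) else 0)"
    using LF_D(2)[OF assms, of "[x]" "[y]"] by (simp add: ksign_def)
qed

lemma susp2_e: "susp2 sc (e w) = (if length w = 2 then le w else 0)"
  unfolding susp2_def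
proof (rule lift_ev)
  fix M assume M: "M \<in> LF"
  have "(\<lambda>u. (if length u = 2 then le u else 0) M) = (\<lambda>w. if length w = 2 then M w else 0)"
    using M by (auto simp: ev_def pointwise)
  then show "(\<lambda>u. (if length u = 2 then le u else 0) M) \<in> \<Phi>" using LF_truncate_sym[OF M] by simp
qed (auto simp: ev_def pointwise)

lemma susp2_add: "susp2 sc (F + K) = susp2 sc F + susp2 sc K"
  and susp2_scale: "susp2 sc (fscale c F) = fscale c (susp2 sc F)"
  and susp2_zero: "susp2 sc 0 = 0"
  by (simp_all add: susp2_def lift_add lift_fscale)

lemma lin_on_susp2: "lin_on T (susp2 sc)"
  unfolding susp2_def by (rule lin_on_lift)

lemma susp2_apply: "susp2 sc (F + K) M = susp2 sc F M + susp2 sc K M"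
    "susp2 sc (fscale c F) M = c * susp2 sc F M" "susp2 sc 0 M = 0"
  unfolding susp2_add susp2_scale susp2_zero by (rule plus_fun_apply fscale_apply zero_fun_apply)+

lemma susp2_CL: "x \<in> Sym2 \<Longrightarrow> susp2 sc x \<in> CL 2"
  by (rule Sym2_mem[OF _ lin_on_susp2 CL_sub]) (auto simp: susp2_e intro: le_CL)

text \<open>Every symmetric bilinear form, extended by zero to words of other lengths, is a Lie form; these forms
  separate the elements of \<open>Sym\<^sup>2(V)\<close>.\<close>

lemma susp2_inj:
  assumes "x \<in> Sym2" "y \<in> Sym2" "susp2 sc x = susp2 sc y"
  shows "x = y"
proof
  fix N
  show "x N = y N"
  proof (cases "N \<in> \<Phi>")
    case True
    let ?N = "\<lambda>w. if length w = 2 then N w else 0"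
    have N_LF: "?N \<in> LF"
    proof (rule LF_I)
      fix us vs :: "'v list"
      show "shuffle_sum ?N us vs = 0" if ne: "us \<noteq> []" "vs \<noteq> []"
      proof (cases "length us + length vs = 2")
        case True
        then have "length us = 1" "length vs = 1" using ne by (cases us; cases vs; simp)+
        then obtain a b where ab: "us = [a]" "vs = [b]" by (cases us; cases vs) auto
        have "N ([] @ a # b # []) = ksign (0 * 0) * N ([] @ b # a # [])"
          by (rule symD[OF \<open>N \<in> \<Phi>\<close>]) (simp_all add: homs_UNIV degree_zero_def)
        then show ?thesis by (simp add: ab ksign_def)
      next
        case False
        then have "shuffle_sum ?N us vs = shuffle_sum (\<lambda>_. 0) us vs"
          by (intro shuffle_sum_cong) simp
        then show ?thesis by simp
      qed
      fix a b c
      show "?N (us @ (a + b) # vs) = ?N (us @ a # vs) + ?N (us @ b # vs)"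
        "?N (us @ sc c a # vs) = c * ?N (us @ a # vs)"
        using multilinD[OF sym_multilin[OF True], of us vs a 0]
        by (simp_all add: homs_UNIV degree_zero_def)
    qed simp
    have *: "susp2 sc z ?N = z N" if "z \<in> Sym2" for z
      using that
      unfolding Sym2_pairs
      by (induction rule: fspan_induct)
        (auto simp add: susp2_e susp2_apply zero_fun_apply[of N] plus_fun_apply[of _ _ N] fscale_apply[of _ _ N],
          simp add: ev_def True N_LF)
    show ?thesis using *[OF assms(1)] *[OF assms(2)] assms(3) by simp
  next
    case False
    then show ?thesis
      using S_off[OF Sym2_S[OF assms(1)]] S_off[OF Sym2_S[OF assms(2)]] by simp
  qed
qed

abbreviation cob where "cob \<equiv> cofree_cobracket sc"

lemma cob_add: "cob (x + y) = cob x + cob y" and cob_scale: "cob (fscale c x) = fscale c (cob x)"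
  and cob_zero: "cob 0 = 0"
  by (simp_all add: cofree_cobracket_def lift_add lift_fscale)

lemma lin_on_cob: "lin_on T cob"
  unfolding cofree_cobracket_def by (rule lin_on_lift)

lemma cob_apply: "cob (x + y) M = cob x M + cob y M" "cob (fscale c x) M = c * cob x M" "cob 0 M = 0"
  unfolding cob_add cob_scale cob_zero by (rule plus_fun_apply fscale_apply zero_fun_apply)+

lemma cob_off: "M \<notin> CF \<Longrightarrow> cob x M = 0"
  by (simp add: cofree_cobracket_def lift_def)

lemma cob_1:
  assumes "x \<in> CL 1"
  shows "cob x = 0"
proof -
  obtain v where v: "x = iot v" using CL_1[OF assms] .
  show ?thesis
  proof
    fix M
    show "cob x M = 0 M"
      using cob_off[of M x] cobracket_le[of M "[v]"] cobr_Nil[of M "[v]"]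
      by (cases "M \<in> CF") (simp_all add: v pointwise)
  qed
qed

lemma cob_pair:
  assumes "M \<in> CF"
  shows "cob (le [v, w]) M = M [iot v, iot w] + M [iot w, iot v]"
  using cobracket_le[OF assms, of "[v, w]"] cobr_Nil[OF assms, of "[v, w]"]
  by (simp add: cobr_def ksign_def numeral_2_eq_2)

lemma cob_pair': "cob (le [v, w]) = evC [iot v, iot w] + evC [iot w, iot v]"
  using cob_off cob_pair by (intro ext) (auto simp: pointwise ev_def)

text \<open>Testing with \<open>trunc n M\<close> extracts the component of total degree \<open>n\<close> of a tensor.\<close>

abbreviation trunc where
  "trunc n M \<equiv> two (\<lambda>a b. (if deg CL a + deg CL b = n then 1 else 0) * M [a, b])"

lemma trunc_word:
  assumes "M \<in> CF" "a \<in> CL p" "b \<in> CL q"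
  shows "trunc n M [a, b] = (if p + q = n then M [a, b] else 0)"
  using C.pair_value_id(1)[OF assms, where s = "\<lambda>p q. if p + q = n then 1 else 0"]
  by (simp only: list.case) simp

lemma trunc_form: "M \<in> CF \<Longrightarrow> trunc n M \<in> CF"
  by (rule C.pair_form(1)[OF _ C.graded_map_id C.graded_map_id, where s = "\<lambda>p q. if p + q = n then 1 else 0"])

lemma cob_degree:
  assumes M: "M \<in> CF" and x: "x \<in> CL n"
  shows "cob x (trunc n M) = cob x M"
  using x[unfolded cofree_lie_def]
proof (induction rule: fspan_induct)
  case (base b)
  then obtain w where w: "b = le w" "int (length w) = n" by blast
  have "cobr (trunc n M) (take i w) (drop i w) = cobr M (take i w) (drop i w)" if "i \<le> length w" for i
  proof -
    have le: "le (take i w) \<in> CL (int i)" "le (drop i w) \<in> CL (n - int i)"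
      using that w by (auto intro!: le_CL)
    show ?thesis unfolding cobr_def trunc_word[OF M le] trunc_word[OF M le(2,1)] by simp
  qed
  then show ?case unfolding w(1) cobracket_le[OF M] cobracket_le[OF trunc_form[OF M]] by simp
qed (simp_all add: cob_apply)

abbreviation cflip where "cflip M \<equiv> two (\<lambda>a b. ksign (deg CL a * deg CL b) * M [b, a])"

lemma cflip_word:
  assumes "M \<in> CF" "a \<in> CL p" "b \<in> CL q"
  shows "cflip M [a, b] = ksign (p * q) * M [b, a]"
  using C.pair_value_id(2)[OF assms, where s = "\<lambda>p q. ksign (p * q)"] by (simp only: list.case)

lemma cflip_form: "M \<in> CF \<Longrightarrow> cflip M \<in> CF"
  by (rule C.pair_form(2)[OF _ C.graded_map_id C.graded_map_id, where s = "\<lambda>p q. ksign (p * q)"])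

lemma cob_anti:
  assumes M: "M \<in> CF" and x: "x \<in> CL n"
  shows "cob x (cflip M) = - cob x M"
  using x[unfolded cofree_lie_def]
proof (induction rule: fspan_induct)
  case (base b)
  then obtain w where w: "b = le w" by blast
  have "cobr (cflip M) u v = - cobr M u v" for u v
    unfolding cobr_def cflip_word[OF M le_CL[OF refl] le_CL[OF refl]] by (simp add: mult.commute algebra_simps)
  then show ?case unfolding w cobracket_le[OF M] cobracket_le[OF cflip_form[OF M]]
    by (simp add: sum_negf)
qed (simp_all add: cob_apply)

end

section \<open>The Koszul dual Lie coalgebra\<close>

lemma conc_ev_zero: "conc \<Phi> (ev \<Phi> u) 0 = 0"
  by (auto simp: conc_apply ev_def pointwise fun_eq_iff)

lemma foldr_conc_words:
  assumes "conc_forms \<Psi> UNIV"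
  shows "foldr (conc \<Psi>) (map (\<lambda>x. ev \<Psi> [p x]) w) (ev \<Psi> []) = ev \<Psi> (map p w)"
proof -
  interpret q: conc_forms \<Psi> UNIV by fact
  show ?thesis by (induction w) (simp_all add: q.conc_ev)
qed

locale koszul_quadratic = ground_space sc for sc :: "'k::field_char_0 \<Rightarrow> 'v::ab_group_add \<Rightarrow> 'v" +
  fixes Q :: "('v, 'k) words set"
  assumes Q_sub: "fsubspace Q" and Q_Sym2: "Q \<subseteq> Sym2"
begin

interpretation VV: vector_space sc by (rule vsp)

abbreviation G where "G \<equiv> koszul_dual sc Q"

lemma G_sub: "fsubspace (G n)"
  unfolding koszul_dual_def by (rule fs.subspace_span)

lemma G_intro:
  assumes "graded_lie_subcoalgebra sc C" "C 2 \<subseteq> susp2 sc ` Q" "x \<in> C n"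
  shows "x \<in> G n"
  unfolding koszul_dual_def by (rule fs.span_base) (use assms in blast)

lemma G_CL: "G n \<subseteq> CL n"
  unfolding koszul_dual_def
  by (intro fs.span_minimal CL_sub) (auto simp: graded_lie_subcoalgebra_def)

lemma susp2_image_sub: "fsubspace (susp2 sc ` Q)"
  by (rule lin_on_image[OF lin_on_susp2 Q_sub])

lemma G_2_susp: "G 2 \<subseteq> susp2 sc ` Q"
  unfolding koszul_dual_def by (rule fs.span_minimal[OF _ susp2_image_sub]) blast

text \<open>The largest candidate concentrated in weights \<open>1\<close> and \<open>2\<close>.  It is a subcoalgebra because the
  cobracket of weight \<open>2\<close> takes values in \<open>sV \<otimes> sV\<close>; so the Koszul dual contains it.\<close>

definition low :: "int \<Rightarrow> ('v, 'k) words set"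
  where "low n = (if n = 1 then CL 1 else if n = 2 then susp2 sc ` Q else {0})"

lemma low_subcoalgebra: "graded_lie_subcoalgebra sc low"
  unfolding graded_lie_subcoalgebra_def
proof (intro allI conjI)
  fix n
  show "fsubspace (low n)"
    unfolding low_def using CL_sub susp2_image_sub fs.subspace_single_0 by simp
  show "low n \<subseteq> CL n"
    unfolding low_def using susp2_CL Q_Sym2 C.G_zero by auto
  have pair: "cob (susp2 sc x) \<in> tensor_square CL low" if "x \<in> Sym2" for x
  proof (rule Sym2_mem[OF that lin_on_comp[OF lin_on_cob lin_on_susp2]])
    have h: "iot u \<in> homs low" for u
      unfolding homs_def low_def using iot_CL by (intro UN_I[of 1]) auto
    have "susp2 sc (e [v, w]) = le [v, w]" for v w by (simp add: susp2_e)
    then show "cob (susp2 sc (e [v, w])) \<in> tensor_square CL low" for v w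
      unfolding tensor_square_def
      by (simp only: cob_pair') (intro fs.span_add fs.span_base; use h in blast)
  qed (simp add: tensor_square_def fs.subspace_span)
  have z: "0 \<in> tensor_square CL low" unfolding tensor_square_def by (rule fs.span_zero)
  show "cob ` low n \<subseteq> tensor_square CL low"
  proof
    fix y assume "y \<in> cob ` low n"
    then obtain x where x: "x \<in> low n" "y = cob x" by blast
    consider "n = 1" | "n = 2" | "n \<noteq> 1" "n \<noteq> 2" by blast
    then show "y \<in> tensor_square CL low"
    proof cases
      case 1
      then have "y = 0" using x cob_1 by (simp add: low_def)
      then show ?thesis using z by simp
    next
      case 2
      then obtain q where "q \<in> Q" "x = susp2 sc q" using x by (auto simp: low_def)
      then show ?thesis using pair[of q] Q_Sym2 x(2) by auto
    next
      case 3
      then have "y = 0" using x cob_zero by (simp add: low_def)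
      then show ?thesis using z by simp
    qed
  qed
qed

lemma G_1: "G 1 = CL 1"
  using G_intro[OF low_subcoalgebra] G_CL[of 1] by (auto simp: low_def)

lemma G_2: "G 2 = susp2 sc ` Q"
  using G_intro[OF low_subcoalgebra] G_2_susp by (auto simp: low_def)

lemma G_homs_CL: "x \<in> homs G \<Longrightarrow> x \<in> homs CL"
  unfolding homs_def using G_CL by blast

lemma G_cob:
  assumes "x \<in> G n"
  shows "cob x \<in> tensor_square CL G"
proof (rule fspan_mem[OF assms[unfolded koszul_dual_def[of sc Q n]] lin_on_cob])
  show "fsubspace (tensor_square CL G)" unfolding tensor_square_def by (rule fs.subspace_span)
  fix b assume "b \<in> \<Union>{C n | C. graded_lie_subcoalgebra sc C \<and> C 2 \<subseteq> susp2 sc ` Q}"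
  then obtain C where C: "graded_lie_subcoalgebra sc C" "C 2 \<subseteq> susp2 sc ` Q" "b \<in> C n" by blast
  have "homs C \<subseteq> homs G" unfolding homs_def using G_intro[OF C(1,2)] by blast
  then have "tensor_square CL C \<subseteq> tensor_square CL G"
    unfolding tensor_square_def by (intro fs.span_mono) blast
  then show "cob b \<in> tensor_square CL G" using C unfolding graded_lie_subcoalgebra_def by blast
qed

lemma G_disj: "x \<in> G m \<Longrightarrow> x \<in> G n \<Longrightarrow> m \<noteq> n \<Longrightarrow> x = 0"
  using CL_disj G_CL by blast

lemma G_pos: "n \<le> 0 \<Longrightarrow> x \<in> G n \<Longrightarrow> x = 0"
  using CL_pos G_CL by blast

sublocale GG: graded_space fscale "koszul_dual sc Q"
  by unfold_locales (auto simp: G_sub intro: G_disj vector_space_fscale)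

abbreviation GF where "GF \<equiv> multilin fscale (koszul_dual sc Q)"
abbreviation evG where "evG w \<equiv> ev (multilin fscale (koszul_dual sc Q)) w"

lemma CF_GF: "M \<in> CF \<Longrightarrow> M \<in> GF"
proof (rule GG.multilinI)
  assume M: "M \<in> CF"
  fix us vs :: "('v, 'k) words list" and n x y c
  assume H: "set us \<subseteq> homs G" "set vs \<subseteq> homs G"
  then have H': "set us \<subseteq> homs CL" "set vs \<subseteq> homs CL" using G_homs_CL by auto
  show "M (us @ (x + y) # vs) = M (us @ x # vs) + M (us @ y # vs)" if "x \<in> G n" "y \<in> G n"
    using C.multilinD(1)[OF M H', of x n y] that G_CL by auto
  show "M (us @ fscale c x # vs) = c * M (us @ x # vs)" if "x \<in> G n"
    using C.multilinD(2)[OF M H', of x n c] that G_CL by auto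
qed

text \<open>Retract every \<open>CL n\<close> onto \<open>G n\<close>.\<close>

lemma GF_extend:
  assumes M: "M \<in> GF"
  shows "\<exists>N\<in>CF. \<forall>w. set w \<subseteq> homs G \<longrightarrow> N w = M w"
proof -
  have "\<forall>n. \<exists>p. (\<forall>a b. p (a + b) = p a + p b) \<and> (\<forall>c a. p (fscale c a) = fscale c (p a)) \<and>
    (\<forall>a\<in>G n. p a = a) \<and> (\<forall>a. p a \<in> G n)"
    using linear_retraction[OF vector_space_fscale G_sub] by blast
  then obtain p where p: "\<And>n a b. p n (a + b) = p n a + p n b" "\<And>n c a. p n (fscale c a) = fscale c (p n a)"
    "\<And>n a. a \<in> G n \<Longrightarrow> p n a = a" "\<And>n a. p n a \<in> G n"
    using choice[of "\<lambda>n p. (\<forall>a b. p (a + b) = p a + p b) \<and> (\<forall>c a. p (fscale c a) = fscale c (p a)) \<and>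
    (\<forall>a\<in>G n. p a = a) \<and> (\<forall>a. p a \<in> G n)"] by metis
  \<comment> \<open>The degree of \<open>0\<close> is arbitrary, but every retraction maps \<open>0\<close> to \<open>0\<close>.\<close>
  define q where "q x = p (deg CL x) x" for x
  have p0: "p n 0 = 0" for n using p(2)[of n 0 0] by simp
  have q: "q x = p n x" if "x \<in> CL n" for x n
    using C.deg_eq[OF that] p0 by (cases "x = 0") (auto simp: q_def)
  have qH: "set (map q us) \<subseteq> homs G" for us
    using p(4) unfolding q_def homs_def by auto
  define N where "N w = M (map q w)" for w
  have "N \<in> CF"
  proof (rule C.multilinI)
    fix us vs :: "('v, 'k) words list" and n x y c
    show "N (us @ (x + y) # vs) = N (us @ x # vs) + N (us @ y # vs)" if xy: "x \<in> CL n" "y \<in> CL n"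
      using GG.multilinD(1)[OF M qH[of us] qH[of vs] p(4)[of n x] p(4)[of n y]] q[OF xy(1)] q[OF xy(2)]
        q[OF C.G_add[OF xy]] p(1) by (simp add: N_def)
    show "N (us @ fscale c x # vs) = c * N (us @ x # vs)" if x: "x \<in> CL n"
      using GG.multilinD(2)[OF M qH[of us] qH[of vs] p(4)[of n x], of c] q[OF x]
        q[OF C.G_scale[OF x]] p(2) by (simp add: N_def)
  qed
  moreover have "N w = M w" if "set w \<subseteq> homs G" for w
  proof -
    have "q x = x" if "x \<in> set w" for x
    proof -
      obtain n where "x \<in> G n" using \<open>x \<in> set w\<close> \<open>set w \<subseteq> homs G\<close> unfolding homs_def by blast
      then show ?thesis using q[of x n] p(3)[of x n] G_CL by auto
    qed
    then have "map q w = w" by (simp add: map_idI)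
    then show ?thesis by (simp add: N_def)
  qed
  ultimately show ?thesis by blast
qed

abbreviation TG where
  "TG n \<equiv> fspan {ev (multilin fscale (koszul_dual sc Q)) [a, b] | a b p q. a \<in> koszul_dual sc Q p \<and> b \<in> koszul_dual sc Q q \<and> p + q = n}"

lemma TG_tensor: "t \<in> TG n \<Longrightarrow> t \<in> tensor_square G G"
  unfolding tensor_square_def
  by (erule set_mp[OF fs.span_mono, rotated]) (use GG.G_homs in blast)

lemma tensor_S: "t \<in> tensor_square G G \<Longrightarrow> t \<in> GG.T.S"
  unfolding tensor_square_def
  by (erule set_mp[OF fs.span_mono, rotated]) (clarsimp, metis GG.T.e_in_S empty_set list.simps(15) empty_subsetI insert_subset)

text \<open>Tensors over \<open>G\<close> are functionals on forms on \<open>G\<close>, tensors over the cofree coalgebra are functionals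
  on fewer forms.  No information is lost since forms extend: \<open>G \<otimes> G\<close> embeds.\<close>

lemma tensor_unique:
  assumes s: "s \<in> tensor_square G G" and t: "t \<in> tensor_square G G"
    and eq: "\<And>M. M \<in> CF \<Longrightarrow> s M = t M"
  shows "s = t"
proof
  fix M
  show "s M = t M"
  proof (cases "M \<in> GF")
    case True
    then obtain N where N: "N \<in> CF" "\<And>w. set w \<subseteq> homs G \<Longrightarrow> N w = M w"
      using GF_extend by blast
    have "s M = s N" using GG.T.S_local[OF tensor_S[OF s] True N(2)] by simp
    also have "\<dots> = t N" by (rule eq[OF N(1)])
    also have "\<dots> = t M" by (rule GG.T.S_local[OF tensor_S[OF t] True N(2)])
    finally show ?thesis .
  next
    case False
    then show ?thesis
      using GG.T.S_off[OF tensor_S[OF s]] GG.T.S_off[OF tensor_S[OF t]] by simp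
  qed
qed

lemma pointwise_lift_subspace:
  assumes "fsubspace T"
  shows "fsubspace {s. \<exists>t\<in>T. \<forall>M\<in>X. t M = s (g M)}"
proof (rule fs.subspaceI)
  show "0 \<in> {s. \<exists>t\<in>T. \<forall>M\<in>X. t M = s (g M)}"
    using fs.subspace_0[OF assms] by (auto simp: pointwise intro!: bexI[of _ 0])
  fix s c assume "s \<in> {s. \<exists>t\<in>T. \<forall>M\<in>X. t M = s (g M)}"
  then obtain t where t: "t \<in> T" "\<forall>M\<in>X. t M = s (g M)" by blast
  then show "fscale c s \<in> {s. \<exists>t\<in>T. \<forall>M\<in>X. t M = s (g M)}"
    using fs.subspace_scale[OF assms t(1), of c] by (auto simp: fscale_apply intro!: bexI[of _ "fscale c t"])
  fix s' assume "s' \<in> {s. \<exists>t\<in>T. \<forall>M\<in>X. t M = s (g M)}"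
  then obtain t' where t': "t' \<in> T" "\<forall>M\<in>X. t' M = s' (g M)" by blast
  show "s + s' \<in> {s. \<exists>t\<in>T. \<forall>M\<in>X. t M = s (g M)}"
    using fs.subspace_add[OF assms t(1) t'(1)] t(2) t'(2) by (auto simp: pointwise intro!: bexI[of _ "t + t'"])
qed

text \<open>The cobracket of a homogeneous element is homogeneous; tensors of other total degree are
  cut off by \<open>trunc\<close>.\<close>

lemma tensor_restrict:
  assumes "s \<in> tensor_square CL G"
  shows "\<exists>t\<in>TG n. \<forall>M\<in>CF. t M = s (trunc n M)"
proof -
  have "s \<in> {s. \<exists>t\<in>TG n. \<forall>M\<in>CF. t M = s (trunc n M)}"
  proof (rule fspan_mem[OF assms[unfolded tensor_square_def] lin_on_ops(4) pointwise_lift_subspace[OF fs.subspace_span]])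
    fix s assume "s \<in> {evC [x, y] | x y. x \<in> homs G \<and> y \<in> homs G}"
    then obtain x y where s: "s = evC [x, y]" "x \<in> homs G" "y \<in> homs G" by blast
    then obtain p q where xy: "x \<in> G p" "y \<in> G q" unfolding homs_def by blast
    have xyC: "x \<in> CL p" "y \<in> CL q" using xy G_CL by auto
    have app: "s (trunc n M) = (if p + q = n then M [x, y] else 0)" if "M \<in> CF" for M
      unfolding s(1) C.T.e_apply[OF trunc_form[OF that]] trunc_word[OF that xyC] ..
    define t where "t = (if p + q = n then evG [x, y] else 0)"
    have "evG [x, y] \<in> TG n" if "p + q = n" by (rule fs.span_base) (use xy that in blast)
    then have "t \<in> TG n" by (simp add: t_def fs.span_zero)
    moreover have "t M = s (trunc n M)" if "M \<in> CF" for M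
      unfolding app[OF that] using GG.T.e_apply[OF CF_GF[OF that]] by (simp add: t_def zero_fun_apply[of M])
    ultimately show "s \<in> {s. \<exists>t\<in>TG n. \<forall>M\<in>CF. t M = s (trunc n M)}" by blast
  qed
  then show ?thesis by blast
qed

abbreviation del where "del \<equiv> sub_cobracket sc (koszul_dual sc Q)"

lemma del_eqI:
  assumes "t \<in> tensor_square G G" "\<And>M. M \<in> CF \<Longrightarrow> t M = cob x M"
  shows "del x = t"
  unfolding sub_cobracket_def
proof (rule the_equality)
  show "t \<in> tensor_square G G \<and> (\<forall>M\<in>CF. t M = cob x M)" using assms by blast
  fix s assume "s \<in> tensor_square G G \<and> (\<forall>M\<in>CF. s M = cob x M)"
  then show "s = t" using assms by (intro tensor_unique) auto
qed

lemma del_G: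
  assumes "x \<in> G n"
  shows "del x \<in> TG n" "M \<in> CF \<Longrightarrow> del x M = cob x M"
proof -
  obtain t where t: "t \<in> TG n" "\<forall>M\<in>CF. t M = cob x (trunc n M)"
    using tensor_restrict[OF G_cob[OF assms]] by blast
  have "t M = cob x M" if "M \<in> CF" for M
    using t(2) that cob_degree[OF that, of x n] assms G_CL by auto
  then have "del x = t" "\<And>M. M \<in> CF \<Longrightarrow> t M = cob x M" using del_eqI[OF TG_tensor[OF t(1)]] by auto
  then show "del x \<in> TG n" "M \<in> CF \<Longrightarrow> del x M = cob x M" using t(1) by auto
qed

lemma del_total:
  assumes "x \<in> total G"
  shows "del x \<in> tensor_square G G" "M \<in> CF \<Longrightarrow> del x M = cob x M"
proof -
  have sub: "fsubspace (tensor_square G G)" unfolding tensor_square_def by (rule fs.subspace_span)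
  have "cob x \<in> {s. \<exists>t\<in>tensor_square G G. \<forall>M\<in>CF. t M = s M}"
  proof (rule fspan_mem[OF assms[unfolded total_def] lin_on_cob pointwise_lift_subspace[OF sub]])
    fix x assume "x \<in> homs G"
    then obtain n where "x \<in> G n" unfolding homs_def by blast
    then show "cob x \<in> {s. \<exists>t\<in>tensor_square G G. \<forall>M\<in>CF. t M = s M}"
      using del_G(2)[of x n] TG_tensor[OF del_G(1)[of x n]] by blast
  qed
  then obtain t where t: "t \<in> tensor_square G G" "\<forall>M\<in>CF. t M = cob x M" by blast
  then have "del x = t" using del_eqI by blast
  then show "del x \<in> tensor_square G G" "M \<in> CF \<Longrightarrow> del x M = cob x M" using t by auto
qed

lemma del_add:
  assumes "x \<in> total G" "y \<in> total G"
  shows "del (x + y) = del x + del y"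
proof (rule del_eqI)
  show "del x + del y \<in> tensor_square G G"
    using del_total(1)[OF assms(1)] del_total(1)[OF assms(2)] unfolding tensor_square_def
    by (rule fs.span_add)
  show "(del x + del y) M = cob (x + y) M" if "M \<in> CF" for M
    unfolding plus_fun_apply[of _ _ M] del_total(2)[OF assms(1) that] del_total(2)[OF assms(2) that] cob_apply ..
qed

lemma del_scale:
  assumes "x \<in> total G"
  shows "del (fscale c x) = fscale c (del x)"
proof (rule del_eqI)
  show "fscale c (del x) \<in> tensor_square G G"
    using del_total(1)[OF assms(1)] unfolding tensor_square_def
    by (rule fs.span_scale)
  show "fscale c (del x) M = cob (fscale c x) M" if "M \<in> CF" for M
    unfolding fscale_apply[of _ _ M] del_total(2)[OF assms(1) that] cob_apply ..
qed

lemma lin_on_del: "lin_on (total G) del"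
  by (simp add: lin_on_def del_add del_scale)

lemma G_total: "x \<in> G n \<Longrightarrow> x \<in> total G"
  unfolding total_def by (rule fs.span_base) (rule GG.G_homs)

sublocale GC: graded_cobracket "koszul_dual sc Q" "sub_cobracket sc (koszul_dual sc Q)"
proof
  show "fsubspace (G n)" for n by (rule G_sub)
  show "x = 0" if "x \<in> G m" "x \<in> G n" "m \<noteq> n" for m n x using G_disj that by blast
  show "x = 0" if "n \<le> 0" "x \<in> G n" for n x using G_pos that by blast
  show "del (x + y) = del x + del y" if "x \<in> G n" "y \<in> G n" for n x y
    by (rule del_add[OF G_total[OF that(1)] G_total[OF that(2)]])
  show "del (fscale c x) = fscale c (del x)" if "x \<in> G n" for n x c
    by (rule del_scale[OF G_total[OF that]])
  show "del x \<in> TG n" if "x \<in> G n" for n x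
    by (rule del_G(1)[OF that])
  fix n x M assume x: "x \<in> G n" and M: "M \<in> GF"
  obtain N where N: "N \<in> CF" "\<And>w. set w \<subseteq> homs G \<Longrightarrow> N w = M w" using GF_extend[OF M] by blast
  have dS: "del x \<in> GG.T.S" by (rule tensor_S[OF TG_tensor[OF del_G(1)[OF x]]])
  have xC: "x \<in> CL n" using x G_CL by blast
  have "del x (two (\<lambda>a b. ksign (deg G a * deg G b) * M [b, a])) = del x (cflip N)"
  proof (rule GG.T.S_local[OF dS CF_GF[OF cflip_form[OF N(1)]]])
    fix w assume w: "set w \<subseteq> homs G"
    show "two (\<lambda>a b. ksign (deg G a * deg G b) * M [b, a]) w = cflip N w"
    proof (cases "length w = 2")
      case True
      then obtain a b where ab: "w = [a, b]" by (cases w; cases "tl w") auto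
      then obtain p q where pq: "a \<in> G p" "b \<in> G q" using w unfolding homs_def by auto
      then have C: "a \<in> CL p" "b \<in> CL q" using G_CL by auto
      have eq: "N [b, a] = M [b, a]" by (rule N(2)) (use w ab in auto)
      have "cflip N [a, b] = ksign (p * q) * M [b, a]" unfolding cflip_word[OF N(1) C] eq ..
      then show ?thesis
        unfolding ab using GG.pair_value_id(2)[OF M pq, where s = "\<lambda>p q. ksign (p * q)"] by (simp only: list.case)
    qed (simp add: two_other)
  qed
  also have "\<dots> = - cob x N"
    unfolding del_G(2)[OF x cflip_form[OF N(1)]] by (rule cob_anti[OF N(1) xC])
  also have "cob x N = del x N" using del_G(2)[OF x N(1)] by simp
  also have "del x N = del x M" by (rule GG.T.S_local[OF dS M N(2)])
  finally show "del x (two (\<lambda>a b. ksign (deg G a * deg G b) * M [b, a])) = - del x M" .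
qed

end

context koszul_quadratic
begin

interpretation VV: vector_space sc by (rule vsp)

section \<open>Degree zero of the cobar construction\<close>

lemma V_multilin:
  assumes "M \<in> \<Phi>"
  shows "M (us @ (x + y) # vs) = M (us @ x # vs) + M (us @ y # vs)"
    "M (us @ sc c x # vs) = c * M (us @ x # vs)"
    "M (us @ x # y # vs) = M (us @ y # x # vs)"
  using multilinD[OF sym_multilin[OF assms], of us vs x 0] symD[OF assms, of us vs x 0 y 0]
  by (simp_all add: homs_UNIV degree_zero_def)

lemma iot_shift: "iot v \<in> shift (- 1) G 0"
  unfolding GC.in_shift using iot_CL G_1 by simp

lemma iot_homs: "set (map iot w) \<subseteq> homs (shift (- 1) G)"
  using GC.G_homs[OF iot_shift] by auto

lemma iot_form:
  assumes M: "M \<in> GC.\<Phi>"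
  shows "(\<lambda>w. M (map iot w)) \<in> \<Phi>"
proof (rule form_degree_zero[OF multilinI])
  fix us vs :: "'v list" and x y :: 'v and c :: 'k
  note H = iot_homs[of us] iot_homs[of vs]
  note lin = GC.multilinD[OF GC.sym_multilin[OF M] H iot_shift]
  show "M (map iot (us @ (x + y) # vs)) = M (map iot (us @ x # vs)) + M (map iot (us @ y # vs))"
    using lin(1)[OF iot_shift, of x y] by (simp add: iot_add)
  show "M (map iot (us @ sc c x # vs)) = c * M (map iot (us @ x # vs))"
    using lin(2)[of c x] by (simp add: iot_scale)
  show "M (map iot (us @ x # y # vs)) = M (map iot (us @ y # x # vs))"
    using GC.symD[OF M H iot_shift iot_shift, of x y] by simp
qed

text \<open>The isomorphism from \<open>Sym(V)\<close> onto the degree \<open>0\<close> part of the cobar construction; it is onto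
  by \<open>J_onto\<close> and injective by \<open>J_inj\<close>.\<close>

definition J :: "('v, 'k) words \<Rightarrow> (('v, 'k) words, 'k) words"
  where "J = lift GC.\<Phi> (\<lambda>w. GC.e (map iot w))"

lemma lin_on_J: "lin_on T J"
  unfolding J_def by (rule lin_on_lift)

lemma J_add: "J (F + K) = J F + J K" and J_scale: "J (fscale c F) = fscale c (J F)"
  and J_zero: "J 0 = 0" and J_diff: "J (F - K) = J F - J K"
  by (simp_all add: J_def lift_add lift_fscale lift_diff)

lemma J_e: "J (e w) = GC.e (map iot w)"
  unfolding J_def
proof (rule lift_ev)
  fix M assume M: "M \<in> GC.\<Phi>"
  then show "(\<lambda>u. GC.e (map iot u) M) \<in> \<Phi>" using iot_form[OF M] by (simp add: GC.e_apply)
qed (simp add: ev_def)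

lemma iot_wdeg: "0 \<notin> set w \<Longrightarrow> GC.wdeg (map iot w) = 0"
proof (induction w)
  case (Cons v w)
  have "iot v \<noteq> 0" using iot_inj[of v 0] iot_zero Cons.prems by auto
  then have "GC.dg (iot v) = 0" by (rule GC.deg_eq[OF iot_shift])
  then show ?case using Cons by simp
qed simp

lemma J_e_SL: "J (e w) \<in> GC.SL 0 (length w)"
proof (cases "0 \<in> set w")
  case True
  then have "e w = 0" by (rule e_null) (simp add: homs_UNIV)
  then show ?thesis by (simp only: J_zero fs.span_zero)
next
  case False
  show ?thesis unfolding J_e
    by (rule GC.e_in_SL) (use iot_homs[of w] iot_wdeg[OF False] in simp_all)
qed

lemma J_Sn: "F \<in> S \<Longrightarrow> J F \<in> GC.Sn 0"
  by (rule S_mem[OF _ lin_on_J GC.Sn_sub]) (use GC.SL_Sn[OF J_e_SL] in auto)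

lemma J_weight: "F \<in> S \<Longrightarrow> weight_proj GC.\<Phi> l (J F) = J (weight_proj \<Phi> l F)"
  by (rule S_ext[OF _ lin_on_comp[OF lin_on_weight_proj lin_on_J] lin_on_comp[OF lin_on_J lin_on_weight_proj]])
    (use GC.weight_proj_SL[OF J_e_SL] in \<open>auto simp: weight_proj_e J_zero\<close>)

lemma J_conc:
  assumes "F \<in> S" "K \<in> S"
  shows "J (F \<cdot> K) = conc GC.\<Phi> (J F) (J K)"
proof (rule S_ext[OF assms(1) lin_on_comp[OF lin_on_J lin_on_conc]])
  show "lin_on S (\<lambda>F. conc GC.\<Phi> (J F) (J K))"
    by (simp add: lin_on_def J_add J_scale conc_add_left conc_scale_left)
  fix u
  have Ju: "J (e u) \<in> GC.S" by (rule GC.Sn_S[OF J_Sn[OF e_S]])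
  show "J (e u \<cdot> K) = conc GC.\<Phi> (J (e u)) (J K)"
  proof (rule S_ext[OF assms(2) lin_on_comp[OF lin_on_J lin_on_conc_right[OF e_S order.refl]]])
    show "lin_on S (\<lambda>K. conc GC.\<Phi> (J (e u)) (J K))"
      by (simp add: lin_on_def J_add J_scale GC.conc_add_right GC.conc_scale_right Ju GC.Sn_S[OF J_Sn])
    show "J (e u \<cdot> e v) = conc GC.\<Phi> (J (e u)) (J (e v))" for v
      unfolding conc_e J_e GC.conc_ev[OF iot_homs iot_homs] by simp
  qed
qed

lemma degree_nonneg:
  assumes "x \<in> homs (shift (- 1) G)" "x \<noteq> 0"
  shows "GC.dg x \<ge> 0"
proof (rule ccontr)
  assume "\<not> ?thesis"
  moreover have "x \<in> G (GC.dg x + 1)" using GC.deg_in[OF assms(1)] by (simp add: GC.in_shift)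
  ultimately show False using G_pos[of "GC.dg x + 1" x] assms(2) by simp
qed

lemma degree_zero_iot:
  assumes "x \<in> homs (shift (- 1) G)" "GC.dg x = 0"
  shows "\<exists>v. x = iot v"
proof -
  have "x \<in> CL 1" using GC.deg_in[OF assms(1)] assms(2) G_1 by (simp add: GC.in_shift)
  then show ?thesis using CL_1 by blast
qed

text \<open>Degrees of letters are nonnegative, so in a word of degree \<open>0\<close> all letters have degree \<open>0\<close>.\<close>

lemma sum_degrees_zero:
  assumes "set w \<subseteq> homs (shift (- 1) G)" "0 \<notin> set w" "GC.wdeg w = 0"
  shows "\<exists>u. w = map iot u"
  using assms
proof (induction w)
  case (Cons x w)
  have nn: "GC.wdeg w \<ge> 0"
    using Cons.prems degree_nonneg by (intro sum_list_nonneg) auto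
  have "GC.dg x \<ge> 0" using Cons.prems by (intro degree_nonneg) auto
  then have 0: "GC.dg x = 0" "GC.wdeg w = 0" using nn Cons.prems(3) by auto
  obtain v where "x = iot v" using degree_zero_iot[of x] Cons.prems 0 by auto
  moreover obtain u where "w = map iot u" using Cons.IH Cons.prems 0 by auto
  ultimately have "x # w = map iot (v # u)" by simp
  then show ?case by (rule exI[of _ "v # u"])
qed simp

lemma J_onto:
  assumes "z \<in> GC.Sn 0"
  obtains F where "F \<in> S" "z = J F"
proof -
  have "z \<in> J ` S"
  proof (rule GC.Sn_mem[OF assms lin_on_ops(4) lin_on_image[OF lin_on_J fs.subspace_span]])
    fix w assume w: "set w \<subseteq> homs (shift (- 1) G)" "GC.wdeg w = 0"
    show "GC.e w \<in> J ` S"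
    proof (cases "0 \<in> set w")
      case True
      then have "GC.e w = J 0" using GC.e_null[OF _ w(1)] J_zero by simp
      then show ?thesis by (simp only: image_eqI[OF refl fs.span_zero])
    next
      case False
      obtain u where "w = map iot u" using sum_degrees_zero[OF w(1) False w(2)] by blast
      then show ?thesis by (intro image_eqI[of _ _ "e u"]) (simp_all only: J_e e_S)
    qed
  qed
  then show ?thesis using that by blast
qed

section \<open>The quadratic differential in weight two\<close>

lemma J_forms:
  assumes N: "N \<in> CF" "\<And>v w. N [iot v, iot w] = - M [iot v, iot w]" and M: "M \<in> GC.\<Phi>" and x: "x \<in> Sym2"
  shows "cob (susp2 sc x) N = - 2 * J x M"
  using x unfolding Sym2_pairs
proof (induction rule: fspan_induct)
  case zero
  show ?case unfolding susp2_zero cob_apply J_zero by (simp add: zero_fun_apply[of M])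
next
  case (base b)
  then obtain v w where b: "b = e [v, w]" by blast
  have "susp2 sc (e [v, w]) = le [v, w]" by (simp add: susp2_e)
  moreover have "M [iot w, iot v] = M [iot v, iot w]"
    using GC.symD[OF M _ _ iot_shift iot_shift, of "[]" "[]" w v] by simp
  ultimately show ?case using cob_pair[OF N(1), of v w] by (simp add: b N(2) J_e GC.e_apply[OF M])
next
  case (add F K)
  show ?case unfolding susp2_add cob_apply J_add plus_fun_apply[of _ _ M] add(3,4)
    by (simp add: algebra_simps)
next
  case (scale c F)
  show ?case unfolding susp2_scale cob_apply J_scale fscale_apply[of _ _ M] scale(2)
    by (simp add: algebra_simps)
qed

text \<open>The two factors \<open>2\<close> cancel: \<open>s\<^sup>2(v w)\<close> has the cobracket \<open>sv \<otimes> sw + sw \<otimes> sv\<close>, and \<open>d\<^sub>2\<close> carries the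
  coefficient \<open>- 1 / 2\<close>.  The sign of \<open>\<mu>\<close> for a first factor of degree \<open>1\<close> makes the result positive.\<close>

lemma d2_susp2:
  assumes x: "x \<in> Q"
  shows "cobar_d2 G del (susp2 sc x) = J x"
proof
  fix M
  have xG: "susp2 sc x \<in> G 2" using G_2 x by blast
  have T: "del (susp2 sc x) \<in> TG 2" by (rule del_G(1)[OF xG])
  show "cobar_d2 G del (susp2 sc x) M = J x M"
  proof (cases "M \<in> GC.\<Phi>")
    case True
    let ?B = "two (\<lambda>x y. ksign (deg G x) * M [x, y])"
    have B: "?B \<in> GF" by (rule GC.mu_form[OF True])
    then obtain N where N: "N \<in> CF" "\<And>w. set w \<subseteq> homs G \<Longrightarrow> N w = ?B w" using GF_extend by blast
    have "N [iot v, iot w] = - M [iot v, iot w]" for v w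
    proof -
      have i: "iot u \<in> G 1" for u using iot_CL G_1 by simp
      have h: "iot u \<in> homs G" for u using i by (rule GG.G_homs)
      have "N [iot v, iot w] = ksign (deg G (iot v)) * M [iot v, iot w]"
        using N(2)[of "[iot v, iot w]"] h by simp
      also have "\<dots> = ksign 1 * M [iot v, iot w]"
        by (rule GG.pair_value_id(1)[OF GC.sym_multilin_G[OF True] i i, where s = "\<lambda>p _. ksign p"])
      finally show ?thesis by (simp add: ksign_def)
    qed
    then have "cob (susp2 sc x) N = - 2 * J x M"
      by (rule J_forms[OF N(1) _ True]) (use x Q_Sym2 in blast)
    moreover have "cob (susp2 sc x) N = del (susp2 sc x) N"
      using del_G(2)[OF xG N(1)] by simp
    moreover have "del (susp2 sc x) N = del (susp2 sc x) ?B"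
      by (rule GG.T.S_local[OF tensor_S[OF TG_tensor[OF T]] B N(2)])
    moreover have "GC.mu (del (susp2 sc x)) M = del (susp2 sc x) ?B"
      by (rule GC.mu_apply[OF T True])
    ultimately show ?thesis
      unfolding GC.cobar_d2_mu fscale_apply[of _ _ M] by simp
  next
    case False
    then have "GC.mu (del (susp2 sc x)) M = 0" "J x M = 0"
      by (simp_all add: GC.mu_def J_def lift_def)
    then show ?thesis unfolding GC.cobar_d2_mu fscale_apply[of _ _ M] by simp
  qed
qed

section \<open>The comparison map\<close>

text \<open>The projection of the Koszul dual onto \<open>sV\<close>, followed by desuspension.\<close>

definition pV :: "('v, 'k) words \<Rightarrow> 'v"
  where "pV x = (THE v. iot v = weight_proj LF 1 x)"

lemma pV_iot [simp]: "pV (iot v) = v"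
  unfolding pV_def
proof (rule the_equality)
  show *: "iot v = weight_proj LF 1 (iot v)" using weight_proj_CL[OF iot_CL, of 1 v] by simp
  show "u = v" if "iot u = weight_proj LF 1 (iot v)" for u
    using that * iot_inj by simp
qed

lemma pV_other:
  assumes "x \<in> CL n" "n \<noteq> 1"
  shows "pV x = 0"
  unfolding pV_def
proof (rule the_equality)
  have *: "weight_proj LF 1 x = 0" using weight_proj_CL[OF assms(1), of 1] assms(2) by simp
  show "iot 0 = weight_proj LF 1 x" using * iot_zero by simp
  show "u = 0" if "iot u = weight_proj LF 1 x" for u
    using that * iot_inj[of u 0] iot_zero by simp
qed

lemma pV_linear:
  assumes "x \<in> CL n"
  shows "y \<in> CL n \<Longrightarrow> pV (x + y) = pV x + pV y" "pV (fscale c x) = sc c (pV x)"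
proof -
  show "pV (x + y) = pV x + pV y" if y: "y \<in> CL n"
  proof (cases "n = 1")
    case True
    obtain u v where "x = iot u" "y = iot v" using CL_1 assms y True by metis
    then show ?thesis by (simp add: iot_add[symmetric])
  next
    case False
    then show ?thesis using pV_other[OF assms] pV_other[OF y] pV_other[OF C.G_add[OF assms y]] by simp
  qed
  show "pV (fscale c x) = sc c (pV x)"
  proof (cases "n = 1")
    case True
    obtain u where "x = iot u" using CL_1 assms True by metis
    then show ?thesis by (simp add: iot_scale[symmetric])
  next
    case False
    then show ?thesis using pV_other[OF assms] pV_other[OF C.G_scale[OF assms]] by simp
  qed
qed

lemma V_null:
  assumes "M \<in> \<Phi>"
  shows "M (us @ 0 # vs) = 0"
  using V_multilin(2)[OF assms, of us 0 0 vs] by simp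

lemma pV_form:
  assumes M: "M \<in> \<Phi>"
  shows "(\<lambda>u. M (map pV u)) \<in> GC.\<Phi>"
proof (rule GC.symI[OF GC.multilinI])
  fix us vs :: "('v, 'k) words list" and m n x y c
  have CL: "z \<in> CL (i + 1)" if "z \<in> shift (- 1) G i" for z i
    using that G_CL by (auto simp: GC.in_shift)
  show "M (map pV (us @ (x + y) # vs)) = M (map pV (us @ x # vs)) + M (map pV (us @ y # vs))"
    if "x \<in> shift (- 1) G n" "y \<in> shift (- 1) G n"
    using V_multilin(1)[OF M, of "map pV us" "pV x" "pV y" "map pV vs"]
      pV_linear(1)[OF CL[OF that(1)] CL[OF that(2)]] by simp
  show "M (map pV (us @ fscale c x # vs)) = c * M (map pV (us @ x # vs))"
    if "x \<in> shift (- 1) G n"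
    using V_multilin(2)[OF M, of "map pV us" c "pV x" "map pV vs"]
      pV_linear(2)[OF CL[OF that(1)], of c] by simp
  show "M (map pV (us @ x # y # vs)) = ksign (m * n) * M (map pV (us @ y # x # vs))"
    if xy: "x \<in> shift (- 1) G m" "y \<in> shift (- 1) G n"
  proof (cases "m = 0 \<and> n = 0")
    case True
    then show ?thesis
      using V_multilin(3)[OF M, of "map pV us" "pV x" "pV y" "map pV vs"] by simp
  next
    case False
    then have "pV x = 0 \<or> pV y = 0"
      using pV_other[OF CL[OF xy(1)]] pV_other[OF CL[OF xy(2)]] by auto
    then show ?thesis
      using V_null[OF M, of "map pV us" "pV y # map pV vs"] V_null[OF M, of "map pV us" "pV x # map pV vs"]
        V_null[OF M, of "map pV us @ [pV x]" "map pV vs"] V_null[OF M, of "map pV us @ [pV y]" "map pV vs"]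
      by auto
  qed
qed

lemma g_kappa_linear: "g_kappa sc P (F + K) = g_kappa sc P F + g_kappa sc P K"
  "g_kappa sc P (fscale c F) = fscale c (g_kappa sc P F)" "g_kappa sc P 0 = 0"
  "g_kappa sc P (F - K) = g_kappa sc P F - g_kappa sc P K"
  by (simp_all add: g_kappa_def alg_extend_def lift_add lift_fscale lift_diff)

lemma lin_on_g_kappa: "lin_on T (g_kappa sc P)"
  unfolding g_kappa_def alg_extend_def by (rule lin_on_lift)

text \<open>The map \<open>kappa\<close> factors through \<open>pV\<close>, and in the quotient algebra products of letters are words.\<close>

lemma g_kappa_e:
  assumes P: "P \<subseteq> S"
  shows "g_kappa sc P (GC.e w) = proj P (e (map pV w))"
proof -
  let ?q = "quot_forms sc P"
  have k: "kappa sc P = (\<lambda>x. ev ?q [pV x])" by (simp add: kappa_def pV_def fun_eq_iff)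
  have f: "foldr (conc ?q) (map (kappa sc P) u) (ev ?q []) = ev ?q (map pV u)" for u
    unfolding k by (rule foldr_conc_words[OF quot_conc_forms[OF P]])
  have "lift ?q (\<lambda>u. ev ?q (map pV u)) (GC.e w) = ev ?q (map pV w)"
  proof (rule lift_ev)
    fix M assume "M \<in> ?q"
    then show "(\<lambda>u. ev ?q (map pV u) M) \<in> GC.\<Phi>"
      using pV_form[OF quot_forms_sym] by (simp add: ev_def)
  qed (simp add: ev_def)
  then show ?thesis unfolding g_kappa_def alg_extend_def f proj_e .
qed

lemma g_kappa_J:
  assumes P: "P \<subseteq> S" and F: "F \<in> S"
  shows "g_kappa sc P (J F) = proj P F"
proof (rule S_ext[OF F lin_on_comp[OF lin_on_g_kappa lin_on_J] lin_on_proj])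
  fix w
  have "map pV (map iot w) = w" by (simp add: map_idI)
  then show "g_kappa sc P (J (e w)) = proj P (e w)" unfolding J_e g_kappa_e[OF P] by simp
qed

lemma g_kappa_other:
  assumes P: "P \<subseteq> S" and F: "F \<in> GC.Sn n" and n: "n \<noteq> 0"
  shows "g_kappa sc P F = 0"
proof (rule GC.Sn_eq[OF F lin_on_g_kappa lin_on_ops(5)])
  fix w assume w: "set w \<subseteq> homs (shift (- 1) G)" "GC.wdeg w = n"
  have "\<exists>x\<in>set w. GC.dg x \<noteq> 0"
  proof (rule ccontr)
    assume "\<not> ?thesis"
    then have "GC.wdeg w = 0" by (induction w) auto
    then show False using w(2) n by simp
  qed
  then obtain x where x: "x \<in> set w" "GC.dg x \<noteq> 0" by blast
  have "x \<in> shift (- 1) G (GC.dg x)" using x w(1) by (intro GC.deg_in) blast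
  then have "x \<in> CL (GC.dg x + 1)" using G_CL by (auto simp: GC.in_shift)
  then have "pV x = 0" using x(2) by (intro pV_other) auto
  then have "0 \<in> set (map pV w)" using x(1) by force
  then have "e (map pV w) = 0" by (rule e_null) (simp add: homs_UNIV)
  then show "g_kappa sc P (GC.e w) = 0" unfolding g_kappa_e[OF P] by (simp add: proj_linear)
qed

text \<open>For the empty set of relations the comparison map is a left inverse of \<open>J\<close>.\<close>

lemma J_inj:
  assumes "F \<in> S" "J F = 0"
  shows "F = 0"
proof -
  have "proj {} F = 0"
    using g_kappa_J[of "{}" F] assms by (simp add: g_kappa_linear)
  then have "F \<in> ideal sc {}" using assms by (intro proj_kernel) auto
  then show ?thesis by (simp add: ideal_def)
qed

end

section \<open>Homology\<close>

lemma boundaries_sub: "chain_complex C d \<Longrightarrow> fsubspace (boundaries C d n)"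
  unfolding boundaries_def by (rule lin_on_image) (simp_all add: chain_complex_def)

lemma coset_eq:
  assumes "fsubspace B"
  shows "{x + b | b. b \<in> B} = {y + b | b. b \<in> B} \<longleftrightarrow> x - y \<in> B"
proof
  assume "{x + b | b. b \<in> B} = {y + b | b. b \<in> B}"
  moreover have "x \<in> {x + b | b. b \<in> B}" using fs.subspace_0[OF assms] by force
  ultimately obtain b where "x = y + b" "b \<in> B" by blast
  then show "x - y \<in> B" by simp
next
  have sub: "{x + b | b. b \<in> B} \<subseteq> {y + b | b. b \<in> B}" if "x - y \<in> B" for x y
  proof
    fix z assume "z \<in> {x + b | b. b \<in> B}"
    then obtain b where b: "z = x + b" "b \<in> B" by blast
    then have "z = y + ((x - y) + b)" by simp
    then show "z \<in> {y + b | b. b \<in> B}" using fs.subspace_add[OF assms that b(2)] by blast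
  qed
  assume xy: "x - y \<in> B"
  moreover have "y - x \<in> B" using fs.subspace_neg[OF assms xy] by simp
  ultimately show "{x + b | b. b \<in> B} = {y + b | b. b \<in> B}" using sub by (intro equalityI) simp_all
qed

lemma homology_map_coset:
  assumes C: "chain_complex C d" and C': "chain_complex C' d'" and f: "chain_map C d C' d' f"
    and x: "x \<in> cycles C d n"
  shows "homology_map C' d' f n {x + b | b. b \<in> boundaries C d n} = {f x + b | b. b \<in> boundaries C' d' n}"
proof -
  have sub: "boundaries C d n \<subseteq> C n"
    using C unfolding chain_complex_def boundaries_def by fastforce
  have fb: "f b \<in> boundaries C' d' n" if b: "b \<in> boundaries C d n" for b
  proof -
    obtain a where "a \<in> C (n + 1)" "b = d a" using b unfolding boundaries_def by blast
    then show ?thesis using f unfolding chain_map_def boundaries_def by blast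
  qed
  have add: "f (x + b) = f x + f b" if "b \<in> boundaries C d n" for b
    using f x sub that unfolding chain_map_def lin_on_def cycles_def by blast
  have B': "fsubspace (boundaries C' d' n)" by (rule boundaries_sub[OF C'])
  show ?thesis
  proof (intro equalityI subsetI)
    fix y assume "y \<in> homology_map C' d' f n {x + b | b. b \<in> boundaries C d n}"
    then obtain b b' where b: "b \<in> boundaries C d n" "b' \<in> boundaries C' d' n" "y = f (x + b) + b'"
      unfolding homology_map_def by blast
    then have "y = f x + (f b + b')" using add by simp
    then show "y \<in> {f x + b | b. b \<in> boundaries C' d' n}"
      using fs.subspace_add[OF B' fb[OF b(1)] b(2)] by blast
  next
    fix y assume "y \<in> {f x + b | b. b \<in> boundaries C' d' n}"
    then obtain b' where b': "b' \<in> boundaries C' d' n" "y = f x + b'" by blast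
    have "x \<in> {x + b | b. b \<in> boundaries C d n}"
      using fs.subspace_0[OF boundaries_sub[OF C]] by force
    then show "y \<in> homology_map C' d' f n {x + b | b. b \<in> boundaries C d n}"
      unfolding homology_map_def using b' by blast
  qed
qed

text \<open>Homology classes are cosets, so bijectivity is a statement on representatives modulo
  boundaries.\<close>

lemma bij_homologyI:
  assumes C: "chain_complex C d" and C': "chain_complex C' d'" and f: "chain_map C d C' d' f"
    and inj: "\<And>x. x \<in> cycles C d n \<Longrightarrow> f x \<in> boundaries C' d' n \<Longrightarrow> x \<in> boundaries C d n"
    and surj: "\<And>y. y \<in> cycles C' d' n \<Longrightarrow> \<exists>x\<in>cycles C d n. y - f x \<in> boundaries C' d' n"
  shows "bij_betw (homology_map C' d' f n) (homology C d n) (homology C' d' n)"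
proof (rule bij_betwI')
  note map = homology_map_coset[OF C C' f] and B = boundaries_sub[OF C] and B' = boundaries_sub[OF C']
  have fx: "f x \<in> cycles C' d' n" if "x \<in> cycles C d n" for x
  proof -
    have x: "x \<in> C n" "d x = 0" using that by (auto simp: cycles_def)
    have 0: "0 \<in> C n" using C fs.subspace_0 unfolding chain_complex_def by blast
    have "f (fscale 0 0) = fscale 0 (f 0)" using f 0 unfolding chain_map_def lin_on_def by blast
    then have "f 0 = 0" by simp
    then show ?thesis using f x unfolding chain_map_def cycles_def by fastforce
  qed
  fix X Y assume X: "X \<in> homology C d n"
  then obtain x where x: "x \<in> cycles C d n" "X = {x + b | b. b \<in> boundaries C d n}"
    unfolding homology_def by blast
  show "homology_map C' d' f n X \<in> homology C' d' n"
    unfolding x(2) map[OF x(1)] homology_def using fx[OF x(1)] by blast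
  assume Y: "Y \<in> homology C d n"
  then obtain y where y: "y \<in> cycles C d n" "Y = {y + b | b. b \<in> boundaries C d n}"
    unfolding homology_def by blast
  have xy: "x - y \<in> cycles C d n"
  proof -
    have "x \<in> C n" "y \<in> C n" "d x = 0" "d y = 0" using x y by (auto simp: cycles_def)
    moreover have sub: "fsubspace (C n)" and "lin_on (C n) d" using C by (auto simp: chain_complex_def)
    moreover have "x - y \<in> C n" using fs.subspace_diff[OF sub] \<open>x \<in> C n\<close> \<open>y \<in> C n\<close> by blast
    moreover from this \<open>y \<in> C n\<close> \<open>lin_on (C n) d\<close> have "d ((x - y) + y) = d (x - y) + d y"
      unfolding lin_on_def by blast
    ultimately show ?thesis by (simp add: cycles_def)
  qed
  have "f ((x - y) + y) = f (x - y) + f y"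
    using f xy y unfolding chain_map_def lin_on_def cycles_def by blast
  then have diff: "f x - f y = f (x - y)" by simp
  show "(homology_map C' d' f n X = homology_map C' d' f n Y) = (X = Y)"
  proof
    assume "homology_map C' d' f n X = homology_map C' d' f n Y"
    then have "f x - f y \<in> boundaries C' d' n"
      unfolding x(2) y(2) map[OF x(1)] map[OF y(1)] coset_eq[OF B'] .
    then have "x - y \<in> boundaries C d n" using inj[OF xy] diff by simp
    then show "X = Y" unfolding x(2) y(2) coset_eq[OF B] .
  qed simp
next
  fix Z assume "Z \<in> homology C' d' n"
  then obtain z where z: "z \<in> cycles C' d' n" "Z = {z + b | b. b \<in> boundaries C' d' n}"
    unfolding homology_def by blast
  obtain x where x: "x \<in> cycles C d n" "z - f x \<in> boundaries C' d' n" using surj[OF z(1)] by blast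
  have "Z = homology_map C' d' f n {x + b | b. b \<in> boundaries C d n}"
    unfolding homology_map_coset[OF C C' f x(1)] z(2) coset_eq[OF boundaries_sub[OF C']] by (rule x(2))
  then show "\<exists>X\<in>homology C d n. Z = homology_map C' d' f n X"
    unfolding homology_def using x(1) by blast
qed

text \<open>The class of a cycle is mapped into the zero group by an injective map.\<close>

lemma exact_where_target_vanishes:
  assumes q: "quasi_isomorphism C d C' d' f" and z: "C' n = {0}" and x: "x \<in> C n" "d x = 0"
  shows "\<exists>y\<in>C (n + 1). x = d y"
proof -
  have C: "chain_complex C d" and C': "chain_complex C' d'" and f: "chain_map C d C' d' f"
    and bij: "bij_betw (homology_map C' d' f n) (homology C d n) (homology C' d' n)"
    using q unfolding quasi_isomorphism_def by auto
  note B = boundaries_sub[OF C]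
  let ?c = "\<lambda>x. {x + b | b. b \<in> boundaries C d n}"
  have 0: "0 \<in> C n" using C fs.subspace_0 unfolding chain_complex_def by blast
  have "d (fscale 0 0) = fscale 0 (d 0)" using C 0 unfolding chain_complex_def lin_on_def by blast
  then have cyc: "0 \<in> cycles C d n" "x \<in> cycles C d n" using 0 x by (simp_all add: cycles_def)
  then have mem: "?c 0 \<in> homology C d n" "?c x \<in> homology C d n" unfolding homology_def by blast+
  have "f x = 0" "f 0 = 0" using f z x(1) 0 unfolding chain_map_def by auto
  then have "homology_map C' d' f n (?c x) = homology_map C' d' f n (?c 0)"
    unfolding homology_map_coset[OF C C' f cyc(1)] homology_map_coset[OF C C' f cyc(2)] by simp
  then have "?c x = ?c 0" using bij mem unfolding bij_betw_def inj_on_def by blast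
  then have "x - 0 \<in> boundaries C d n" unfolding coset_eq[OF B] .
  then show ?thesis unfolding boundaries_def by auto
qed

section \<open>The uncurved cobar construction\<close>

lemma (in conc_forms) der_extend_null:
  assumes "F \<in> S"
  shows "der_extend \<Phi> G (\<lambda>_. 0) F = 0"
proof -
  have "der_extend \<Phi> G (\<lambda>_. 0) F = lift \<Phi> (\<lambda>_. 0) F"
    unfolding der_extend_def by (simp add: conc_ev_zero)
  then show ?thesis using S_null[OF assms] by (auto simp: lift_def pointwise fun_eq_iff)
qed

lemma (in graded_cobracket) cobar_diff_uncurved:
  assumes "F \<in> Sn n"
  shows "cobar_diff G \<delta> (\<lambda>_. 0) (\<lambda>_. 0) F = der (cobar_d2 G \<delta>) F"
proof -
  have "cobar_d0 G (\<lambda>_. 0) = (\<lambda>_. 0)" by (auto simp: cobar_d0_def)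
  moreover have "cobar_d1 G (\<lambda>_. 0) = (\<lambda>_. 0)"
    using e_single_zero by (auto simp: cobar_d1_def cobar_forms_def)
  ultimately show ?thesis
    unfolding cobar_diff_def cobar_forms_def
    using der_extend_null[OF Sn_S[OF assms]] by simp
qed

lemma (in graded_cobracket) cobar_eq: "cobar G = Sn"
  by (simp add: cobar_def cobar_forms_def)

section \<open>Quadratic-linear-constant relations\<close>

locale qlc = ground_space sc for sc :: "'k::field_char_0 \<Rightarrow> 'v::ab_group_add \<Rightarrow> 'v" +
  fixes R :: "('v, 'k) words set"
  assumes R_sub: "fsubspace R" and R_upto: "R \<subseteq> symV_upto sc 2"
    and R_low: "R \<inter> symV_upto sc 1 = {0}" and R_ideal: "ideal sc R \<inter> symV_upto sc 2 = R"
begin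

abbreviation wp where "wp l F \<equiv> weight_proj \<Phi> l F"

lemma R_S: "R \<subseteq> S"
  using R_upto upto_S by blast

lemma qR_eq: "qR sc R = wp 2 ` R"
  by (simp add: qR_def symV_eq)

sublocale koszul_quadratic sc "qR sc R"
proof
  show "fsubspace (qR sc R)"
    unfolding qR_eq by (rule lin_on_image[OF lin_on_weight_proj R_sub])
  show "qR sc R \<subseteq> Sym2"
    unfolding qR_eq using weight_2_Sym2 R_S by blast
qed

abbreviation rel :: "('v, 'k) words \<Rightarrow> 'v \<Rightarrow> 'k \<Rightarrow> ('v, 'k) words"
  where "rel x v c \<equiv> x - e [v] + fscale c (e [])"

text \<open>Two relations with the same quadratic part differ by an element of \<open>R \<inter> (k \<oplus> V) = 0\<close>.\<close>

lemma rel_unique: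
  assumes "x \<in> Sym2" "rel x v c \<in> R" "rel x u b \<in> R"
  shows "u = v" "b = c"
proof -
  let ?r = "rel x v c - rel x u b"
  have r: "?r = (e [u] - e [v]) + fscale (c - b) (e [])"
    by (simp add: fs.scale_left_diff_distrib)
  have "?r \<in> R" by (rule fs.subspace_diff[OF R_sub assms(2,3)])
  moreover have "?r \<in> symV_upto sc 1"
    unfolding r upto_eq by (intro fs.span_add fs.span_diff fs.span_scale fs.span_base) auto
  ultimately have 0: "?r = 0" using R_low by blast
  have "wp 1 ?r = e [u] - e [v]" "wp 0 ?r = fscale (c - b) (e [])"
    unfolding r by (simp_all add: weight_proj_add weight_proj_diff weight_proj_scale weight_proj_e)
  then have "e [u] = e [v]" "fscale (c - b) (e []) = 0" unfolding 0 by simp_all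
  then show "u = v" "b = c" using e_single_inj' e_Nil_nonzero by auto
qed

lemma rel_exists:
  assumes r: "r \<in> R"
  obtains v c where "r = rel (wp 2 r) v c"
proof -
  have rS: "r \<in> S" using r R_S by blast
  obtain v where v: "wp 1 r = e [v]" using weight_1[OF rS] by blast
  obtain c where c: "wp 0 r = fscale c (e [])" using weight_0[OF rS] by blast
  have neg: "e [- v] = - e [v]"
  proof -
    have "e [v + - v] = e [v] + e [- v]" using e_plus[of "[]" v "- v" "[]"] by simp
    then have "e [v] + e [- v] = 0" by (simp add: e_single_zero)
    then show ?thesis by (simp add: add_eq_0_iff)
  qed
  have "r = (\<Sum>l\<le>2. wp l r)" by (rule upto_weight) (use r R_upto in blast)
  also have "\<dots> = wp 0 r + wp 1 r + wp 2 r"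
    by (simp add: numeral_2_eq_2)
  also have "\<dots> = rel (wp 2 r) (- v) c"
    unfolding v c neg by (simp add: algebra_simps)
  finally show ?thesis using that by blast
qed

abbreviation ph where "ph \<equiv> QLC_phi sc R"
abbreviation th where "th \<equiv> QLC_theta sc R"

lemma phi_theta_eq:
  assumes "x \<in> Sym2" "rel x v c \<in> R"
  shows "ph x = v" "th x = c"
  unfolding QLC_phi_def QLC_theta_def symV_eq
  using assms rel_unique[OF assms(1)] by (intro the_equality; blast)+

lemma phi_theta:
  assumes "x \<in> qR sc R"
  shows "rel x (ph x) (th x) \<in> R"
proof -
  obtain r where r: "r \<in> R" "x = wp 2 r" using assms qR_eq by auto
  obtain v c where vc: "r = rel (wp 2 r) v c" using rel_exists[OF r(1)] .
  have x: "x \<in> Sym2" using assms Q_Sym2 by blast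
  have "rel x v c \<in> R" using vc r by simp
  then show ?thesis using phi_theta_eq[OF x] by simp
qed

lemma R_rel:
  assumes "r \<in> R"
  shows "wp 2 r \<in> qR sc R" "r = rel (wp 2 r) (ph (wp 2 r)) (th (wp 2 r))"
proof -
  show x: "wp 2 r \<in> qR sc R" using assms qR_eq by auto
  obtain v c where vc: "r = rel (wp 2 r) v c" using rel_exists[OF assms] .
  have "rel (wp 2 r) v c \<in> R" using vc assms by simp
  then show "r = rel (wp 2 r) (ph (wp 2 r)) (th (wp 2 r))"
    using phi_theta_eq[of "wp 2 r" v c] vc x Q_Sym2 by auto
qed

lemma phi_theta_add:
  assumes x: "x \<in> qR sc R" and y: "y \<in> qR sc R"
  shows "ph (x + y) = ph x + ph y" "th (x + y) = th x + th y"
proof -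
  have S2: "x + y \<in> Sym2" using fs.subspace_add[OF Q_sub x y] Q_Sym2 by blast
  have "e [ph x + ph y] = e [ph x] + e [ph y]" using e_plus[of "[]" "ph x" "ph y" "[]"] by simp
  then have "rel (x + y) (ph x + ph y) (th x + th y) = rel x (ph x) (th x) + rel y (ph y) (th y)"
    by (simp add: fs.scale_left_distrib algebra_simps)
  then have "rel (x + y) (ph x + ph y) (th x + th y) \<in> R"
    using fs.subspace_add[OF R_sub phi_theta[OF x] phi_theta[OF y]] by (simp only:)
  then show "ph (x + y) = ph x + ph y" "th (x + y) = th x + th y"
    by (rule phi_theta_eq[OF S2])+
qed

lemma phi_theta_scale:
  assumes x: "x \<in> qR sc R"
  shows "ph (fscale a x) = sc a (ph x)" "th (fscale a x) = a * th x"
proof -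
  have S2: "fscale a x \<in> Sym2" using fs.subspace_scale[OF Q_sub x] Q_Sym2 by blast
  have "e [sc a (ph x)] = fscale a (e [ph x])" using e_sc[of "[]" a "ph x" "[]"] by simp
  then have "rel (fscale a x) (sc a (ph x)) (a * th x) = fscale a (rel x (ph x) (th x))"
    by (simp add: fs.scale_right_distrib fs.scale_right_diff_distrib)
  then have "rel (fscale a x) (sc a (ph x)) (a * th x) \<in> R"
    using fs.subspace_scale[OF R_sub phi_theta[OF x]] by (simp only:)
  then show "ph (fscale a x) = sc a (ph x)" "th (fscale a x) = a * th x"
    by (rule phi_theta_eq[OF S2])+
qed

text \<open>The inverse of \<open>susp2\<close> on quadratic relations, in the form in which it occurs in \<open>theta_tilde\<close>.\<close>

abbreviation desusp where "desusp z \<equiv> (THE x. x \<in> qR sc R \<and> susp2 sc x = z)"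

lemma desusp_susp2:
  assumes "x \<in> qR sc R"
  shows "desusp (susp2 sc x) = x"
  using assms susp2_inj[of _ x] Q_Sym2 by (intro the_equality) blast+

lemma theta_susp2:
  assumes "x \<in> qR sc R"
  shows "theta_tilde sc R (susp2 sc x) = th x"
proof -
  have "susp2 sc x \<in> CL 2" using assms Q_Sym2 by (intro susp2_CL) blast
  then have "weight_proj LF 2 (susp2 sc x) = susp2 sc x"
    using weight_proj_CL[of "susp2 sc x" 2 2] by simp
  then show ?thesis unfolding theta_tilde_def using desusp_susp2[OF assms] by simp
qed

lemma theta_other:
  assumes "x \<in> G n" "n \<noteq> 2"
  shows "theta_tilde sc R x = 0"
proof -
  have "weight_proj LF 2 x = susp2 sc 0"
    using weight_proj_CL[of x n 2] assms G_CL susp2_zero by auto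
  then have "theta_tilde sc R x = th 0"
    unfolding theta_tilde_def using desusp_susp2[OF fs.subspace_0[OF Q_sub]] by simp
  also have "th 0 = 0" using phi_theta_scale(2)[OF fs.subspace_0[OF Q_sub], of 0] by simp
  finally show ?thesis .
qed

lemma G_2_cases:
  assumes "x \<in> G 2"
  obtains q where "q \<in> qR sc R" "x = susp2 sc q"
  using assms G_2 by blast

text \<open>The given values \<open>s\<^sup>2x \<mapsto> s \<phi>(x)\<close> in weight \<open>2\<close>, extended by zero; this starts the construction
  of the coderivation.\<close>

definition dphi :: "('v, 'k) words \<Rightarrow> ('v, 'k) words"
  where "dphi x = (if x \<in> G 2 then iot (ph (desusp x)) else 0)"

lemma dphi_susp2: "q \<in> qR sc R \<Longrightarrow> dphi (susp2 sc q) = iot (ph q)"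
  using G_2 desusp_susp2 by (auto simp: dphi_def)

lemma dphi_other:
  assumes "x \<in> G n" "n \<noteq> 2"
  shows "dphi x = 0"
proof (cases "x \<in> G 2")
  case True
  then have "x = susp2 sc 0" using G_disj[OF assms(1) True assms(2)] susp2_zero by simp
  then have "dphi x = iot (ph 0)" using dphi_susp2[OF fs.subspace_0[OF Q_sub]] by simp
  then show ?thesis using phi_theta_scale(1)[OF fs.subspace_0[OF Q_sub], of 0] iot_scale[of 0 "ph 0"] by simp
qed (simp add: dphi_def)

lemma dphi_lin_deg: "GC.lin_deg dphi"
proof (rule GC.lin_degI)
  fix n x assume x: "x \<in> G n"
  have z: "dphi y = 0" if "n \<noteq> 2" "y \<in> G n" for y using dphi_other that by blast
  have q: "\<exists>q\<in>qR sc R. y = susp2 sc q" if "n = 2" "y \<in> G n" for y using that G_2_cases by blast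
  show "dphi x \<in> G (n - 1)"
    using q[OF _ x] z[OF _ x] GG.G_zero dphi_susp2 iot_CL G_1 by (cases "n = 2") auto
  show "dphi (x + y) = dphi x + dphi y" if y: "y \<in> G n" for y
  proof (cases "n = 2")
    case True
    obtain p q where "p \<in> qR sc R" "x = susp2 sc p" "q \<in> qR sc R" "y = susp2 sc q"
      using q[OF True x] q[OF True y] by blast
    then show ?thesis
      using fs.subspace_add[OF Q_sub]
      by (simp add: susp2_add[symmetric] dphi_susp2 phi_theta_add iot_add)
  qed (simp add: z x y GG.G_add)
  show "dphi (fscale c x) = fscale c (dphi x)" for c
  proof (cases "n = 2")
    case True
    obtain p where "p \<in> qR sc R" "x = susp2 sc p" using q[OF True x] by blast
    then show ?thesis
      using fs.subspace_scale[OF Q_sub]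
      by (simp add: susp2_scale[symmetric] dphi_susp2 phi_theta_scale iot_scale)
  qed (simp add: z x GG.G_scale)
qed

end

section \<open>Koszulness and the boundaries of degree zero\<close>

locale koszul_qlc = qlc sc R for sc :: "'k::field_char_0 \<Rightarrow> 'v::ab_group_add \<Rightarrow> 'v" and R +
  assumes koszul: "qA_koszul sc R"
begin

lemma koszul_quasi_iso:
  "quasi_isomorphism GC.Sn (cobar_diff G del (\<lambda>_. 0) (\<lambda>_. 0))
       (quot_alg sc (qR sc R)) (\<lambda>_. 0) (g_kappa sc (qR sc R))"
  using koszul unfolding qA_koszul_def Let_def GC.cobar_eq .

sublocale CC: curved_cobar "koszul_dual sc (qR sc R)" "sub_cobracket sc (koszul_dual sc (qR sc R))" "theta_tilde sc R"
proof
  show "theta_tilde sc R (x + y) = theta_tilde sc R x + theta_tilde sc R y"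
    if x: "x \<in> G n" and y: "y \<in> G n" for n x y
  proof (cases "n = 2")
    case True
    obtain p where p: "p \<in> qR sc R" "x = susp2 sc p" using x True G_2_cases[of x] by blast
    obtain q where q: "q \<in> qR sc R" "y = susp2 sc q" using y True G_2_cases[of y] by blast
    show ?thesis
      unfolding q(2) p(2) susp2_add[symmetric] theta_susp2[OF q(1)] theta_susp2[OF p(1)]
        theta_susp2[OF fs.subspace_add[OF Q_sub p(1) q(1)]] phi_theta_add[OF p(1) q(1)] ..
  next
    case False
    then show ?thesis using theta_other[OF x] theta_other[OF y] theta_other[OF GG.G_add[OF x y]] by simp
  qed
  show "theta_tilde sc R (fscale c x) = c * theta_tilde sc R x" if x: "x \<in> G n" for n x c
  proof (cases "n = 2")
    case True
    obtain p where p: "p \<in> qR sc R" "x = susp2 sc p" using x True G_2_cases[of x] by blast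
    show ?thesis
      unfolding p(2) susp2_scale[symmetric] theta_susp2[OF p(1)]
        theta_susp2[OF fs.subspace_scale[OF Q_sub p(1)]] phi_theta_scale[OF p(1)] ..
  next
    case False
    then show ?thesis using theta_other[OF x] theta_other[OF GG.G_scale[OF x]] by simp
  qed
  show "theta_tilde sc R x = 0" if "x \<in> G n" "n \<noteq> 2" for n x by (rule theta_other[OF that])
  \<comment> \<open>The uncurved cobar construction has the differential \<open>d\<^sub>2\<close>, and the target of the quasi-isomorphism
    vanishes outside degree \<open>0\<close>.\<close>
  note q = koszul_quasi_iso
  have C: "chain_complex GC.Sn (cobar_diff G del (\<lambda>_. 0) (\<lambda>_. 0))"
    using q unfolding quasi_isomorphism_def by blast
  fix n F assume F: "F \<in> GC.Sn n"
  have dF: "GC.der (cobar_d2 G del) F \<in> GC.Sn (n - 1)"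
    by (rule GC.odd_derivationD(3)[OF GC.der_odd_derivation[OF GC.odd_gen_d2] F])
  have "cobar_diff G del (\<lambda>_. 0) (\<lambda>_. 0) (cobar_diff G del (\<lambda>_. 0) (\<lambda>_. 0) F) = 0"
    using C F unfolding chain_complex_def by blast
  then show "GC.der (cobar_d2 G del) (GC.der (cobar_d2 G del) F) = 0"
    unfolding GC.cobar_diff_uncurved[OF F] GC.cobar_diff_uncurved[OF dF] .
  assume n: "n \<noteq> 0" and "GC.der (cobar_d2 G del) F = 0"
  then have "cobar_diff G del (\<lambda>_. 0) (\<lambda>_. 0) F = 0" unfolding GC.cobar_diff_uncurved[OF F] by simp
  note ex = exact_where_target_vanishes[OF q, of n F]
  have "\<exists>K\<in>GC.Sn (n + 1). F = cobar_diff G del (\<lambda>_. 0) (\<lambda>_. 0) K"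
    by (rule ex[OF quot_alg_other[OF n] F]) fact
  then obtain K where K: "K \<in> GC.Sn (n + 1)" "F = cobar_diff G del (\<lambda>_. 0) (\<lambda>_. 0) K" by blast
  then show "\<exists>K\<in>GC.Sn (n + 1). F = GC.der (cobar_d2 G del) K"
    using GC.cobar_diff_uncurved[OF K(1)] by auto
qed

abbreviation DD where "DD d \<equiv> cobar_diff G del d (theta_tilde sc R)"
abbreviation cp (infixl "\<star>" 70) where "F \<star> K \<equiv> conc GC.\<Phi> F K"

text \<open>The degree \<open>1\<close> generators are those of weight \<open>2\<close>, so the boundaries of degree \<open>0\<close> depend on
  \<open>d\<close> only through its values in weight \<open>2\<close>.\<close>

definition phi_like :: "(('v, 'k) words \<Rightarrow> ('v, 'k) words) \<Rightarrow> bool"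
  where "phi_like d \<longleftrightarrow> GC.lin_deg d \<and> (\<forall>x\<in>G 2. d x = dphi x)"

lemma DD_relation:
  assumes d: "phi_like d" and x: "x \<in> qR sc R"
  shows "DD d (GC.e [susp2 sc x]) = J (rel x (ph x) (th x))"
proof -
  have xG: "susp2 sc x \<in> G 2" using G_2 x by blast
  have "d (susp2 sc x) = iot (ph x)" using d xG dphi_susp2[OF x] unfolding phi_like_def by simp
  moreover have "J (e [ph x]) = GC.e [iot (ph x)]" "J (e []) = GC.e []" by (simp_all add: J_e)
  moreover have "GC.lin_deg d" using d unfolding phi_like_def by blast
  ultimately show ?thesis
    using CC.D_single[OF _ xG, of d] d2_susp2[OF x] theta_susp2[OF x]
    by (simp add: J_add J_diff J_scale)
qed

lemma DD_zero:
  assumes "GC.lin_deg d" "F \<in> S"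
  shows "DD d (J F) = 0"
  using GC.Sn_neg[OF GC.odd_derivationD(3)[OF CC.D_odd[OF assms(1)] J_Sn[OF assms(2)]]] by simp

text \<open>Elements of degree \<open>0\<close> are cycles, so the differential is linear over \<open>Sym(V)\<close>.\<close>

lemma DD_left:
  assumes d: "GC.lin_deg d" and F: "F \<in> S" and K: "K \<in> GC.Sn n"
  shows "DD d (J F \<star> K) = J F \<star> DD d K"
  using GC.Leibniz[OF CC.D_odd[OF d] J_Sn[OF F] K] DD_zero[OF d F] by simp

lemma sum_degrees_one:
  assumes "set w \<subseteq> homs (shift (- 1) G)" "0 \<notin> set w" "GC.wdeg w = 1"
  shows "\<exists>u x v. w = map iot u @ x # map iot v \<and> x \<in> G 2"
  using assms
proof (induction w)
  case (Cons x w)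
  have nn: "GC.wdeg w \<ge> 0"
    using Cons.prems degree_nonneg by (intro sum_list_nonneg) auto
  have x: "x \<in> shift (- 1) G (GC.dg x)" using Cons.prems by (intro GC.deg_in) auto
  have "GC.dg x \<ge> 0" using Cons.prems by (intro degree_nonneg) auto
  then consider "GC.dg x = 0" "GC.wdeg w = 1" | "GC.dg x = 1" "GC.wdeg w = 0"
    using nn Cons.prems(3) by force
  then show ?case
  proof cases
    case 1
    obtain a where "x = iot a" using degree_zero_iot[of x] Cons.prems 1 by auto
    moreover obtain u y v where "w = map iot u @ y # map iot v" "y \<in> G 2"
      using Cons.IH Cons.prems 1 by auto
    ultimately have "x # w = map iot (a # u) @ y # map iot v" "y \<in> G 2" by simp_all
    then show ?thesis by blast
  next
    case 2
    obtain v where "w = map iot v" using sum_degrees_zero[of w] Cons.prems 2 by auto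
    then have "x # w = map iot [] @ x # map iot v" by simp
    moreover have "x \<in> G 2" using x 2 by (simp add: GC.in_shift)
    ultimately show ?thesis by blast
  qed
qed simp

text \<open>A word of degree \<open>1\<close> has exactly one letter of degree \<open>1\<close>, coming from some \<open>x \<in> qR\<close>.  The
  differential replaces it by the relation with quadratic part \<open>x\<close> and leaves the other letters.\<close>

lemma boundary_in_ideal:
  assumes d: "phi_like d" and z: "z \<in> GC.Sn 1"
  shows "DD d z \<in> J ` ideal sc R"
proof -
  have dl: "GC.lin_deg d" using d unfolding phi_like_def by blast
  note odd = CC.D_odd[OF dl]
  show ?thesis
  proof (rule GC.Sn_mem[OF z GC.lin_on_odd[OF odd] lin_on_image[OF lin_on_J ideal_sub]])
    fix w assume word: "set w \<subseteq> homs (shift (- 1) G)" "GC.wdeg w = 1"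
    show "DD d (GC.e w) \<in> J ` ideal sc R"
    proof (cases "0 \<in> set w")
      case True
      then have "GC.e w = 0" using word(1) by (rule GC.e_null)
      then have "DD d (GC.e w) = J 0" using GC.odd_derivation_zero[OF odd] J_zero by simp
      then show ?thesis using fs.subspace_0[OF ideal_sub] by blast
    next
      case False
      obtain u y v where w: "w = map iot u @ y # map iot v" "y \<in> G 2"
        using sum_degrees_one[OF word(1) False word(2)] by blast
      obtain x where x: "x \<in> qR sc R" "y = susp2 sc x" using w(2) G_2_cases[of y] by blast
      let ?r = "rel x (ph x) (th x)"
      have r: "?r \<in> R" by (rule phi_theta[OF x(1)])
      then have rS: "?r \<in> S" and ri: "?r \<in> ideal sc R" using R_S ideal_base[OF R_S r] by blast+
      have y: "GC.e [y] \<in> GC.Sn 1" using w(2) by (intro GC.e_single) (simp add: GC.in_shift)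
      have v: "GC.e (map iot v) = J (e v)" and u: "GC.e (map iot u) = J (e u)" by (simp_all add: J_e)
      have yv: "GC.e [y] \<star> J (e v) \<in> GC.Sn (1 + 0)" by (rule GC.Sn_conc[OF y J_Sn[OF e_S]])
      have "GC.e w = J (e u) \<star> (GC.e [y] \<star> J (e v))"
        using word(1) w(1) by (simp add: u[symmetric] v[symmetric] GC.conc_ev)
      then have "DD d (GC.e w) = J (e u) \<star> DD d (GC.e [y] \<star> J (e v))"
        using DD_left[OF dl e_S yv] by simp
      also have "DD d (GC.e [y] \<star> J (e v)) = DD d (GC.e [y]) \<star> J (e v)"
        using GC.Leibniz[OF odd y J_Sn[OF e_S[of v]]] DD_zero[OF dl e_S[of v]]
          GC.conc_zero_right[OF GC.Sn_S[OF y]] by simp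
      also have "DD d (GC.e [y]) = J ?r" unfolding x(2) by (rule DD_relation[OF d x(1)])
      also have "J ?r \<star> J (e v) = J (?r \<cdot> e v)" by (rule J_conc[OF rS e_S, symmetric])
      also have "J (e u) \<star> J (?r \<cdot> e v) = J (e u \<cdot> (?r \<cdot> e v))"
        by (rule J_conc[OF e_S conc_in_S[OF rS e_S], symmetric])
      finally have "DD d (GC.e w) = J (e u \<cdot> (?r \<cdot> e v))" .
      moreover have "?r \<cdot> e v \<in> ideal sc R"
        unfolding commute[OF rS e_S] by (rule ideal_mult[OF R_S e_S ri])
      then have "e u \<cdot> (?r \<cdot> e v) \<in> ideal sc R" by (rule ideal_mult[OF R_S e_S])
      ultimately show ?thesis by blast
    qed
  qed
qed

lemma ideal_in_boundary:
  assumes d: "phi_like d" and F: "F \<in> ideal sc R"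
  shows "J F \<in> DD d ` GC.Sn 1"
proof -
  have dl: "GC.lin_deg d" using d unfolding phi_like_def by blast
  note lin = GC.lin_on_odd[OF CC.D_odd[OF dl]]
  show ?thesis
  proof (rule fspan_mem[OF F[unfolded ideal_def symV_eq] lin_on_J lin_on_image[OF lin GC.Sn_sub]])
    fix b assume "b \<in> {F \<cdot> r | F r. F \<in> Sn 0 \<and> r \<in> R}"
    then obtain K r where b: "b = K \<cdot> r" "K \<in> S" "r \<in> R" using S_Sn_0 by blast
    have rS: "r \<in> S" using b(3) R_S by blast
    let ?x = "wp 2 r"
    have y: "GC.e [susp2 sc ?x] \<in> GC.Sn 1"
      using G_2 R_rel(1)[OF b(3)] by (intro GC.e_single) (auto simp: GC.in_shift)
    have "J b = J K \<star> J r" unfolding b(1) by (rule J_conc[OF b(2) rS])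
    also have "J r = DD d (GC.e [susp2 sc ?x])"
      using DD_relation[OF d R_rel(1)[OF b(3)]] R_rel(2)[OF b(3)] by simp
    also have "J K \<star> DD d (GC.e [susp2 sc ?x]) = DD d (J K \<star> GC.e [susp2 sc ?x])"
      by (rule DD_left[OF dl b(2) y, symmetric])
    finally show "J b \<in> DD d ` GC.Sn 1" using GC.Sn_conc[OF J_Sn[OF b(2)] y] by auto
  qed
qed

text \<open>The boundary \<open>D (d\<^sub>2 x)\<close> lies in the ideal generated by \<open>R\<close>.  It has no part of length \<open>3\<close> or more,
  because \<open>d\<^sub>2\<^sup>2 = 0\<close>.  By the condition on \<open>R\<close> it is itself a relation, and every relation is the
  differential of a generator.\<close>

lemma weight_three:
  assumes x: "x \<in> G 3"
  shows "\<exists>y\<in>G 2. DD dphi (cobar_d2 G del x) = DD dphi (GC.e [y])"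
proof -
  have d: "phi_like dphi" unfolding phi_like_def using dphi_lin_deg by blast
  let ?z = "cobar_d2 G del x"
  have z: "?z \<in> GC.SL 1 2" using GC.d2_in_SL[OF x] by simp
  obtain F where F: "F \<in> ideal sc R" "DD dphi ?z = J F"
    using boundary_in_ideal[OF d GC.SL_Sn[OF z]] by blast
  have FS: "F \<in> S" using F(1) ideal_in_S[OF R_S] by blast
  have x': "x \<in> shift (- 1) G 2" using x by (simp add: GC.in_shift)
  have sq: "CC.D2 ?z = 0"
    using CC.d2_square[OF GC.e_single[OF x']] GC.der_single[OF GC.odd_gen_d2 GC.H_G[OF x]] by simp
  have "wp (Suc k) F = 0" if k: "k \<ge> 2" for k
  \<comment> \<open>Lengths are read off in \<open>Sym(V)\<close> because \<open>J\<close> preserves them.\<close>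
  proof (rule J_inj)
    show "wp (Suc k) F \<in> S"
      using weight_proj_upto[OF FS order.refl, of "Suc k"] upto_S by blast
    have pz: "weight_proj GC.\<Phi> l ?z = (if l = 2 then ?z else 0)" for l
      by (rule GC.weight_proj_SL[OF z])
    have "J (wp (Suc k) F) = weight_proj GC.\<Phi> (Suc k) (DD dphi ?z)"
      using J_weight[OF FS] F(2) by simp
    also have "\<dots> = 0"
      unfolding CC.P_D_Suc[OF dphi_lin_deg GC.SL_Sn[OF z]] pz using k sq by simp
    finally show "J (wp (Suc k) F) = 0" .
  qed
  then have high: "wp l F = 0" if "l > 2" for l
    using that by (cases l) auto
  obtain N where N: "\<And>l. l \<ge> N \<Longrightarrow> wp l F = 0" "F = (\<Sum>l<N. wp l F)"
    using length_bounded[of F 0] FS S_Sn_0 by blast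
  have "F = (\<Sum>l\<in>{..<N} \<inter> {..2}. wp l F)"
    by (subst N(2), rule sum.mono_neutral_right) (use high in auto)
  also have "\<dots> \<in> symV_upto sc 2"
    unfolding upto_eq using weight_proj_upto[OF FS, of _ 2, unfolded upto_eq] by (intro fs.span_sum) auto
  finally have "F \<in> R" using F(1) R_ideal by blast
  have q: "wp 2 F \<in> qR sc R" and Fr: "F = rel (wp 2 F) (ph (wp 2 F)) (th (wp 2 F))"
    using R_rel[OF \<open>F \<in> R\<close>] by blast+
  have "DD dphi (GC.e [susp2 sc (wp 2 F)]) = J F"
    unfolding DD_relation[OF d q] using Fr by simp
  then show ?thesis using F(2) G_2 q by (intro bexI[of _ "susp2 sc (wp 2 F)"]) auto
qed

end

context koszul_qlc
begin

section \<open>The coderivation on the whole of the Koszul dual\<close>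

abbreviation lp where "lp n x \<equiv> weight_proj LF n x"

lemma lp_G: "x \<in> G m \<Longrightarrow> lp n x = (if int n = m then x else 0)"
  using weight_proj_CL[of x m n] G_CL by blast

lemma lp_total:
  assumes "x \<in> total G"
  shows "lp n x \<in> G (int n)"
proof (rule fspan_mem[OF assms[unfolded total_def] lin_on_weight_proj G_sub])
  fix x assume "x \<in> homs G"
  then obtain m where "x \<in> G m" unfolding homs_def by blast
  then show "lp n x \<in> G (int n)" using lp_G[of x m n] GG.G_zero by auto
qed

lemma lp_sum:
  assumes "x \<in> total G"
  shows "\<exists>N. \<forall>M\<ge>N. lp M x = 0 \<and> x = (\<Sum>n<M. lp n x)"
  using assms unfolding total_def
proof (rule weight_bounded)
  fix x assume "x \<in> homs G"
  then obtain m where x: "x \<in> G m" unfolding homs_def by blast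
  have "lp k x = (if k = nat m then x else 0)" for k
    using lp_G[OF x, of k] G_pos[OF _ x] by auto
  then show "\<exists>l. \<forall>k. lp k x = (if k = l then x else 0)" by blast
qed

text \<open>Extends a map given on homogeneous elements to their span by adding up over the weights; zero
  outside the span, where \<open>phi_tilde\<close> is zero by convention.\<close>

definition ext :: "(('v, 'k) words \<Rightarrow> ('v, 'k) words) \<Rightarrow> ('v, 'k) words \<Rightarrow> ('v, 'k) words"
  where "ext d x = (if x \<in> total G then \<Sum>n | lp n x \<noteq> 0. d (lp n x) else 0)"

lemma ext_sum:
  assumes d: "GC.lin_deg d" and x: "x \<in> total G" and N: "\<And>n. n \<ge> N \<Longrightarrow> lp n x = 0"
  shows "ext d x = (\<Sum>n<N. d (lp n x))"
proof -
  have "{n. lp n x \<noteq> 0} \<subseteq> {..<N}" using N by (auto simp: not_le[symmetric])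
  then have "(\<Sum>n | lp n x \<noteq> 0. d (lp n x)) = (\<Sum>n<N. d (lp n x))"
    by (intro sum.mono_neutral_left) (auto simp: GC.lin_deg_zero[OF d])
  then show ?thesis using x by (simp add: ext_def)
qed

lemma total_sub: "fsubspace (total G)"
  unfolding total_def by (rule fs.subspace_span)

lemma ext_add:
  assumes d: "GC.lin_deg d" and x: "x \<in> total G" and y: "y \<in> total G"
  shows "ext d (x + y) = ext d x + ext d y"
proof -
  obtain M where M: "\<forall>n\<ge>M. lp n x = 0" using lp_sum[OF x] by blast
  obtain N where N: "\<forall>n\<ge>N. lp n y = 0" using lp_sum[OF y] by blast
  let ?N = "max M N"
  have s: "ext d x = (\<Sum>n<?N. d (lp n x))" "ext d y = (\<Sum>n<?N. d (lp n y))"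
    using M N by (intro ext_sum[OF d] x y; simp)+
  have "ext d (x + y) = (\<Sum>n<?N. d (lp n (x + y)))"
    using M N by (intro ext_sum[OF d] fs.subspace_add[OF total_sub x y]) (simp add: weight_proj_add)
  also have "\<dots> = (\<Sum>n<?N. d (lp n x) + d (lp n y))"
    unfolding weight_proj_add using GC.lin_degD(2)[OF d lp_total[OF x] lp_total[OF y]] by simp
  finally show ?thesis unfolding s sum.distrib .
qed

lemma ext_scale:
  assumes d: "GC.lin_deg d" and x: "x \<in> total G"
  shows "ext d (fscale c x) = fscale c (ext d x)"
proof -
  obtain M where M: "\<forall>n\<ge>M. lp n x = 0" using lp_sum[OF x] by blast
  have s: "ext d x = (\<Sum>n<M. d (lp n x))" using M by (intro ext_sum[OF d] x) simp
  have "ext d (fscale c x) = (\<Sum>n<M. d (lp n (fscale c x)))"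
    using M by (intro ext_sum[OF d] fs.subspace_scale[OF total_sub x]) (simp add: weight_proj_scale)
  also have "\<dots> = (\<Sum>n<M. fscale c (d (lp n x)))"
    unfolding weight_proj_scale using GC.lin_degD(3)[OF d lp_total[OF x]] by simp
  finally show ?thesis unfolding s fs.scale_sum_right .
qed

lemma ext_G:
  assumes d: "GC.lin_deg d" and x: "x \<in> G m"
  shows "ext d x = d x"
proof (cases "m \<le> 0")
  case True
  then have "x = 0" using G_pos x by blast
  then show ?thesis by (simp add: ext_def GC.lin_deg_zero[OF d])
next
  case False
  have "ext d x = (\<Sum>n<Suc (nat m). d (lp n x))"
  proof (rule ext_sum[OF d G_total[OF x]])
    fix n assume "n \<ge> Suc (nat m)"
    then have "int n \<noteq> m" by linarith
    then show "lp n x = 0" by (simp add: lp_G[OF x])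
  qed
  also have "\<dots> = (\<Sum>n<Suc (nat m). if n = nat m then d x else 0)"
    using lp_G[OF x] False GC.lin_deg_zero[OF d] by (intro sum.cong) auto
  also have "\<dots> = d x" by simp
  finally show ?thesis .
qed

lemma lin_deg_total:
  assumes d: "GC.lin_deg d" and lin: "lin_on (total G) f" and f: "\<And>n x. x \<in> G n \<Longrightarrow> f x = d x" and x: "x \<in> total G"
  shows "f x \<in> total G"
proof (rule fspan_mem[OF x[unfolded total_def] lin[unfolded total_def] total_sub])
  fix x assume "x \<in> homs G"
  then obtain n where x: "x \<in> G n" unfolding homs_def by blast
  then show "f x \<in> total G" using f[OF x] GC.lin_degD(1)[OF d x] G_total by simp
qed

text \<open>The description by which \<open>phi_tilde\<close> is defined.\<close>

abbreviation is_phi_tilde where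
  "is_phi_tilde d \<equiv> lie_coderivation G del d \<and>
       (\<forall>x \<in> total G. \<forall>q \<in> qR sc R. lp 2 x = susp2 sc q \<longrightarrow> lp 1 (d x) = iot (ph q)) \<and>
       (\<forall>x. x \<notin> total G \<longrightarrow> d x = 0)"

lemma susp2_lp: "q \<in> qR sc R \<Longrightarrow> lp 2 (susp2 sc q) = susp2 sc q"
  using lp_G[of "susp2 sc q" 2 2] G_2 by simp

lemma coderivation_lin_deg:
  assumes "lie_coderivation G del d"
  shows "GC.lin_deg d"
proof (rule GC.lin_degI)
  fix n x assume x: "x \<in> G n"
  show "d x \<in> G (n - 1)" using assms x unfolding lie_coderivation_def by blast
  show "d (x + y) = d x + d y" if "y \<in> G n" for y
    using assms G_total[OF x] G_total[OF that] unfolding lie_coderivation_def lin_on_def by blast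
  show "d (fscale c x) = fscale c (d x)" for c
    using assms G_total[OF x] unfolding lie_coderivation_def lin_on_def by blast
qed

lemma is_phi_tilde_unique:
  assumes d: "is_phi_tilde d" and d': "is_phi_tilde d'"
  shows "d = d'"
proof -
  have ld: "GC.lin_deg d" "GC.lin_deg d'" using d d' coderivation_lin_deg by blast+
  have co: "del (f x) = GC.Td f (del x)" if "is_phi_tilde f" "x \<in> G n" for f n x
    using that G_total unfolding lie_coderivation_def by blast
  have two: "f x = iot (ph q)" if f: "is_phi_tilde f" "GC.lin_deg f" and q: "q \<in> qR sc R" "x = susp2 sc q" for f x q
  proof -
    have x: "x \<in> G 2" using G_2 q by blast
    have "f x \<in> G 1" using GC.lin_degD(1)[OF f(2) x] by simp
    then have "lp 1 (f x) = f x" using lp_G[of "f x" 1 1] by simp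
    moreover have "lp 1 (f x) = iot (ph q)"
      using f(1) G_total[OF x] q susp2_lp[OF q(1)] by blast
    ultimately show ?thesis by simp
  qed
  have agree: "d x = d' x" if "x \<in> G n" for n x
  proof (rule CC.coderivation_unique[OF ld _ _ _ that])
    show "del (d x) = GC.Td d (del x)" if "x \<in> G n" for n x by (rule co[OF d that])
    show "del (d' x) = GC.Td d' (del x)" if "x \<in> G n" for n x by (rule co[OF d' that])
    fix x assume "x \<in> G 2"
    then obtain q where q: "q \<in> qR sc R" "x = susp2 sc q" using G_2_cases[of x] by blast
    show "d x = d' x" using two[OF d ld(1) q] two[OF d' ld(2) q] by simp
  qed
  have lin: "lin_on (total G) d" "lin_on (total G) d'"
    using d d' unfolding lie_coderivation_def by blast+
  show ?thesis
  proof
    fix x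
    show "d x = d' x"
    proof (cases "x \<in> total G")
      case True
      show ?thesis
        by (rule fspan_eq[OF True[unfolded total_def] lin[unfolded total_def]])
          (use agree in \<open>auto simp: homs_def\<close>)
    next
      case False
      then show ?thesis using d d' by simp
    qed
  qed
qed

text \<open>In weight \<open>3\<close>, where homological exactness is missing, the induction is fed by \<open>weight_three\<close>.\<close>

lemma differential:
  "\<exists>d. phi_like d \<and> (\<forall>n. \<forall>x\<in>G n. DD d (DD d (GC.e [x])) = 0)"
  using CC.differential_exists[OF dphi_lin_deg weight_three] unfolding phi_like_def by blast

lemma DD_cong:
  assumes d: "GC.lin_deg d" "GC.lin_deg d'" and agree: "\<And>n x. x \<in> G n \<Longrightarrow> d x = d' x"
    and F: "F \<in> GC.Sn n"
  shows "DD d F = DD d' F"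
proof (rule GC.Sn_eq[OF F GC.lin_on_odd[OF CC.D_odd[OF d(1)]] GC.lin_on_odd[OF CC.D_odd[OF d(2)]]])
  fix w assume w: "set w \<subseteq> homs (shift (- 1) G)"
  show "DD d (GC.e w) = DD d' (GC.e w)"
  proof (rule GC.derivation_cong_word[OF CC.D_odd[OF d(1)] CC.D_odd[OF d(2)] w])
    fix x assume "x \<in> set w"
    then have "x \<in> homs G" using w GC.H_eq by blast
    then obtain m where x: "x \<in> G m" unfolding homs_def by blast
    show "DD d (GC.e [x]) = DD d' (GC.e [x])"
      unfolding CC.D_single[OF d(1) x] CC.D_single[OF d(2) x] agree[OF x] ..
  qed
qed

text \<open>The map built from Koszulness satisfies the description of \<open>phi_tilde\<close>, and that description
  determines it; so the two agree and \<open>phi_tilde\<close> inherits \<open>D\<^sup>2 = 0\<close>.\<close>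

lemma phi_tilde_properties:
  "phi_like (phi_tilde sc R)" "\<And>n x. x \<in> G n \<Longrightarrow> DD (phi_tilde sc R) (DD (phi_tilde sc R) (GC.e [x])) = 0"
proof -
  obtain d where d: "phi_like d" and sq: "\<And>n x. x \<in> G n \<Longrightarrow> DD d (DD d (GC.e [x])) = 0"
    using differential by blast
  have ld: "GC.lin_deg d" using d unfolding phi_like_def by blast
  let ?f = "ext d"
  have fG: "?f x = d x" if "x \<in> G n" for n x by (rule ext_G[OF ld that])
  have lf: "GC.lin_deg ?f"
  proof (rule GC.lin_degI)
    fix n x assume x: "x \<in> G n"
    show "?f x \<in> G (n - 1)" using fG[OF x] GC.lin_degD(1)[OF ld x] by simp
    show "?f (x + y) = ?f x + ?f y" if "y \<in> G n" for y
      by (rule ext_add[OF ld G_total[OF x] G_total[OF that]])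
    show "?f (fscale c x) = fscale c (?f x)" for c
      by (rule ext_scale[OF ld G_total[OF x]])
  qed
  have sqf: "DD ?f (DD ?f (GC.e [x])) = 0" if x: "x \<in> G n" for n x
  proof -
    have ex: "GC.e [x] \<in> GC.Sn (n - 1)" using x by (intro GC.e_single) (simp add: GC.in_shift)
    have eq: "DD ?f F = DD d F" if "F \<in> GC.Sn i" for F i
      by (rule DD_cong[OF lf ld _ that]) (rule fG)
    show ?thesis
      unfolding eq[OF ex] eq[OF GC.odd_derivationD(3)[OF CC.D_odd[OF ld] ex]] by (rule sq[OF x])
  qed
  have lin: "lin_on (total G) ?f"
    unfolding lin_on_def using ext_add[OF ld] ext_scale[OF ld] by blast
  have ft: "?f x \<in> total G" if "x \<in> total G" for x
    by (rule lin_deg_total[OF ld lin _ that]) (rule fG)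
  have co: "del (?f x) = GC.Td ?f (del x)" if "x \<in> total G" for x
  proof (rule fspan_eq[OF that[unfolded total_def], unfolded total_def[symmetric]])
    show "lin_on (total G) (\<lambda>x. del (?f x))" "lin_on (total G) (\<lambda>x. GC.Td ?f (del x))"
      using lin lin_on_del GC.lin_on_Td[of UNIV ?f] ft by (simp_all add: lin_on_def)
    fix x assume "x \<in> homs G"
    then obtain n where x: "x \<in> G n" unfolding homs_def by blast
    show "del (?f x) = GC.Td ?f (del x)" by (rule CC.coderivation_if_square_zero[OF lf x sqf[OF x]])
  qed
  have lie: "lie_coderivation G del ?f"
    unfolding lie_coderivation_def using lin co GC.lin_degD(1)[OF lf] by blast
  have corestriction: "lp 1 (?f x) = iot (ph q)"
    if x: "x \<in> total G" and q: "q \<in> qR sc R" "lp 2 x = susp2 sc q" for x q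
  proof -
    obtain M where M: "\<forall>n\<ge>M. lp n x = 0" using lp_sum[OF x] by blast
    have "?f x = (\<Sum>n<M + 3. d (lp n x))"
      using M by (intro ext_sum[OF ld x]) simp
    then have "lp 1 (?f x) = (\<Sum>n<M + 3. lp 1 (d (lp n x)))"
      by (simp add: weight_proj_sum)
    also have "\<dots> = (\<Sum>n<M + 3. if n = 2 then d (lp 2 x) else 0)"
    proof (intro sum.cong refl)
      fix n
      show "lp 1 (d (lp n x)) = (if n = 2 then d (lp 2 x) else 0)"
        using lp_G[OF GC.lin_degD(1)[OF ld lp_total[OF x]], of 1 n] by auto
    qed
    also have "\<dots> = d (susp2 sc q)" using q(2) by simp
    also have "\<dots> = iot (ph q)"
      using d G_2 q(1) dphi_susp2[OF q(1)] unfolding phi_like_def by simp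
    finally show ?thesis .
  qed
  have isp: "is_phi_tilde ?f"
    using lie corestriction by (auto simp: ext_def)
  have "phi_tilde sc R = ?f"
    unfolding phi_tilde_def Let_def
    by (rule the_equality, rule isp, rule is_phi_tilde_unique, assumption, rule isp)
  moreover have "phi_like ?f"
    using lf d fG unfolding phi_like_def by simp
  ultimately show "phi_like (phi_tilde sc R)"
    "\<And>n x. x \<in> G n \<Longrightarrow> DD (phi_tilde sc R) (DD (phi_tilde sc R) (GC.e [x])) = 0"
    using sqf by auto
qed

section \<open>The quasi-isomorphism\<close>

abbreviation Dtot where "Dtot \<equiv> DD (phi_tilde sc R)"

lemma phi_tilde_lin_deg: "GC.lin_deg (phi_tilde sc R)"
  using phi_tilde_properties(1) unfolding phi_like_def by blast

lemma Dtot_square: "F \<in> GC.Sn n \<Longrightarrow> Dtot (Dtot F) = 0"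
  by (rule CC.D_square[OF phi_tilde_lin_deg phi_tilde_properties(2)])

lemma Dtot_chain: "chain_complex GC.Sn Dtot"
  unfolding chain_complex_def lin_on_def
  using GC.odd_derivationD[OF CC.D_odd[OF phi_tilde_lin_deg]] GC.Sn_sub Dtot_square by blast

lemma quot_sub: "fsubspace (quot_alg sc R n)"
  unfolding quot_alg_def alg_part_def by (rule fs.subspace_span)

lemma quot_chain: "chain_complex (quot_alg sc R) (\<lambda>_. 0)"
  unfolding chain_complex_def lin_on_def using quot_sub fs.subspace_0 by auto

lemma g_in_quot:
  assumes "F \<in> GC.Sn n"
  shows "g_kappa sc R F \<in> quot_alg sc R n"
proof (cases "n = 0")
  case True
  obtain K where K: "K \<in> S" "F = J K" using J_onto assms True by blast
  have "proj R K \<in> quot_alg sc R 0"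
    by (rule S_mem[OF K(1) lin_on_proj quot_sub]) (auto simp: proj_e quot_alg_0 intro: fs.span_base)
  then show ?thesis using g_kappa_J[OF R_S K(1)] K(2) True by simp
next
  case False
  then show ?thesis using g_kappa_other[OF R_S assms False] fs.subspace_0[OF quot_sub] by simp
qed

text \<open>Boundaries of degree \<open>0\<close> come from the ideal \<open>(R)\<close>; in other degrees the target vanishes.\<close>

lemma g_boundary:
  assumes "F \<in> GC.Sn n"
  shows "g_kappa sc R (Dtot F) = 0"
proof (cases "n = 1")
  case True
  obtain K where K: "K \<in> ideal sc R" "Dtot F = J K"
    using boundary_in_ideal[OF phi_tilde_properties(1)] assms True by blast
  have "K \<in> S" using K(1) ideal_in_S[OF R_S] by blast
  then show ?thesis using g_kappa_J[OF R_S] proj_ideal[OF K(1)] K(2) by simp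
next
  case False
  then show ?thesis
    using g_kappa_other[OF R_S GC.odd_derivationD(3)[OF CC.D_odd[OF phi_tilde_lin_deg] assms]] by simp
qed

lemma g_chain_map: "chain_map GC.Sn Dtot (quot_alg sc R) (\<lambda>_. 0) (g_kappa sc R)"
  unfolding chain_map_def lin_on_def
proof (intro allI conjI ballI)
  fix n F assume F: "F \<in> GC.Sn n"
  show "g_kappa sc R F \<in> quot_alg sc R n" by (rule g_in_quot[OF F])
  show "g_kappa sc R (Dtot F) = 0" by (rule g_boundary[OF F])
qed (rule g_kappa_linear)+

lemma g_surjective: "quot_alg sc R 0 \<subseteq> proj R ` S"
  unfolding quot_alg_0
  by (rule fs.span_minimal[OF _ lin_on_image[OF lin_on_proj fs.subspace_span]])
    (auto simp: proj_e[symmetric] intro: e_S)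

lemma quasi_iso: "quasi_isomorphism GC.Sn Dtot (quot_alg sc R) (\<lambda>_. 0) (g_kappa sc R)"
  unfolding quasi_isomorphism_def
proof (intro conjI allI)
  show "chain_complex GC.Sn Dtot" by (rule Dtot_chain)
  show "chain_complex (quot_alg sc R) (\<lambda>_. 0)" by (rule quot_chain)
  show "chain_map GC.Sn Dtot (quot_alg sc R) (\<lambda>_. 0) (g_kappa sc R)" by (rule g_chain_map)
  fix n
  show "bij_betw (homology_map (quot_alg sc R) (\<lambda>_. 0) (g_kappa sc R) n)
      (homology GC.Sn Dtot n) (homology (quot_alg sc R) (\<lambda>_. 0) n)"
  proof (rule bij_homologyI[OF Dtot_chain quot_chain g_chain_map])
    fix F assume F: "F \<in> cycles GC.Sn Dtot n"
      and gF: "g_kappa sc R F \<in> boundaries (quot_alg sc R) (\<lambda>_. 0) n"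
    have FS: "F \<in> GC.Sn n" "Dtot F = 0" using F by (auto simp: cycles_def)
    show "F \<in> boundaries GC.Sn Dtot n"
    proof (cases "n = 0")
      case True
      obtain K where K: "K \<in> S" "F = J K" using J_onto FS(1) True by blast
      have "proj R K = 0" using gF g_kappa_J[OF R_S K(1)] K(2) by (auto simp: boundaries_def)
      then have "K \<in> ideal sc R" by (rule proj_kernel[OF R_S K(1)])
      then show ?thesis
        using ideal_in_boundary[OF phi_tilde_properties(1)] K(2) True by (auto simp: boundaries_def)
    next
      case False
      have "\<exists>K\<in>GC.Sn (n + 1). F = Dtot K"
        by (rule CC.D_acyclic[OF phi_tilde_lin_deg _ False FS]) (rule Dtot_square)
      then show ?thesis by (auto simp: boundaries_def)
    qed
  next
    fix y assume "y \<in> cycles (quot_alg sc R) (\<lambda>_. 0) n"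
    then have y: "y \<in> quot_alg sc R n" by (simp add: cycles_def)
    have 0: "0 \<in> boundaries (quot_alg sc R) (\<lambda>_. 0) n"
      unfolding boundaries_def using fs.subspace_0[OF quot_sub] by force
    show "\<exists>x\<in>cycles GC.Sn Dtot n. y - g_kappa sc R x \<in> boundaries (quot_alg sc R) (\<lambda>_. 0) n"
    proof (cases "n = 0")
      case True
      obtain F where F: "F \<in> S" "y = proj R F" using g_surjective y True by blast
      have "J F \<in> cycles GC.Sn Dtot n"
        using J_Sn[OF F(1)] DD_zero[OF phi_tilde_lin_deg F(1)] True by (simp add: cycles_def)
      moreover have "y - g_kappa sc R (J F) = 0" using g_kappa_J[OF R_S F(1)] F(2) by simp
      ultimately show ?thesis using 0 by metis
    next
      case False
      then have "y = 0" using y quot_alg_other by blast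
      moreover have "0 \<in> cycles GC.Sn Dtot n"
        using GC.Sn_intros(3) GC.odd_derivation_zero[OF CC.D_odd[OF phi_tilde_lin_deg]] by (simp add: cycles_def)
      ultimately show ?thesis using 0 g_kappa_linear(3) by (metis diff_0_right)
    qed
  qed
qed

end

theorem theorem5p1:
  fixes sc :: "'k::field_char_0 \<Rightarrow> 'v::ab_group_add \<Rightarrow> 'v"
    and R :: "('v, 'k) words set"
  defines "G \<equiv> koszul_dual sc (qR sc R)"
  assumes "commutative_QLC sc R"
    and "qA_koszul sc R"
  shows "quasi_isomorphism
           (cobar G) (cobar_diff G (sub_cobracket sc G) (phi_tilde sc R) (theta_tilde sc R))
           (quot_alg sc R) (\<lambda>_. 0)
           (g_kappa sc R)"
proof -
  interpret koszul_qlc sc R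
    using assms(2,3)
    by (simp add: koszul_qlc_def koszul_qlc_axioms_def qlc_def qlc_axioms_def ground_space_def
        commutative_QLC_def)
  show ?thesis
    unfolding G_def GC.cobar_eq by (rule quasi_iso)
qed

end
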